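(* Let $p\in[1,\infty)$ and $\beta\in\Omega_{p,n}$, where $\Omega_{1,n}:=(-\infty,1-\frac1n)\cup(1,\infty)$ and $\Omega_{p,n}:=\mathbb{R}\setminus\{\frac1p\}$ if $p\in(1,\infty)$. (i) There exists a positive constant $C$, depending only on $p$, $n$, and $\beta$, such that, for any $\upsilon\in A_1$, any dyadic grid $\mathcal{D}$, and any $f\in\dot W^{1,p}_\upsilon$, $$\sup_{\lambda\in(0,\infty)}\lambda^p\sum_{Q\in\mathcal{D}_{\lambda,\beta+1-\frac1p}[f]}|Q|^{\beta p-1}\upsilon(Q)\le C[\upsilon]_{A_1}\left\|\,|\nabla f|\,\right\|_{L^p_\upsilon}^p.$$ (ii) There exists a positive constant $C$, depending only on $p$, $n$, and $\beta$, such that, for any $\upsilon\in A_p$, any dyadic grid $\mathcal{D}$, and any $f\in\dot W^{1,p}_\upsilon$, $$\sup_{\lambda\in(0,\infty)}\lambda^p\sum_{Q\in\mathcal{D}_{\lambda,\beta+1-\frac1p}[f]}|Q|^{\beta p-1}\upsilon(Q)\le C[\upsilon]_{A_p}^{\alpha_{p,\beta}}\left\|\,|\nabla f|\,\right\|_{L^p_\upsilon}^p,$$ where $\alpha_{p,\beta}:=\frac{p}{p-1}$ if $p\in(1,\infty)$ and $\beta\in[\frac1p-1,\frac1p)$, and $\alpha_{p,\beta}:=1$ otherwise.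
   Context: Everything is on $\mathbb{R}^n$, $n\ge1$. Cubes have edges parallel to the coordinate axes; $l(Q)$ is the edge length of $Q$ and $|E|$ the Lebesgue measure of $E$. A dyadic grid is a countable set $\mathcal{D}$ of cubes such that: (1) each $Q\in\mathcal{D}$ has $l(Q)=2^k$ for some $k\in\mathbb{Z}$; (2) if $P,Q\in\mathcal{D}$, then $P\cap Q\in\{\emptyset,P,Q\}$; (3) for each $k\in\mathbb{Z}$, $\mathbb{R}^n=\bigcup_{\{Q\in\mathcal{D}:\,l(Q)=2^k\}}Q$. For a cube $Q$ and $f\in L^1_{\rm loc}$, $\omega_Q(f):=|Q|^{-1-\frac1n}\int_Q\int_Q|f(x)-f(y)|\,dx\,dy$. For $\lambda\in(0,\infty)$ and $b\in\mathbb{R}$, $\mathcal{D}_{\lambda,b}[f]:=\{Q\in\mathcal{D}:\omega_Q(f)>\lambda|Q|^b\}$. For a nonnegative locally integrable $\upsilon$, put $\upsilon(Q):=\int_Q\upsilon(x)\,dx$; $\upsilon\in A_p$ means $[\upsilon]_{A_p}<\infty$, where the following suprema are over all cubes $Q$: for $p\in(1,\infty)$, $[\upsilon]_{A_p}:=\sup_Q\big[\frac1{|Q|}\int_Q\upsilon\big]\big[\frac1{|Q|}\int_Q\upsilon^{-\frac1{p-1}}\big]^{p-1}$, and $[\upsilon]_{A_1}:=\sup_Q\big[\frac1{|Q|}\int_Q\upsilon\big]\|\upsilon^{-1}\|_{L^\infty(Q)}$. $\|g\|_{L^p_\upsilon}:=(\int_{\mathbb{R}^n}|g|^p\upsilon\,dx)^{1/p}$,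 and $\dot W^{1,p}_\upsilon$ is the set of all $f\in L^1_{\rm loc}$ whose weak gradient $\nabla f$ exists and satisfies $|\nabla f|\in L^p_\upsilon$. *)

theory Defs
  imports "HOL-Analysis.Analysis" "HOL-Probability.Essential_Supremum"
begin

text \<open>
  The space is \<^typ>\<open>real ^ 'n\<close>, of dimension \<open>n = CARD('n)\<close>, with the (complete)
  Lebesgue measure. Quantities that may be infinite take values in \<^typ>\<open>ennreal\<close>, where
  \<open>0 * top = 0\<close>.
\<close>

subsection \<open>Cubes and dyadic grids\<close>

text \<open>
  A cube of edge length \<open>l\<close> is a product of intervals of length \<open>l\<close>. Each interval may contain
  both, one or none of its end points, so open, closed and half-open cubes are all included.
\<close>

definition is_cube :: "real \<Rightarrow> (real ^ 'n) set \<Rightarrow> bool" where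
  "is_cube l Q \<longleftrightarrow> l > 0 \<and>
     (\<exists>(a :: real ^ 'n) (J :: 'n \<Rightarrow> real set).
        (\<forall>i. {a $ i <..< a $ i + l} \<subseteq> J i \<and> J i \<subseteq> {a $ i .. a $ i + l}) \<and>
        Q = {x. \<forall>i. x $ i \<in> J i})"

definition cubes :: "(real ^ 'n) set set" where
  "cubes = {Q. \<exists>l. is_cube l Q}"

definition dyadic_grid :: "(real ^ 'n) set set \<Rightarrow> bool" where
  "dyadic_grid D \<longleftrightarrow> countable D \<and>
     (\<forall>Q\<in>D. \<exists>k::int. is_cube (2 powi k) Q) \<and>
     (\<forall>P\<in>D. \<forall>Q\<in>D. P \<inter> Q \<in> {{}, P, Q}) \<and>
     (\<forall>k::int. UNIV = \<Union>{Q \<in> D. is_cube (2 powi k) Q})"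

subsection \<open>Local integrability and oscillations\<close>

definition locally_integrable :: "(real ^ 'n \<Rightarrow> 'b::{banach, second_countable_topology}) \<Rightarrow> bool" where
  "locally_integrable f \<longleftrightarrow> (\<forall>K. compact K \<longrightarrow> set_integrable lebesgue K f)"

definition oscillation :: "(real ^ 'n) set \<Rightarrow> (real ^ 'n \<Rightarrow> real) \<Rightarrow> real" where
  "oscillation Q f = measure lebesgue Q powr (- 1 - 1 / real CARD('n)) *
     (LINT y:Q|lebesgue. (LINT x:Q|lebesgue. \<bar>f x - f y\<bar>))"

definition level_cubes ::
  "(real ^ 'n) set set \<Rightarrow> real \<Rightarrow> real \<Rightarrow> (real ^ 'n \<Rightarrow> real) \<Rightarrow> (real ^ 'n) set set" where
  "level_cubes D lam b f = {Q \<in> D. oscillation Q f > lam * measure lebesgue Q powr b}"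

subsection \<open>Muckenhoupt weights\<close>

text \<open>
  Real powers on \<^typ>\<open>ennreal\<close>. Unlike \<^term>\<open>(powr) :: real \<Rightarrow> real \<Rightarrow> real\<close>, a negative power
  of \<open>0\<close> is \<open>top\<close>.
\<close>

definition ennpow :: "ennreal \<Rightarrow> real \<Rightarrow> ennreal" where
  "ennpow x r =
     (if r = 0 then 1
      else if x = 0 then (if r > 0 then 0 else top)
      else if x = top then (if r > 0 then top else 0)
      else ennreal (enn2real x powr r))"

definition weight :: "(real ^ 'n \<Rightarrow> real) \<Rightarrow> bool" where
  "weight v \<longleftrightarrow> (\<forall>x. v x \<ge> 0) \<and> locally_integrable v"

definition weight_of :: "(real ^ 'n \<Rightarrow> real) \<Rightarrow> (real ^ 'n) set \<Rightarrow> ennreal" where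
  "weight_of v Q = (\<integral>\<^sup>+x\<in>Q. ennreal (v x) \<partial>lebesgue)"

definition average :: "(real ^ 'n) set \<Rightarrow> (real ^ 'n \<Rightarrow> ennreal) \<Rightarrow> ennreal" where
  "average Q g = (\<integral>\<^sup>+x\<in>Q. g x \<partial>lebesgue) / emeasure lebesgue Q"

definition A_const :: "real \<Rightarrow> (real ^ 'n \<Rightarrow> real) \<Rightarrow> ennreal" where
  "A_const p v =
     (if p = 1 then
        (SUP Q\<in>cubes. average Q (\<lambda>x. ennreal (v x)) *
           esssup (restrict_space lebesgue Q) (\<lambda>x. inverse (ennreal (v x))))
      else
        (SUP Q\<in>cubes. average Q (\<lambda>x. ennreal (v x)) *
           ennpow (average Q (\<lambda>x. ennpow (ennreal (v x)) (- 1 / (p - 1)))) (p - 1)))"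

definition A_class :: "real \<Rightarrow> (real ^ 'n \<Rightarrow> real) set" where
  "A_class p = {v. weight v \<and> A_const p v < top}"

subsection \<open>Weak gradients and homogeneous weighted Sobolev spaces\<close>

definition partial :: "'n \<Rightarrow> (real ^ 'n \<Rightarrow> real) \<Rightarrow> real ^ 'n \<Rightarrow> real" where
  "partial i \<phi> x = frechet_derivative \<phi> (at x) (axis i 1)"

primrec Ck :: "nat \<Rightarrow> (real ^ 'n \<Rightarrow> real) \<Rightarrow> bool" where
  "Ck 0 \<phi> \<longleftrightarrow> continuous_on UNIV \<phi>"
| "Ck (Suc k) \<phi> \<longleftrightarrow> (\<forall>x. \<phi> differentiable (at x)) \<and> (\<forall>i. Ck k (partial i \<phi>))"

definition test_function :: "(real ^ 'n \<Rightarrow> real) \<Rightarrow> bool" where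
  "test_function \<phi> \<longleftrightarrow> (\<forall>k. Ck k \<phi>) \<and> compact (closure {x. \<phi> x \<noteq> 0})"

definition has_weak_gradient :: "(real ^ 'n \<Rightarrow> real) \<Rightarrow> (real ^ 'n \<Rightarrow> real ^ 'n) \<Rightarrow> bool" where
  "has_weak_gradient f G \<longleftrightarrow> locally_integrable G \<and>
     (\<forall>\<phi>. test_function \<phi> \<longrightarrow>
        (\<forall>i. (LINT x|lebesgue. f x * partial i \<phi> x) = - (LINT x|lebesgue. G x $ i * \<phi> x)))"

definition Lp_norm :: "real \<Rightarrow> (real ^ 'n \<Rightarrow> real) \<Rightarrow> (real ^ 'n \<Rightarrow> real) \<Rightarrow> ennreal" where
  "Lp_norm p v g = ennpow (\<integral>\<^sup>+x. ennreal (\<bar>g x\<bar> powr p * v x) \<partial>lebesgue) (1 / p)"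

definition sobolev :: "real \<Rightarrow> (real ^ 'n \<Rightarrow> real) \<Rightarrow> (real ^ 'n \<Rightarrow> real) set" where
  "sobolev p v = {f. locally_integrable f \<and>
     (\<exists>G. has_weak_gradient f G \<and> Lp_norm p v (\<lambda>x. norm (G x)) < top)}"

subsection \<open>Parameters and the quantity to be estimated\<close>

definition Omega :: "real \<Rightarrow> nat \<Rightarrow> real set" where
  "Omega p n = (if p = 1 then {..< 1 - 1 / real n} \<union> {1 <..} else UNIV - {1 / p})"

definition alpha :: "real \<Rightarrow> real \<Rightarrow> real" where
  "alpha p \<beta> = (if p > 1 \<and> \<beta> \<in> {1 / p - 1 ..< 1 / p} then p / (p - 1) else 1)"

definition level_sup ::
  "real \<Rightarrow> real \<Rightarrow> (real ^ 'n \<Rightarrow> real) \<Rightarrow> (real ^ 'n) set set \<Rightarrow> (real ^ 'n \<Rightarrow> real) \<Rightarrow> ennreal" where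
  "level_sup p \<beta> v D f =
     (SUP lam\<in>{0 <..}. ennreal (lam powr p) *
        (\<Sum>\<^sub>\<infinity>Q\<in>level_cubes D lam (\<beta> + 1 - 1 / p) f.
           ennreal (measure lebesgue Q powr (\<beta> * p - 1)) * weight_of v Q))"

end

theory Submission
  imports Defs
begin

text \<open>
  Poincare's inequality bounds the oscillation of \<open>f\<close> on a cube \<open>Q\<close> by the mass of
  \<open>g = |\<nabla>f|\<close> on \<open>Q\<close>, so that every level cube has a large average of \<open>g\<close>. In this
  form the estimate reduces to a sum over a finite laminar family of cubes, and one uses

  \<^item> the maximal cubes of the family if \<open>\<beta> > 1/p\<close>,
  \<^item> its minimal cubes if \<open>\<beta> < 1/p - 1\<close>,
  \<^item> truncation of \<open>g\<close> at the height prescribed by the size of the cube if \<open>v \<in> A\<^sub>1\<close>, \<open>p > 1\<close>,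
  \<^item> Lerner's proof of Buckley's inequality in the remaining range for \<open>v \<in> A\<^sub>p\<close>, \<open>p > 1\<close>.

  For \<open>p = 1\<close> and \<open>0 \<le> \<beta> < 1 - 1/n\<close> the mass of \<open>g\<close> alone does not suffice. Fix
  \<open>n\<beta> < s < n - 1\<close>. A greedy selection, from small to large cubes, keeps a subfamily that carries a
  fixed fraction of the sum and is sparse: the cubes strictly inside a selected \<open>Q\<close> satisfy
  \<open>\<Sum> l(P)\<^sup>s \<le> l(Q)\<^sup>s\<close>. Since \<open>s < n - 1\<close>, most lines parallel to the axes miss the small
  cubes, and the mass of \<open>g\<close> in a small cube \<open>P\<close> contributes to the oscillation on \<open>Q\<close> only with
  a factor \<open>(l(P) / l(Q))\<^sup>a\<close>. These factors form a geometric series in \<open>Q\<close>.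
\<close>

section \<open>Smooth bump functions\<close>

text \<open>The average of g on a level cube is at least a height \<open>thr\<close>, a multiple of
  \<lambda>|Q|^(\<beta> - 1/p), and the coefficient \<lambda>^p |Q|^(\<beta> p - 1) is a multiple of
  \<open>thr\<close>^p. Through a point there passes at most one cube per scale, and for \<beta>
  \<noteq> 1/p the heights along this tower form a geometric sequence; the estimates rest on such
  series. For p = 1 the truncation has no exponent p - 1 > 0 to sum with, and for 0 < \<beta> < 1
  mass alone is not enough: if it is spread evenly over a Cantor set of dimension n\<beta>, all
  generations of cubes contribute equally. A gradient cannot do this below dimension n - 1; hence
  the bound \<beta> < 1 - 1/n, and hence a Poincare inequality from whose right-hand side small
  cubes can be removed. It is proved from the weak gradient along axis-parallel paths, which shows
  the mass that is actually met. The removed cubes must be small compared with the cube considered,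
  so f is compared with a constant on successively halved subcubes, with smaller holes in
  each.\<close>

text \<open>The powers of \<open>t\<close> in the denominator make the span of this family closed under derivatives.\<close>

definition bump :: "nat \<Rightarrow> real \<Rightarrow> real" where
  "bump j t = (if t > 0 then exp (- 1 / t) / t ^ j else 0)"

lemma bump_tendsto_0_at_right: "((\<lambda>h. exp (- 1 / h) / h ^ m) \<longlongrightarrow> (0::real)) (at_right 0)"
proof -
  have "((\<lambda>x. x ^ m / exp x) \<longlongrightarrow> (0::real)) at_top"
    by (rule tendsto_power_div_exp_0)
  then show ?thesis
    unfolding filterlim_at_right_to_top
    by (rule Lim_transform_eventually)
       (use eventually_gt_at_top[of "0::real"] in eventually_elim,
        auto simp: exp_minus divide_inverse power_inverse)
qed

lemma bump_has_derivative:
  "(bump j has_real_derivative (- real j * bump (j + 1) t + bump (j + 2) t)) (at t)"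
proof -
  consider "t > 0" | "t < 0" | "t = 0" by linarith
  then show ?thesis
  proof cases
    case 1
    have "((\<lambda>t. exp (- 1 / t) / t ^ j) has_real_derivative
            (- real j * bump (j + 1) t + bump (j + 2) t)) (at t)"
    proof -
      have "real j * t ^ (j - Suc 0) * t = real j * t ^ j"
        by (cases j) auto
      then show ?thesis
        using 1 by (auto intro!: derivative_eq_intros simp: bump_def field_simps power2_eq_square)
    qed
    then show ?thesis
      by (rule has_field_derivative_transform_within_open[where S="{0<..}"])
         (use 1 in \<open>auto simp: bump_def\<close>)
  next
    case 2
    have "((\<lambda>t. 0) has_real_derivative (- real j * bump (j + 1) t + bump (j + 2) t)) (at t)"
      using 2 by (auto simp: bump_def)
    then show ?thesis
      by (rule has_field_derivative_transform_within_open[where S="{..<0}"])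
         (use 2 in \<open>auto simp: bump_def\<close>)
  next
    case 3
    \<comment> \<open>For h > 0 the difference quotient at 0 is \<open>bump (Suc j) h\<close>, which
      is again flat at 0.\<close>
    have "((\<lambda>h. bump j h / h) \<longlongrightarrow> 0) (at_right 0)"
      by (rule Lim_transform_eventually[OF bump_tendsto_0_at_right[of "Suc j"]])
         (use eventually_at_right_less[of "0::real"] in eventually_elim, auto simp: bump_def)
    moreover have "((\<lambda>h. bump j h / h) \<longlongrightarrow> 0) (at_left 0)"
      by (rule Lim_transform_eventually[OF tendsto_const[of 0]])
         (auto simp: bump_def eventually_at_filter)
    ultimately have "((\<lambda>h. bump j h / h) \<longlongrightarrow> 0) (at 0)"
      by (simp add: filterlim_split_at)
    then show ?thesis
      using 3 by (simp add: DERIV_def bump_def)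
  qed
qed

lemma bump_bounds: "0 \<le> bump 0 t" "bump 0 t \<le> 1"
  by (auto simp: bump_def)

lemma bump_mult_tendsto: "(\<lambda>m. bump 0 (real m * t)) \<longlonglongrightarrow> (if t > 0 then 1 else 0)"
proof (cases "t > 0")
  case True
  have "(\<lambda>m. exp (- 1 / t * (1 / real m))) \<longlonglongrightarrow> exp (- 1 / t * 0)"
    by (intro tendsto_intros lim_1_over_n)
  then show ?thesis
  proof (rule Lim_transform_eventually[THEN subst[of _ _ "\<lambda>l. _ \<longlonglongrightarrow> l", rotated]])
    show "\<forall>\<^sub>F m in sequentially. exp (- 1 / t * (1 / real m)) = bump 0 (real m * t)"
      using eventually_gt_at_top[of 0] by eventually_elim (use True in \<open>simp add: bump_def\<close>)
  qed (use True in simp)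
next
  case False
  then have "bump 0 (real m * t) = 0" for m
    by (auto simp: bump_def zero_less_mult_iff)
  then show ?thesis using False by simp
qed

text \<open>The algebra generated by bumps of affine functions of one coordinate. It is closed under
  \<open>partial\<close>, so membership gives \<open>Ck k\<close> for every k by induction, and it
  contains every test function that the proof uses.\<close>

inductive smooth_fun :: "(real ^ 'n \<Rightarrow> real) \<Rightarrow> bool" where
  bump: "smooth_fun (\<lambda>x. bump j (c + m * x $ i))"
| const: "smooth_fun (\<lambda>x. c)"
| add: "smooth_fun f \<Longrightarrow> smooth_fun g \<Longrightarrow> smooth_fun (\<lambda>x. f x + g x)"
| mult: "smooth_fun f \<Longrightarrow> smooth_fun g \<Longrightarrow> smooth_fun (\<lambda>x. f x * g x)"

lemma smooth_fun_derivative: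
  fixes f :: "real ^ 'n \<Rightarrow> real"
  assumes "smooth_fun f"
  shows "\<exists>F. (\<forall>i. smooth_fun (F i)) \<and> (\<forall>x. (f has_derivative (\<lambda>h. \<Sum>i\<in>UNIV. h $ i * F i x)) (at x))"
  using assms
proof induction
  case (bump j c m i)
  define b :: "real ^ 'n \<Rightarrow> real" where "b = (\<lambda>x. m * (- real j * bump (j + 1) (c + m * x $ i) + bump (j + 2) (c + m * x $ i)))"
  define F where "F = (\<lambda>k::'n. if k = i then b else (\<lambda>x. 0))"
  have "smooth_fun b"
    unfolding b_def by (intro smooth_fun.intros)
  then have "smooth_fun (F k)" for k
    by (auto simp: F_def intro: smooth_fun.const)
  moreover have "((\<lambda>x. bump j (c + m * x $ i)) has_derivative (\<lambda>h. \<Sum>i\<in>UNIV. h $ i * F i x)) (at x)" for x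
  proof -
    have "(bump j has_derivative (\<lambda>h. h * (- real j * bump (j + 1) (c + m * x $ i) + bump (j + 2) (c + m * x $ i)))) (at (c + m * x $ i))"
      using bump_has_derivative[of j "c + m * x $ i"] unfolding has_field_derivative_def
      by (rule has_derivative_eq_rhs) (simp add: fun_eq_iff)
    moreover have "((\<lambda>x. c + m * x $ i) has_derivative (\<lambda>h. m * h $ i)) (at x)"
      by (auto intro!: derivative_eq_intros bounded_linear.has_derivative[OF bounded_linear_vec_nth])
    ultimately have "((\<lambda>x. bump j (c + m * x $ i)) has_derivative (\<lambda>h. m * h $ i * (- real j * bump (j + 1) (c + m * x $ i) + bump (j + 2) (c + m * x $ i)))) (at x)"
      by (rule has_derivative_compose[rotated])
    moreover have "(\<Sum>k\<in>UNIV. h $ k * F k x) = m * h $ i * (- real j * bump (j + 1) (c + m * x $ i) + bump (j + 2) (c + m * x $ i))" for h :: "real ^ 'n"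
      by (simp add: F_def b_def if_distrib[of "\<lambda>g. _ * g x" for x] algebra_simps cong: if_cong)
    ultimately show ?thesis by simp
  qed
  ultimately show ?case by blast
next
  case (const c)
  show ?case
    by (intro exI[of _ "\<lambda>i x. 0"]) (auto intro: smooth_fun.const)
next
  case (add f g)
  then obtain F G where F: "\<forall>i. smooth_fun (F i)" "\<forall>x. (f has_derivative (\<lambda>h. \<Sum>i\<in>UNIV. h $ i * F i x)) (at x)"
    and G: "\<forall>i. smooth_fun (G i)" "\<forall>x. (g has_derivative (\<lambda>h. \<Sum>i\<in>UNIV. h $ i * G i x)) (at x)"
    by blast
  show ?case
  proof (intro exI[of _ "\<lambda>i x. F i x + G i x"] conjI allI)
    show "smooth_fun (\<lambda>x. F i x + G i x)" for i using F G by (auto intro: smooth_fun.add)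
    show "((\<lambda>x. f x + g x) has_derivative (\<lambda>h. \<Sum>i\<in>UNIV. h $ i * (F i x + G i x))) (at x)" for x
      using has_derivative_add[OF F(2)[rule_format, of x] G(2)[rule_format, of x]]
      by (simp add: sum.distrib distrib_left)
  qed
next
  case (mult f g)
  then obtain F G where F: "\<forall>i. smooth_fun (F i)" "\<forall>x. (f has_derivative (\<lambda>h. \<Sum>i\<in>UNIV. h $ i * F i x)) (at x)"
    and G: "\<forall>i. smooth_fun (G i)" "\<forall>x. (g has_derivative (\<lambda>h. \<Sum>i\<in>UNIV. h $ i * G i x)) (at x)"
    by blast
  show ?case
  proof (intro exI[of _ "\<lambda>i x. f x * G i x + F i x * g x"] conjI allI)
    show "smooth_fun (\<lambda>x. f x * G i x + F i x * g x)" for i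
      using F G mult by (intro smooth_fun.intros) auto
    show "((\<lambda>x. f x * g x) has_derivative (\<lambda>h. \<Sum>i\<in>UNIV. h $ i * (f x * G i x + F i x * g x))) (at x)" for x
      using has_derivative_mult[OF F(2)[rule_format, of x] G(2)[rule_format, of x]]
      by (simp add: sum.distrib sum_distrib_left sum_distrib_right algebra_simps)
  qed
qed

lemma smooth_fun_partial:
  fixes f :: "real ^ 'n \<Rightarrow> real"
  assumes "smooth_fun f"
  shows "smooth_fun (partial i f)" "(f has_derivative (\<lambda>h. \<Sum>i\<in>UNIV. h $ i * partial i f x)) (at x)"
proof -
  obtain F where F: "\<forall>i. smooth_fun (F i)" "\<And>x. (f has_derivative (\<lambda>h. \<Sum>i\<in>UNIV. h $ i * F i x)) (at x)"
    using smooth_fun_derivative[OF assms] by blast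
  have eq: "partial i f = F i" for i
  proof
    fix x
    have "frechet_derivative f (at x) = (\<lambda>h. \<Sum>i\<in>UNIV. h $ i * F i x)"
      using frechet_derivative_at[OF F(2)[of x]] by simp
    then show "partial i f x = F i x"
      by (simp add: partial_def axis_def if_distrib[of "\<lambda>a. a * _"] cong: if_cong)
  qed
  show "smooth_fun (partial i f)" "(f has_derivative (\<lambda>h. \<Sum>i\<in>UNIV. h $ i * partial i f x)) (at x)"
    using F by (auto simp: eq)
qed

lemma smooth_fun_continuous: "smooth_fun f \<Longrightarrow> continuous_on A f"
  by (meson continuous_at_imp_continuous_on has_derivative_continuous smooth_fun_partial(2))

lemma smooth_fun_Ck: "smooth_fun f \<Longrightarrow> Ck k f"
proof (induction k arbitrary: f)
  case (Suc k)
  then show ?case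
    using smooth_fun_partial[OF Suc.prems] by (auto simp: differentiable_def)
qed (simp add: smooth_fun_continuous)

lemma smooth_fun_prod: "finite A \<Longrightarrow> (\<And>i. i \<in> A \<Longrightarrow> smooth_fun (f i)) \<Longrightarrow> smooth_fun (\<lambda>x. \<Prod>i\<in>A. f i x)"
  by (induction A rule: finite_induct) (auto intro: smooth_fun.const smooth_fun.mult)

text \<open>Smooth functions supported in a box that tend to its indicator as m grows. The family is
  closed under translation, which lets the weak identity be shifted along a line.\<close>

definition box_bump :: "real ^ 'n \<Rightarrow> real ^ 'n \<Rightarrow> nat \<Rightarrow> real ^ 'n \<Rightarrow> real" where
  "box_bump a b m x = (\<Prod>i\<in>UNIV. bump 0 (real m * (x $ i - a $ i)) * bump 0 (real m * (b $ i - x $ i)))"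

lemma smooth_fun_box_bump: "smooth_fun (box_bump a b m)"
proof -
  have "smooth_fun (\<lambda>x. bump 0 (- (real m * a $ i) + real m * x $ i) * bump 0 (real m * b $ i + (- real m) * x $ i))" for i
    by (intro smooth_fun.intros)
  then have "smooth_fun (\<lambda>x. \<Prod>i\<in>UNIV. bump 0 (- (real m * a $ i) + real m * x $ i) * bump 0 (real m * b $ i + (- real m) * x $ i))"
    by (intro smooth_fun_prod) auto
  moreover have "(\<lambda>x. \<Prod>i\<in>UNIV. bump 0 (- (real m * a $ i) + real m * x $ i) * bump 0 (real m * b $ i + (- real m) * x $ i)) = box_bump a b m"
    by (auto simp: box_bump_def algebra_simps)
  ultimately show ?thesis by simp
qed

lemma box_bump_bounds: "0 \<le> box_bump a b m x" "box_bump a b m x \<le> 1"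
  unfolding box_bump_def
  by (auto intro!: prod_nonneg prod_le_1 mult_le_one simp: bump_bounds)

lemma box_bump_zero: "x \<notin> box a b \<Longrightarrow> box_bump a b m x = 0"
  unfolding box_bump_def mem_box_cart not_all
  by (auto simp: bump_def zero_less_mult_iff)

lemma box_bump_tendsto: "(\<lambda>m. box_bump a b m x) \<longlonglongrightarrow> indicator (box a b) x"
proof -
  have "(\<lambda>m. box_bump a b m x) \<longlonglongrightarrow>
     (\<Prod>i\<in>UNIV. (if x $ i - a $ i > 0 then 1 else 0) * (if b $ i - x $ i > 0 then 1 else 0))"
    unfolding box_bump_def by (intro tendsto_prod tendsto_mult bump_mult_tendsto)
  also have "(\<Prod>i\<in>UNIV. (if x $ i - a $ i > 0 then 1 else 0) * (if b $ i - x $ i > 0 then 1 else 0)) = (indicator (box a b) x :: real)"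
    by (auto simp: indicator_def mem_box_cart)
  finally show ?thesis .
qed

lemma box_bump_translate: "box_bump a b m (x - c) = box_bump (a + c) (b + c) m x"
  by (simp add: box_bump_def algebra_simps)

lemma test_function_box_bump: "test_function (box_bump a b m)"
proof -
  have "closure {x. box_bump a b m x \<noteq> 0} \<subseteq> closure (cbox a b)"
    using box_bump_zero box_subset_cbox by (intro closure_mono) blast
  then have "compact (closure {x. box_bump a b m x \<noteq> 0})"
    by (meson bounded_cbox bounded_closure bounded_subset compact_eq_bounded_closed closed_closure)
  then show ?thesis
    by (simp add: test_function_def smooth_fun_Ck smooth_fun_box_bump)
qed

section \<open>Integrals along lines\<close>

lemma lborel_translate:
  fixes f :: "'a::euclidean_space \<Rightarrow> 'b::{banach, second_countable_topology}"
  assumes [measurable]: "f \<in> borel_measurable borel"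
  shows "(\<integral>x. f (x + c) \<partial>lborel) = (\<integral>x. f x \<partial>lborel)"
    and "integrable lborel (\<lambda>x. f (x + c)) \<longleftrightarrow> integrable lborel f"
proof -
  have "lborel = distr lborel borel (\<lambda>x. x + c)"
    using lborel_distr_plus[of c] by (subst add.commute) (rule sym)
  note eq = this
  show "(\<integral>x. f (x + c) \<partial>lborel) = (\<integral>x. f x \<partial>lborel)"
    by (subst (2) eq, subst integral_distr) auto
  show "integrable lborel (\<lambda>x. f (x + c)) \<longleftrightarrow> integrable lborel f"
    by (subst (2) eq, subst integrable_distr_eq) auto
qed

lemma nn_integral_lborel_translate:
  fixes f :: "'a::euclidean_space \<Rightarrow> ennreal"
  assumes [measurable]: "f \<in> borel_measurable borel"
  shows "(\<integral>\<^sup>+x. f (x + c) \<partial>lborel) = (\<integral>\<^sup>+x. f x \<partial>lborel)"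
proof -
  have "(\<integral>\<^sup>+x. f x \<partial>lborel) = (\<integral>\<^sup>+x. f x \<partial>distr lborel borel ((+) c))"
    by (simp add: lborel_distr_plus)
  also have "\<dots> = (\<integral>\<^sup>+x. f (c + x) \<partial>lborel)"
    by (subst nn_integral_distr) auto
  finally show ?thesis by (simp add: add.commute)
qed

lemma AE_lborel_translate:
  fixes P :: "'a::euclidean_space \<Rightarrow> bool"
  assumes "AE x in lborel. P x"
  shows "AE x in lborel. P (x + c)"
proof -
  from assms obtain N where N: "{x. \<not> P x} \<subseteq> N" "N \<in> sets borel" "emeasure lborel N = 0"
    by (auto elim!: AE_E)
  show ?thesis
  proof (rule AE_I')
    have "{x. x + c \<in> N} = (\<lambda>x. x + c) -` N \<inter> space lborel" by auto
    moreover have "emeasure (distr lborel borel ((+) c)) N = emeasure lborel ((+) c -` N \<inter> space lborel)"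
      using N by (intro emeasure_distr) auto
    moreover have "(\<lambda>x. x + c) -` N \<inter> space lborel \<in> sets lborel"
      using N by (intro measurable_sets[where A=borel]) auto
    ultimately show "{x. x + c \<in> N} \<in> null_sets lborel"
      using N by (auto simp: null_sets_def lborel_distr_plus add.commute[of _ c])
    show "{x \<in> space lborel. \<not> P (x + c)} \<subseteq> {x. x + c \<in> N}"
      using N(1) by auto
  qed
qed

lemma enn2real_eqD:
  assumes "enn2real x = enn2real y" "x \<noteq> \<infinity>" "y \<noteq> \<infinity>"
  shows "x = y"
  using assms by (cases x; cases y) auto

text \<open>The positive and the negative part of D are densities of two measures that agree on all
  boxes. Boxes are stable under intersection and generate the Borel sets, so the measures are equal,
  and densities are unique up to null sets.\<close>

lemma AE_0_of_box_integrals: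
  fixes D :: "'a::euclidean_space \<Rightarrow> real"
  assumes [measurable]: "D \<in> borel_measurable borel"
    and int: "\<And>a b. set_integrable lborel (box a b) D"
    and zero: "\<And>a b. (\<integral>x. indicator (box a b) x * D x \<partial>lborel) = 0"
  shows "AE x in lborel. D x = 0"
proof -
  let ?A = "\<lambda>n::nat. box (- (real n *\<^sub>R One)) (real n *\<^sub>R One) :: 'a set"
  \<comment> \<open>\<open>ennreal\<close> sends negative reals to 0, so these are the positive and
    the negative part.\<close>
  let ?p = "\<lambda>x. ennreal (D x)" and ?m = "\<lambda>x. ennreal (- D x)"
  have fin: "(\<integral>\<^sup>+x. ?p x * indicator (box a b) x \<partial>lborel) < \<infinity>"
     and eq: "(\<integral>\<^sup>+x. ?p x * indicator (box a b) x \<partial>lborel) = (\<integral>\<^sup>+x. ?m x * indicator (box a b) x \<partial>lborel)" for a b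
  proof -
    have i: "integrable lborel (\<lambda>x. indicator (box a b) x * D x)"
      using int[of a b] by (simp add: set_integrable_def)
    have e: "(\<integral>\<^sup>+x. ?p x * indicator (box a b) x \<partial>lborel) = (\<integral>\<^sup>+x. ennreal (indicator (box a b) x * D x) \<partial>lborel)"
        "(\<integral>\<^sup>+x. ?m x * indicator (box a b) x \<partial>lborel) = (\<integral>\<^sup>+x. ennreal (- (indicator (box a b) x * D x)) \<partial>lborel)"
      by (auto intro!: nn_integral_cong split: split_indicator)
    note i' = integrableD[OF i]
    show "(\<integral>\<^sup>+x. ?p x * indicator (box a b) x \<partial>lborel) < \<infinity>"
      using i'(2) by (simp add: e less_top)
    have "enn2real (\<integral>\<^sup>+x. ennreal (indicator (box a b) x * D x) \<partial>lborel)
        = enn2real (\<integral>\<^sup>+x. ennreal (- (indicator (box a b) x * D x)) \<partial>lborel)"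
      using zero[of a b] by (simp add: real_lebesgue_integral_def[OF i])
    then show "(\<integral>\<^sup>+x. ?p x * indicator (box a b) x \<partial>lborel) = (\<integral>\<^sup>+x. ?m x * indicator (box a b) x \<partial>lborel)"
      unfolding e using i'(2,3) by (rule enn2real_eqD)
  qed
  have "density lborel ?p = density lborel ?m"
  proof (rule measure_eqI_generator_eq)
    let ?E = "range (\<lambda>(a, b). box a b::'a set)"
    show "Int_stable ?E"
      by (auto simp: Int_stable_def box_Int_box)
    show "?E \<subseteq> Pow UNIV" "sets (density lborel ?p) = sigma_sets UNIV ?E" "sets (density lborel ?m) = sigma_sets UNIV ?E"
      by (simp_all add: borel_eq_box)
    show "range ?A \<subseteq> ?E" "(\<Union>i. ?A i) = UNIV"
      unfolding UN_box_eq_UNIV by auto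
    show "emeasure (density lborel ?p) (?A i) \<noteq> \<infinity>" for i
      using fin by (simp add: emeasure_density less_top)
    show "emeasure (density lborel ?p) X = emeasure (density lborel ?m) X" if "X \<in> ?E" for X
      using that eq by (auto simp: emeasure_density)
  qed
  moreover have "sigma_finite_measure (density lborel ?p)"
  proof
    show "\<exists>A. countable A \<and> A \<subseteq> sets (density lborel ?p) \<and> \<Union> A = space (density lborel ?p) \<and>
        (\<forall>a\<in>A. emeasure (density lborel ?p) a \<noteq> \<infinity>)"
      using fin UN_box_eq_UNIV
      by (intro exI[of _ "range ?A"]) (auto simp: emeasure_density less_top)
  qed
  ultimately have "AE x in lborel. ?p x = ?m x"
    by (subst sigma_finite_density_unique[symmetric]) auto
  then show ?thesis
  proof eventually_elim
    case (elim x)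
    then show ?case
      by (cases "0 \<le> D x") (auto simp: ennreal_neg ennreal_eq_0_iff intro: sym)
  qed
qed

section \<open>Weak derivatives integrated along coordinate lines\<close>

lemma partial_translate:
  assumes "smooth_fun \<phi>"
  shows "partial i (\<lambda>x. \<phi> (x - c)) x = partial i \<phi> (x - c)"
proof -
  have "((\<lambda>x. x - c) has_derivative (\<lambda>h. h)) (at x)"
    by (auto intro!: derivative_eq_intros)
  from has_derivative_compose[OF this smooth_fun_partial(2)[OF assms]]
  have "((\<lambda>x. \<phi> (x - c)) has_derivative (\<lambda>h. \<Sum>i\<in>UNIV. h $ i * partial i \<phi> (x - c))) (at x)"
    by simp
  then have eq: "frechet_derivative (\<lambda>x. \<phi> (x - c)) (at x) = (\<lambda>h. \<Sum>i\<in>UNIV. h $ i * partial i \<phi> (x - c))"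
    by (rule frechet_derivative_at[symmetric])
  show ?thesis
    unfolding partial_def[of i "\<lambda>x. \<phi> (x - c)"] eq
    by (simp add: axis_def if_distrib[of "\<lambda>a. a * _"] cong: if_cong)
qed

lemma partial_box_bump_zero:
  assumes "x \<notin> cbox a b"
  shows "partial i (box_bump a b m) x = 0"
proof -
  have "((\<lambda>x. 0::real) has_derivative (\<lambda>h. 0)) (at x)" by simp
  then have "(box_bump a b m has_derivative (\<lambda>h. 0)) (at x)"
    by (rule has_derivative_transform_within_open[where s="- cbox a b"])
       (use assms box_bump_zero box_subset_cbox in \<open>force+\<close>)
  from frechet_derivative_at[OF this] show ?thesis
    by (metis partial_def)
qed

lemma partial_box_bump_bounded: "\<exists>B\<ge>0. \<forall>x. \<bar>partial i (box_bump a b m) x\<bar> \<le> B"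
proof -
  have "continuous_on (cbox a b) (partial i (box_bump a b m))"
    by (intro smooth_fun_continuous smooth_fun_partial smooth_fun_box_bump)
  then have "bounded (partial i (box_bump a b m) ` cbox a b)"
    by (intro compact_imp_bounded compact_continuous_image) auto
  then obtain B where B: "\<And>x. x \<in> cbox a b \<Longrightarrow> \<bar>partial i (box_bump a b m) x\<bar> \<le> B"
    unfolding bounded_iff by auto
  show ?thesis
  proof (intro exI[of _ "max B 0"] conjI allI)
    show "\<bar>partial i (box_bump a b m) x\<bar> \<le> max B 0" for x
      using B[of x] partial_box_bump_zero[of x a b i m] by (cases "x \<in> cbox a b") auto
  qed simp
qed

lemma sum_scaleR_axis:
  fixes P :: "'n::finite \<Rightarrow> real"
  shows "(\<Sum>k\<in>UNIV. (c *\<^sub>R axis i 1) $ k * P k) = c * P i"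
proof -
  have "(c *\<^sub>R axis i 1) $ k * P k = (if k = i then c * P i else 0)" for k
    by (simp add: axis_def)
  then show ?thesis by simp
qed

lemma smooth_fun_FTC:
  assumes "smooth_fun \<phi>" "0 \<le> s"
  shows "(\<integral>t. indicator {0..s} t * partial i \<phi> (z - t *\<^sub>R axis i 1) \<partial>lborel) = \<phi> z - \<phi> (z - s *\<^sub>R axis i 1)"
proof -
  have D: "((\<lambda>t. - \<phi> (z - t *\<^sub>R axis i 1)) has_vector_derivative partial i \<phi> (z - t *\<^sub>R axis i 1)) (at t within {0..s})" for t
  proof -
    have "((\<lambda>t. z - t *\<^sub>R axis i 1) has_derivative (\<lambda>h. (- h) *\<^sub>R axis i 1)) (at t)"
      by (auto intro!: derivative_eq_intros)
    from has_derivative_compose[OF this smooth_fun_partial(2)[OF assms(1)]]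
    have "((\<lambda>t. - \<phi> (z - t *\<^sub>R axis i 1)) has_derivative (\<lambda>h. h * partial i \<phi> (z - t *\<^sub>R axis i 1))) (at t)"
      unfolding sum_scaleR_axis by (auto dest: has_derivative_minus)
    then show ?thesis
      by (simp add: has_vector_derivative_def has_derivative_at_withinI)
  qed
  have "continuous_on {0..s} (\<lambda>t. partial i \<phi> (z - t *\<^sub>R axis i 1))"
    by (intro continuous_on_compose2[OF smooth_fun_continuous[OF smooth_fun_partial(1)[OF assms(1)], of UNIV]] continuous_intros) auto
  from integral_FTC_Icc[OF assms(2) D this] show ?thesis by simp
qed

lemma box_bump_zero_cbox: "x \<notin> cbox a b \<Longrightarrow> box_bump a b m x = 0"
  using box_bump_zero box_subset_cbox by blast

text \<open>By Tonelli, a bound on the slices that is uniform in t and supported in a bounded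
  interval suffices. It justifies the exchanges of integrals in
  \<open>AE_line_integral\<close>.\<close>

lemma integrable_lborel_bounded_strip:
  fixes H :: "real \<times> (real ^ 'n) \<Rightarrow> real"
  assumes [measurable]: "H \<in> borel_measurable (borel \<Otimes>\<^sub>M borel)"
    and "\<And>t. (\<integral>\<^sup>+z. ennreal \<bar>H (t, z)\<bar> \<partial>lborel) \<le> ennreal C * indicator {0..s} t"
  shows "integrable (lborel \<Otimes>\<^sub>M lborel) H"
  unfolding integrable_iff_bounded
proof
  show "H \<in> borel_measurable (lborel \<Otimes>\<^sub>M lborel)"
    by (simp add: measurable_cong_sets[OF sets_pair_measure_cong[OF sets_lborel sets_lborel] refl])
  have "(\<integral>\<^sup>+x. ennreal (norm (H x)) \<partial>(lborel \<Otimes>\<^sub>M lborel)) = (\<integral>\<^sup>+t. (\<integral>\<^sup>+z. ennreal \<bar>H (t, z)\<bar> \<partial>lborel) \<partial>lborel)"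
    by (subst lborel.nn_integral_fst[symmetric])
       (auto simp: measurable_cong_sets[OF sets_pair_measure_cong[OF sets_lborel sets_lborel] refl])
  also have "\<dots> \<le> (\<integral>\<^sup>+t. ennreal C * indicator {0..s} t \<partial>lborel)"
    by (intro nn_integral_mono assms)
  also have "\<dots> < \<infinity>"
    by (simp add: nn_integral_cmult ennreal_mult_less_top emeasure_lborel_Icc_eq)
  finally show "(\<integral>\<^sup>+x. ennreal (norm (H x)) \<partial>(lborel \<Otimes>\<^sub>M lborel)) < \<infinity>" .
qed

text \<open>The weak identity for the translates of a bump \<psi> by t e is integrated over 0 \<le>
  t \<le> s. On the left the derivative integrates to \<psi>(z) - \<psi>(z - s e) by the fundamental
  theorem; on the right Fubini produces the integral of g along the segment. Hence the defect
  \<open>D\<close> is orthogonal to all bumps and vanishes a.e. The null set may depend on s, which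
  is harmless: shifts are fixed before z is integrated.\<close>

lemma AE_line_integral:
  fixes f g :: "real ^ 'n \<Rightarrow> real"
  assumes [measurable]: "f \<in> borel_measurable borel" "g \<in> borel_measurable borel"
    and f: "\<And>a b. set_integrable lborel (cbox a b) f"
    and g: "\<And>a b. set_integrable lborel (cbox a b) g"
    and weak: "\<And>a b m. (\<integral>x. f x * partial i (box_bump a b m) x \<partial>lborel) = - (\<integral>x. g x * box_bump a b m x \<partial>lborel)"
    and s: "0 \<le> s"
  shows "AE z in lborel. f (z + s *\<^sub>R axis i 1) - f z = (\<integral>t. indicator {0..s} t * g (z + t *\<^sub>R axis i 1) \<partial>lborel)"
proof -
  let ?e = "axis i (1::real) :: real ^ 'n"
  define I where "I = (\<lambda>z. \<integral>t. indicator {0..s} t * g (z + t *\<^sub>R ?e) \<partial>lborel)"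
  define D where "D = (\<lambda>z. f (z + s *\<^sub>R ?e) - f z - I z)"
  have [measurable]: "I \<in> borel_measurable borel"
    unfolding I_def by measurable
  have [measurable]: "D \<in> borel_measurable borel"
    unfolding D_def by measurable
  have bigbox: "a \<le> a' \<Longrightarrow> b' \<le> b \<Longrightarrow> cbox a' b' \<subseteq> cbox a b" for a a' b b' :: "real ^ 'n"
    by (auto simp: less_eq_vec_def mem_box_cart) (meson order.trans)+
  have shift: "z + t *\<^sub>R ?e \<in> cbox a (b + s *\<^sub>R ?e)" if "z \<in> cbox a b" "t \<in> {0..s}" for a b z t
    using that by (auto simp: mem_box_cart axis_def intro: add_increasing2 add_mono)
  have shift': "z \<in> cbox a (b + s *\<^sub>R ?e)" if "z - t *\<^sub>R ?e \<in> cbox a b" "t \<in> {0..s}" for a b z t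
    using shift[OF that] by simp
  have fin: "(\<integral>\<^sup>+z. ennreal \<bar>indicator (cbox a b) z * h z\<bar> \<partial>lborel) = ennreal (\<integral>z. \<bar>indicator (cbox a b) z * h z\<bar> \<partial>lborel)"
    if "set_integrable lborel (cbox a b) h" for a b and h :: "real ^ 'n \<Rightarrow> real"
    using that unfolding set_integrable_def by (intro nn_integral_eq_integral) auto
  have int_gz: "integrable (lborel \<Otimes>\<^sub>M lborel) (\<lambda>(t, z). indicator {0..s} t * (indicator (cbox a b) z * g (z + t *\<^sub>R ?e)))" for a b
  proof (rule integrable_lborel_bounded_strip)
    fix t :: real
    have "(\<integral>\<^sup>+z. ennreal \<bar>case (t, z) of (t, z) \<Rightarrow> indicator {0..s} t * (indicator (cbox a b) z * g (z + t *\<^sub>R ?e))\<bar> \<partial>lborel)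
       \<le> (\<integral>\<^sup>+z. indicator {0..s} t * ennreal \<bar>indicator (cbox a (b + s *\<^sub>R ?e)) (z + t *\<^sub>R ?e) * g (z + t *\<^sub>R ?e)\<bar> \<partial>lborel)"
      using shift by (intro nn_integral_mono) (auto simp: indicator_def)
    also have "\<dots> = indicator {0..s} t * (\<integral>\<^sup>+z. ennreal \<bar>indicator (cbox a (b + s *\<^sub>R ?e)) (z + t *\<^sub>R ?e) * g (z + t *\<^sub>R ?e)\<bar> \<partial>lborel)"
      by (rule nn_integral_cmult) measurable
    also have "(\<integral>\<^sup>+z. ennreal \<bar>indicator (cbox a (b + s *\<^sub>R ?e)) (z + t *\<^sub>R ?e) * g (z + t *\<^sub>R ?e)\<bar> \<partial>lborel)
       = (\<integral>\<^sup>+z. ennreal \<bar>indicator (cbox a (b + s *\<^sub>R ?e)) z * g z\<bar> \<partial>lborel)"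
      by (rule nn_integral_lborel_translate[where f="\<lambda>z. ennreal \<bar>indicator (cbox a (b + s *\<^sub>R ?e)) z * g z\<bar>"]) measurable
    also have "\<dots> = ennreal (\<integral>z. \<bar>indicator (cbox a (b + s *\<^sub>R ?e)) z * g z\<bar> \<partial>lborel)"
      by (rule fin[OF g])
    finally show "(\<integral>\<^sup>+z. ennreal \<bar>case (t, z) of (t, z) \<Rightarrow> indicator {0..s} t * (indicator (cbox a b) z * g (z + t *\<^sub>R ?e))\<bar> \<partial>lborel)
       \<le> ennreal (\<integral>z. \<bar>indicator (cbox a (b + s *\<^sub>R ?e)) z * g z\<bar> \<partial>lborel) * indicator {0..s} t"
      by (simp add: mult.commute)
  qed measurable
  have I_eq: "(\<integral>t. indicator {0..s} t * (indicator (cbox a b) z * g (z + t *\<^sub>R ?e)) \<partial>lborel) = indicator (cbox a b) z * I z" for a b z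
    unfolding I_def by (cases "z \<in> cbox a b") auto
  have int_I: "set_integrable lborel (cbox a b) I" for a b
    using lborel_pair.integrable_snd[OF int_gz[of a b]]
    by (simp add: I_eq set_integrable_def)
  have int_fs: "set_integrable lborel (cbox a b) (\<lambda>z. f (z + s *\<^sub>R ?e))" for a b
  proof -
    have "integrable lborel (\<lambda>z. indicator (cbox (a + s *\<^sub>R ?e) (b + s *\<^sub>R ?e)) z * f z)"
      using f by (simp add: set_integrable_def)
    then have "integrable lborel (\<lambda>z. indicator (cbox (a + s *\<^sub>R ?e) (b + s *\<^sub>R ?e)) (z + s *\<^sub>R ?e) * f (z + s *\<^sub>R ?e))"
      by (subst lborel_translate(2)[where f="\<lambda>z. indicator (cbox (a + s *\<^sub>R ?e) (b + s *\<^sub>R ?e)) z * f z"]) auto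
    moreover have "indicator (cbox (a + s *\<^sub>R ?e) (b + s *\<^sub>R ?e)) (z + s *\<^sub>R ?e) = (indicator (cbox a b) z :: real)" for z
      by (auto simp: indicator_def mem_box_cart)
    ultimately show ?thesis by (simp add: set_integrable_def)
  qed
  have int_D: "set_integrable lborel (cbox a b) D" for a b
    unfolding D_def by (intro set_integral_diff int_fs f int_I)
  have bump_int: "integrable lborel (\<lambda>z. h z * box_bump a b m z)"
    if "set_integrable lborel (cbox a b) h" "h \<in> borel_measurable borel" for a b m and h :: "real ^ 'n \<Rightarrow> real"
  proof (rule Bochner_Integration.integrable_bound)
    show "integrable lborel (\<lambda>z. indicator (cbox a b) z * h z)"
      using that by (simp add: set_integrable_def)
    have [measurable]: "box_bump a b m \<in> borel_measurable borel"
      by (intro borel_measurable_continuous_onI smooth_fun_continuous smooth_fun_box_bump)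
    show "(\<lambda>z. h z * box_bump a b m z) \<in> borel_measurable lborel"
      using that by measurable
    show "AE z in lborel. norm (h z * box_bump a b m z) \<le> norm (indicator (cbox a b) z * h z)"
      using box_bump_bounds[of a b m] box_bump_zero_cbox[of _ a b m]
      by (intro AE_I2) (auto simp: abs_mult indicator_def intro!: mult_left_le)
  qed
  have zero_bump: "(\<integral>z. D z * box_bump a b m z \<partial>lborel) = 0" for a b m
  proof -
    define \<psi> where "\<psi> = box_bump a b m"
    define P where "P = partial i \<psi>"
    have sm: "smooth_fun \<psi>" "smooth_fun P"
      unfolding P_def \<psi>_def by (intro smooth_fun_box_bump smooth_fun_partial)+
    have [measurable]: "\<psi> \<in> borel_measurable borel" "P \<in> borel_measurable borel"
      using sm by (auto intro!: borel_measurable_continuous_onI smooth_fun_continuous)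
    obtain B where B: "0 \<le> B" "\<And>x. \<bar>P x\<bar> \<le> B"
      using partial_box_bump_bounded[of i a b m] by (auto simp: P_def \<psi>_def)
    have Pz: "x \<notin> cbox a b \<Longrightarrow> P x = 0" for x
      by (simp add: P_def \<psi>_def partial_box_bump_zero)
    let ?K = "cbox a (b + s *\<^sub>R ?e)"
    have int_fP: "integrable (lborel \<Otimes>\<^sub>M lborel) (\<lambda>(t, z). indicator {0..s} t * (f z * P (z - t *\<^sub>R ?e)))"
    proof (rule integrable_lborel_bounded_strip)
      fix t :: real
      have "(\<integral>\<^sup>+z. ennreal \<bar>case (t, z) of (t, z) \<Rightarrow> indicator {0..s} t * (f z * P (z - t *\<^sub>R ?e))\<bar> \<partial>lborel)
         \<le> (\<integral>\<^sup>+z. (ennreal B * indicator {0..s} t) * ennreal \<bar>indicator ?K z * f z\<bar> \<partial>lborel)"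
      proof (intro nn_integral_mono)
        fix z
        show "ennreal \<bar>case (t, z) of (t, z) \<Rightarrow> indicator {0..s} t * (f z * P (z - t *\<^sub>R ?e))\<bar> \<le> (ennreal B * indicator {0..s} t) * ennreal \<bar>indicator ?K z * f z\<bar>"
        proof (cases "t \<in> {0..s} \<and> z \<in> ?K")
          case True
          then show ?thesis
            using B by (auto simp: abs_mult ennreal_mult'[symmetric] mult.commute[of B] intro!: ennreal_leI mult_left_mono)
        next
          case False
          then show ?thesis
            using shift'[of z t a b] Pz[of "z - t *\<^sub>R ?e"] by (auto simp: indicator_def)
        qed
      qed
      also have "\<dots> = (ennreal B * indicator {0..s} t) * (\<integral>\<^sup>+z. ennreal \<bar>indicator ?K z * f z\<bar> \<partial>lborel)"
        by (rule nn_integral_cmult) measurable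
      also have "\<dots> = ennreal (B * (\<integral>z. \<bar>indicator ?K z * f z\<bar> \<partial>lborel)) * indicator {0..s} t"
        unfolding fin[OF f] using B by (simp add: ennreal_mult' mult_ac)
      finally show "(\<integral>\<^sup>+z. ennreal \<bar>case (t, z) of (t, z) \<Rightarrow> indicator {0..s} t * (f z * P (z - t *\<^sub>R ?e))\<bar> \<partial>lborel) \<le> \<dots>" .
    qed measurable
    \<comment> \<open>The bump translated by t e is again a box bump, so the weak identity applies
      to it.\<close>
    have weak_t: "(\<integral>z. f z * P (z - t *\<^sub>R ?e) \<partial>lborel) = - (\<integral>z. g (z + t *\<^sub>R ?e) * \<psi> z \<partial>lborel)" for t
    proof -
      have eq: "box_bump (a + t *\<^sub>R ?e) (b + t *\<^sub>R ?e) m = (\<lambda>x. \<psi> (x - t *\<^sub>R ?e))"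
        by (simp add: \<psi>_def box_bump_translate fun_eq_iff)
      have "(\<integral>z. f z * P (z - t *\<^sub>R ?e) \<partial>lborel) = - (\<integral>z. g z * \<psi> (z - t *\<^sub>R ?e) \<partial>lborel)"
        using weak[of "a + t *\<^sub>R ?e" "b + t *\<^sub>R ?e" m]
        by (simp add: eq partial_translate[OF sm(1)] P_def)
      also have "(\<integral>z. g z * \<psi> (z - t *\<^sub>R ?e) \<partial>lborel) = (\<integral>z. g (z + t *\<^sub>R ?e) * \<psi> z \<partial>lborel)"
        using lborel_translate(1)[of "\<lambda>z. g z * \<psi> (z - t *\<^sub>R ?e)" "t *\<^sub>R ?e"] by simp
      finally show ?thesis .
    qed
    have "integrable (lborel \<Otimes>\<^sub>M lborel) (\<lambda>(t, z). indicator {0..s} t * (g (z + t *\<^sub>R ?e) * \<psi> z))"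
    proof (rule Bochner_Integration.integrable_bound[OF int_gz[of a b]])
      show "(\<lambda>(t, z). indicator {0..s} t * (g (z + t *\<^sub>R ?e) * \<psi> z)) \<in> borel_measurable (lborel \<Otimes>\<^sub>M lborel)"
        by measurable
      show "AE x in lborel \<Otimes>\<^sub>M lborel. norm (case x of (t, z) \<Rightarrow> indicator {0..s} t * (g (z + t *\<^sub>R ?e) * \<psi> z))
         \<le> norm (case x of (t, z) \<Rightarrow> indicator {0..s} t * (indicator (cbox a b) z * g (z + t *\<^sub>R ?e)))"
        using box_bump_bounds[of a b m] box_bump_zero_cbox[of _ a b m]
        by (intro AE_I2) (auto simp: abs_mult indicator_def \<psi>_def intro!: mult_left_le)
    qed
    note Fub = lborel_pair.Fubini_integral[OF this]
    have "(\<integral>t. indicator {0..s} t * (g (z + t *\<^sub>R ?e) * \<psi> z) \<partial>lborel) = I z * \<psi> z" for z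
      unfolding I_def by (simp add: mult.assoc[symmetric])
    with Fub have F2: "(\<integral>z. I z * \<psi> z \<partial>lborel) = (\<integral>t. indicator {0..s} t * (\<integral>z. g (z + t *\<^sub>R ?e) * \<psi> z \<partial>lborel) \<partial>lborel)"
      by (simp only: integral_mult_right_zero)
    have "(\<integral>t. indicator {0..s} t * (f z * P (z - t *\<^sub>R ?e)) \<partial>lborel) = f z * (\<integral>t. indicator {0..s} t * P (z - t *\<^sub>R ?e) \<partial>lborel)" for z
      by (simp add: mult.left_commute[of _ "f z"])
    with lborel_pair.Fubini_integral[OF int_fP]
    have "(\<integral>z. f z * (\<integral>t. indicator {0..s} t * P (z - t *\<^sub>R ?e) \<partial>lborel) \<partial>lborel) = (\<integral>t. indicator {0..s} t * (\<integral>z. f z * P (z - t *\<^sub>R ?e) \<partial>lborel) \<partial>lborel)"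
      by (simp only: integral_mult_right_zero)
    then have "(\<integral>z. f z * (\<psi> z - \<psi> (z - s *\<^sub>R ?e)) \<partial>lborel) = - (\<integral>z. I z * \<psi> z \<partial>lborel)"
      unfolding P_def smooth_fun_FTC[OF sm(1) s] F2
      by (simp add: P_def[symmetric] weak_t)
    moreover have "(\<integral>z. f z * (\<psi> z - \<psi> (z - s *\<^sub>R ?e)) \<partial>lborel) = (\<integral>z. f z * \<psi> z \<partial>lborel) - (\<integral>z. f z * \<psi> (z - s *\<^sub>R ?e) \<partial>lborel)"
    proof -
      have "integrable lborel (\<lambda>z. f z * \<psi> z)"
        unfolding \<psi>_def by (rule bump_int[OF f]) simp
      moreover have "integrable lborel (\<lambda>z. f z * \<psi> (z - s *\<^sub>R ?e))"
        unfolding \<psi>_def box_bump_translate by (rule bump_int[OF f]) simp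
      ultimately show ?thesis by (simp add: right_diff_distrib)
    qed
    moreover have "(\<integral>z. f z * \<psi> (z - s *\<^sub>R ?e) \<partial>lborel) = (\<integral>z. f (z + s *\<^sub>R ?e) * \<psi> z \<partial>lborel)"
      using lborel_translate(1)[of "\<lambda>z. f z * \<psi> (z - s *\<^sub>R ?e)" "s *\<^sub>R ?e"] by simp
    moreover have "(\<integral>z. D z * \<psi> z \<partial>lborel) = (\<integral>z. f (z + s *\<^sub>R ?e) * \<psi> z \<partial>lborel) - (\<integral>z. f z * \<psi> z \<partial>lborel) - (\<integral>z. I z * \<psi> z \<partial>lborel)"
      using bump_int[OF f, of a b m] bump_int[OF int_fs, of a b m] bump_int[OF int_I, of a b m]
      by (simp add: D_def left_diff_distrib \<psi>_def)
    ultimately show ?thesis by (simp add: \<psi>_def)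
  qed
  \<comment> \<open>Letting m tend to infinity under dominated convergence replaces the bumps by
    indicators of boxes.\<close>
  have "AE z in lborel. D z = 0"
  proof (rule AE_0_of_box_integrals)
    fix a b :: "real ^ 'n"
    show "set_integrable lborel (box a b) D"
      by (rule set_integrable_subset[OF int_D[of a b]]) (auto simp: box_subset_cbox)
    have "(\<lambda>m. \<integral>z. D z * box_bump a b m z \<partial>lborel) \<longlonglongrightarrow> (\<integral>z. D z * indicator (box a b) z \<partial>lborel)"
    proof (rule integral_dominated_convergence)
      show "integrable lborel (\<lambda>z. norm (indicator (cbox a b) z * D z))"
        using int_D[of a b] by (simp add: set_integrable_def)
      have [measurable]: "box_bump a b m \<in> borel_measurable borel" for m
        by (intro borel_measurable_continuous_onI smooth_fun_continuous smooth_fun_box_bump)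
      show "(\<lambda>z. D z * box_bump a b m z) \<in> borel_measurable lborel" for m
        by measurable
      show "AE z in lborel. (\<lambda>m. D z * box_bump a b m z) \<longlonglongrightarrow> D z * indicator (box a b) z"
        by (intro AE_I2 tendsto_mult tendsto_const box_bump_tendsto)
      show "AE z in lborel. norm (D z * box_bump a b m z) \<le> norm (indicator (cbox a b) z * D z)" for m
        using box_bump_bounds[of a b m] box_bump_zero_cbox[of _ a b m]
        by (intro AE_I2) (auto simp: abs_mult indicator_def intro!: mult_left_le)
    qed measurable
    then show "(\<integral>z. indicator (box a b) z * D z \<partial>lborel) = 0"
      by (simp add: zero_bump mult.commute LIMSEQ_const_iff)
  qed measurable
  then show ?thesis
    by eventually_elim (simp add: D_def I_def)
qed

section \<open>Poincare inequality with holes\<close>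

definition cb :: "real ^ 'n \<Rightarrow> real \<Rightarrow> (real ^ 'n) set" where
  "cb a l = box a (a + vec l)"

lemma mem_cb: "x \<in> cb a l \<longleftrightarrow> (\<forall>i. a $ i < x $ i \<and> x $ i < a $ i + l)"
  by (simp add: cb_def mem_box_cart)

lemma cb_measurable [measurable]: "cb a l \<in> sets borel"
  by (simp add: cb_def)

lemma emeasure_box_cart:
  fixes a b :: "real ^ 'n"
  assumes "\<And>i. a $ i \<le> b $ i"
  shows "emeasure lborel (box a b) = ennreal (\<Prod>i\<in>UNIV. b $ i - a $ i)"
proof -
  have "cbox a b \<noteq> {}"
    using assms by (auto simp: interval_ne_empty_cart)
  then have "measure lborel (cbox a b) = (\<Prod>i\<in>UNIV. b $ i - a $ i)"
    by (rule content_cbox_cart)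
  moreover have "emeasure lborel (box a b) = emeasure lborel (cbox a b)"
    by (simp add: emeasure_lborel_box_eq emeasure_lborel_cbox_eq)
  ultimately show ?thesis
    by (simp add: emeasure_eq_ennreal_measure[OF less_imp_neq[OF emeasure_lborel_cbox_finite[unfolded infinity_ennreal_def]]])
qed

lemma emeasure_cb: "0 \<le> l \<Longrightarrow> emeasure lborel (cb (a :: real ^ 'n) l) = ennreal (l ^ CARD('n))"
  by (simp add: cb_def emeasure_box_cart)

text \<open>Chebyshev's inequality. A threshold of three times the average leaves at most a third of
  R above it; a third rather than a half makes the conclusion strict, so that two such sets cannot
  cover R.\<close>

lemma emeasure_superlevel_lt_half:
  fixes \<phi> :: "'a \<Rightarrow> ennreal"
  assumes [measurable]: "\<phi> \<in> borel_measurable M" "R \<in> sets M"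
    and R: "emeasure M R = ennreal r" "0 < r"
    and b: "(\<integral>\<^sup>+x. \<phi> x * indicator R x \<partial>M) \<le> b"
  shows "2 * emeasure M {x\<in>R. 3 * b / ennreal r < \<phi> x} < ennreal r"
proof -
  let ?k = "3 * b / ennreal r"
  let ?A = "{x\<in>R. ?k < \<phi> x}"
  have eqA: "?A = {x\<in>space M. ?k < \<phi> x} \<inter> R"
    using sets.sets_into_space[OF assms(2)] by auto
  have [measurable]: "?A \<in> sets M"
    unfolding eqA by measurable
  have AR: "emeasure M ?A \<le> ennreal r"
    unfolding R(1)[symmetric] by (intro emeasure_mono) auto
  have "?k * emeasure M ?A = (\<integral>\<^sup>+x. ?k * indicator ?A x \<partial>M)"
    by (simp add: nn_integral_cmult_indicator)
  also have "\<dots> \<le> (\<integral>\<^sup>+x. \<phi> x * indicator R x \<partial>M)"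
    by (intro nn_integral_mono) (auto simp: indicator_def)
  finally have le: "?k * emeasure M ?A \<le> b" using b by simp
  \<comment> \<open>At b = 0 the threshold is 0 and Chebyshev's inequality is void; at b = top
    nothing exceeds the threshold. Only the finite positive case is a computation.\<close>
  consider "b = 0" | "b = top" | s where "b = ennreal s" "0 < s"
    by (cases b) (auto simp: ennreal_zero_less_top less_le)
  then show ?thesis
  proof cases
    case 1
    have "AE x in M. \<phi> x * indicator R x = 0"
      using b 1 by (subst nn_integral_0_iff_AE[symmetric]) auto
    then have "AE x in M. x \<notin> ?A"
      by eventually_elim (auto simp: indicator_def)
    then have "emeasure M ?A = 0"
      by (subst (asm) AE_iff_measurable[where N="?A"])
         (use sets.sets_into_space[OF assms(2)] in auto)
    then show ?thesis using R by simp
  next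
    case 2
    then have "?A = {}" by (auto simp: ennreal_mult_top ennreal_top_divide)
    show ?thesis unfolding \<open>?A = {}\<close> using R by simp
  next
    case 3
    obtain a where a: "emeasure M ?A = ennreal a" "0 \<le> a"
      using AR by (cases "emeasure M ?A") (auto simp: top_unique)
    have k: "?k = ennreal (3 * s / r)"
      using 3 R by (simp add: ennreal_mult'[symmetric] divide_ennreal flip: ennreal_numeral)
    have "3 * s / r * a \<le> s"
      using le 3 R a unfolding k by (simp add: ennreal_mult'[symmetric])
    then have "3 * a \<le> r"
      using 3 R by (simp add: field_simps)
    then have "2 * a < r" using R by linarith
    then have "ennreal (2 * a) < ennreal r"
      using a by (intro ennreal_lessI R)
    then show ?thesis
      using a by (simp add: ennreal_mult' flip: ennreal_numeral)
  qed
qed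

lemma exists_point_below_averages:
  fixes \<phi> \<psi> :: "'a \<Rightarrow> ennreal"
  assumes [measurable]: "\<phi> \<in> borel_measurable M" "\<psi> \<in> borel_measurable M" "R \<in> sets M"
    and R: "emeasure M R = ennreal r" "0 < r"
    and b: "(\<integral>\<^sup>+x. \<phi> x * indicator R x \<partial>M) \<le> b" "(\<integral>\<^sup>+x. \<psi> x * indicator R x \<partial>M) \<le> c"
  shows "\<exists>x\<in>R. \<phi> x \<le> 3 * b / ennreal r \<and> \<psi> x \<le> 3 * c / ennreal r"
proof (rule ccontr)
  let ?A = "{x\<in>R. 3 * b / ennreal r < \<phi> x}" and ?B = "{x\<in>R. 3 * c / ennreal r < \<psi> x}"
  assume "\<not> ?thesis"
  then have "R = ?A \<union> ?B" by (auto simp: not_le)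
  have eqA: "?A = {x\<in>space M. 3 * b / ennreal r < \<phi> x} \<inter> R" "?B = {x\<in>space M. 3 * c / ennreal r < \<psi> x} \<inter> R"
    using sets.sets_into_space[OF assms(3)] by auto
  have [measurable]: "?A \<in> sets M" "?B \<in> sets M"
    unfolding eqA by measurable
  have "2 * ennreal r = 2 * emeasure M (?A \<union> ?B)"
    using R \<open>R = ?A \<union> ?B\<close> by simp
  also have "\<dots> \<le> 2 * (emeasure M ?A + emeasure M ?B)"
    by (intro mult_left_mono emeasure_subadditive) auto
  also have "\<dots> = 2 * emeasure M ?A + 2 * emeasure M ?B"
    by (simp add: distrib_left)
  also have "\<dots> < ennreal r + ennreal r"
    by (intro add_strict_mono emeasure_superlevel_lt_half assms)
  finally show False
    by (simp add: mult_2)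
qed

text \<open>The corners of the path from x to x + h that changes one coordinate after another:
  \<open>x + coord_proj S h\<close> has already moved in the directions of S.\<close>

definition coord_proj :: "'n set \<Rightarrow> real ^ 'n \<Rightarrow> real ^ 'n" where
  "coord_proj S h = (\<chi> j. if j \<in> S then h $ j else 0)"

lemma coord_proj_nth [simp]: "coord_proj S h $ j = (if j \<in> S then h $ j else 0)"
  by (simp add: coord_proj_def)

lemma coord_proj_insert: "i \<notin> S \<Longrightarrow> coord_proj (insert i S) h = coord_proj S h + h $ i *\<^sub>R axis i 1"
  by (simp add: vec_eq_iff axis_def)

lemma coord_proj_UNIV [simp]: "coord_proj UNIV h = h"
  by (simp add: vec_eq_iff)

lemma coord_proj_measurable [measurable]: "coord_proj S \<in> borel_measurable borel"
proof -
  have "continuous_on UNIV (\<lambda>x. if j \<in> S then x $ j else 0 :: real)" for j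
    by (cases "j \<in> S") (auto intro!: continuous_intros)
  then show ?thesis
    unfolding coord_proj_def by (intro borel_measurable_continuous_onI continuous_intros)
qed

text \<open>The part of the cube covered by the tubes in direction i over the holes. For a point
  outside, the whole line in direction i misses all holes, not only a given segment.\<close>

definition bad_lines :: "'n \<Rightarrow> real ^ 'n \<Rightarrow> real \<Rightarrow> ((real ^ 'n) \<times> real) set \<Rightarrow> (real ^ 'n) set" where
  "bad_lines i c r \<P> = {z. z \<in> cb c r \<and> (\<exists>(a, l)\<in>\<P>. \<forall>j. j \<noteq> i \<longrightarrow> a $ j < z $ j \<and> z $ j < a $ j + l)}"

lemma bad_lines_eq:
  "bad_lines i c r \<P> = (\<Union>(a, l)\<in>\<P>. cb c r \<inter> box (\<chi> j. if j = i then c $ i else a $ j) (\<chi> j. if j = i then c $ i + r else a $ j + l))"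
proof -
  have "z \<in> box (\<chi> j. if j = i then c $ i else a $ j) (\<chi> j. if j = i then c $ i + r else a $ j + l) \<longleftrightarrow>
      (\<forall>j. j \<noteq> i \<longrightarrow> a $ j < z $ j \<and> z $ j < a $ j + l)" if "z \<in> cb c r" for z a l
    using that by (auto simp: mem_box_cart mem_cb)
  then show ?thesis
    unfolding bad_lines_def by blast
qed

lemma bad_lines_measurable [measurable]: "finite \<P> \<Longrightarrow> bad_lines i c r \<P> \<in> sets borel"
  unfolding bad_lines_eq by (intro sets.finite_UN) auto

text \<open>A tube has length r and cross-section l^(n - 1). This is where the exponent n - 1
  enters, and with it the restriction \<beta> < 1 - 1/n for p = 1.\<close>

lemma emeasure_bad_lines:
  fixes c :: "real ^ 'n"
  assumes "finite \<P>" "0 < r" "\<And>a l. (a, l) \<in> \<P> \<Longrightarrow> 0 < l"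
  shows "emeasure lborel (bad_lines i c r \<P>) \<le> ennreal (\<Sum>(a, l)\<in>\<P>. r * l ^ (CARD('n) - 1))"
proof -
  have "emeasure lborel (bad_lines i c r \<P>) \<le>
      (\<Sum>p\<in>\<P>. emeasure lborel (case p of (a, l) \<Rightarrow> cb c r \<inter> box (\<chi> j. if j = i then c $ i else a $ j) (\<chi> j. if j = i then c $ i + r else a $ j + l)))"
    unfolding bad_lines_eq using assms(1) by (intro emeasure_subadditive_finite) auto
  also have "\<dots> \<le> (\<Sum>p\<in>\<P>. ennreal (case p of (a, l) \<Rightarrow> r * l ^ (CARD('n) - 1)))"
  proof (intro sum_mono, clarify)
    fix a l assume "(a, l) \<in> \<P>"
    then have l: "0 < l" using assms by blast
    have "emeasure lborel (cb c r \<inter> box (\<chi> j. if j = i then c $ i else a $ j) (\<chi> j. if j = i then c $ i + r else a $ j + l))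
       \<le> emeasure lborel (box (\<chi> j. if j = i then c $ i else a $ j) (\<chi> j. if j = i then c $ i + r else a $ j + l))"
      by (intro emeasure_mono) auto
    also have "\<dots> = ennreal (\<Prod>j\<in>UNIV. if j = i then r else l)"
      using l assms(2) by (subst emeasure_box_cart) (auto intro!: arg_cong[where f=ennreal] prod.cong)
    also have "(\<Prod>j\<in>UNIV. if j = i then r else l) = r * l ^ (CARD('n) - 1)"
      by (subst prod.remove[of _ i]) (auto simp: card_Diff_singleton)
    finally show "emeasure lborel (cb c r \<inter> box (\<chi> j. if j = i then c $ i else a $ j) (\<chi> j. if j = i then c $ i + r else a $ j + l)) \<le> ennreal (r * l ^ (CARD('n) - 1))" .
  qed
  also have "\<dots> = ennreal (\<Sum>(a, l)\<in>\<P>. r * l ^ (CARD('n) - 1))"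
    using assms by (intro sum_ennreal) (auto intro!: mult_nonneg_nonneg zero_le_power less_imp_le)
  finally show ?thesis .
qed


section \<open>Paths parallel to the axes that avoid the holes\<close>

locale weak_partials =
  fixes f :: "real ^ 'n \<Rightarrow> real" and g :: "'n \<Rightarrow> real ^ 'n \<Rightarrow> real"
  assumes f_meas [measurable]: "f \<in> borel_measurable borel"
    and g_meas [measurable]: "\<And>i. g i \<in> borel_measurable borel"
    and f_int: "\<And>a b. set_integrable lborel (cbox a b) f"
    and g_int: "\<And>i a b. set_integrable lborel (cbox a b) (g i)"
    and weak: "\<And>i a b m. (\<integral>x. f x * partial i (box_bump a b m) x \<partial>lborel) = - (\<integral>x. g i x * box_bump a b m x \<partial>lborel)"
begin

text \<open>The integral of |g_i| over the line through z in direction i, inside the cube and off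
  the holes. The range from -r to r serves both signs of the step and does not depend on its end
  point.\<close>

definition line_mass :: "'n \<Rightarrow> real ^ 'n \<Rightarrow> real \<Rightarrow> (real ^ 'n) set \<Rightarrow> real ^ 'n \<Rightarrow> ennreal" where
  "line_mass i c r U z = (\<integral>\<^sup>+t. indicator {-r..r} t * (ennreal \<bar>g i (z + t *\<^sub>R axis i 1)\<bar> * indicator (cb c r - U) (z + t *\<^sub>R axis i 1)) \<partial>lborel)"

lemma line_mass_measurable [measurable]:
  assumes [measurable]: "U \<in> sets borel"
  shows "line_mass i c r U \<in> borel_measurable borel"
  unfolding line_mass_def by measurable

lemma nn_integral_line_mass:
  assumes [measurable]: "U \<in> sets borel" and r: "0 < r"
  shows "(\<integral>\<^sup>+z. line_mass i c r U z \<partial>lborel) = ennreal (2 * r) * (\<integral>\<^sup>+z. ennreal \<bar>g i z\<bar> * indicator (cb c r - U) z \<partial>lborel)"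
proof -
  have "(\<integral>\<^sup>+z. line_mass i c r U z \<partial>lborel) = (\<integral>\<^sup>+t. (\<integral>\<^sup>+z. indicator {-r..r} t * (ennreal \<bar>g i (z + t *\<^sub>R axis i 1)\<bar> * indicator (cb c r - U) (z + t *\<^sub>R axis i 1)) \<partial>lborel) \<partial>lborel)"
    unfolding line_mass_def by (rule lborel_pair.Fubini') measurable
  also have "\<dots> = (\<integral>\<^sup>+t. indicator {-r..r} t * (\<integral>\<^sup>+z. ennreal \<bar>g i z\<bar> * indicator (cb c r - U) z \<partial>lborel) \<partial>lborel)"
  proof (rule nn_integral_cong)
    fix t :: real
    have "(\<integral>\<^sup>+z. indicator {-r..r} t * (ennreal \<bar>g i (z + t *\<^sub>R axis i 1)\<bar> * indicator (cb c r - U) (z + t *\<^sub>R axis i 1)) \<partial>lborel)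
       = indicator {-r..r} t * (\<integral>\<^sup>+z. ennreal \<bar>g i (z + t *\<^sub>R axis i 1)\<bar> * indicator (cb c r - U) (z + t *\<^sub>R axis i 1) \<partial>lborel)"
      by (rule nn_integral_cmult) measurable
    also have "(\<integral>\<^sup>+z. ennreal \<bar>g i (z + t *\<^sub>R axis i 1)\<bar> * indicator (cb c r - U) (z + t *\<^sub>R axis i 1) \<partial>lborel) = (\<integral>\<^sup>+z. ennreal \<bar>g i z\<bar> * indicator (cb c r - U) z \<partial>lborel)"
      by (rule nn_integral_lborel_translate[where f="\<lambda>z. ennreal \<bar>g i z\<bar> * indicator (cb c r - U) z"]) measurable
    finally show "(\<integral>\<^sup>+z. indicator {-r..r} t * (ennreal \<bar>g i (z + t *\<^sub>R axis i 1)\<bar> * indicator (cb c r - U) (z + t *\<^sub>R axis i 1)) \<partial>lborel) = indicator {-r..r} t * (\<integral>\<^sup>+z. ennreal \<bar>g i z\<bar> * indicator (cb c r - U) z \<partial>lborel)" .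
  qed
  also have "\<dots> = ennreal (2 * r) * (\<integral>\<^sup>+z. ennreal \<bar>g i z\<bar> * indicator (cb c r - U) z \<partial>lborel)"
    using r by (subst nn_integral_multc) auto
  finally show ?thesis .
qed

text \<open>A cube is convex and a line off the tubes meets no hole, so the segment from z to z + s
  e lies in the region over which \<open>line_mass\<close> integrates.\<close>

lemma AE_line_bound:
  assumes "finite \<P>" and "\<bar>s\<bar> \<le> r"
  defines "U \<equiv> \<Union>(a, l)\<in>\<P>. cb a l"
  shows "AE z in lborel. z \<in> cb c r \<longrightarrow> z + s *\<^sub>R axis i 1 \<in> cb c r \<longrightarrow> z \<notin> bad_lines i c r \<P> \<longrightarrow>
    ennreal \<bar>f (z + s *\<^sub>R axis i 1) - f z\<bar> \<le> line_mass i c r U z"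
proof -
  let ?e = "axis i (1::real) :: real ^ 'n"
  have good: "z + t *\<^sub>R ?e \<in> cb c r - U"
    if z: "z \<in> cb c r" "z + s *\<^sub>R ?e \<in> cb c r" "z \<notin> bad_lines i c r \<P>" and t: "t \<in> {0..s} \<union> {s..0}" for z t
  proof -
    have "c $ j < (z + t *\<^sub>R ?e) $ j \<and> (z + t *\<^sub>R ?e) $ j < c $ j + r" for j
    proof (cases "j = i")
      case True
      then show ?thesis using z(1,2) t by (auto simp: mem_cb dest!: spec[of _ i])
    next
      case False
      then show ?thesis using z(1) by (auto simp: mem_cb axis_def)
    qed
    then have "z + t *\<^sub>R ?e \<in> cb c r" by (simp add: mem_cb)
    moreover have "z + t *\<^sub>R ?e \<notin> U"
    proof
      assume "z + t *\<^sub>R ?e \<in> U"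
      then obtain a l where al: "(a, l) \<in> \<P>" "z + t *\<^sub>R ?e \<in> cb a l" by (auto simp: U_def)
      have "a $ j < z $ j \<and> z $ j < a $ j + l" if "j \<noteq> i" for j
        using al(2) that by (auto simp: mem_cb axis_def dest!: spec[of _ j])
      then show False
        using al(1) z by (auto simp: bad_lines_def)
    qed
    ultimately show ?thesis by blast
  qed
  have nonneg: "AE z in lborel. ennreal \<bar>f (z + u *\<^sub>R ?e) - f z\<bar> \<le> (\<integral>\<^sup>+t. indicator {0..u} t * ennreal \<bar>g i (z + t *\<^sub>R ?e)\<bar> \<partial>lborel)" if "0 \<le> u" for u
    using AE_line_integral[where i=i, OF f_meas g_meas[of i] f_int g_int weak that]
  proof eventually_elim
    case (elim z)
    have eq: "(\<integral>\<^sup>+t. indicator {0..u} t * ennreal \<bar>g i (z + t *\<^sub>R ?e)\<bar> \<partial>lborel) = (\<integral>\<^sup>+t. ennreal (norm (indicator {0..u} t * g i (z + t *\<^sub>R ?e))) \<partial>lborel)"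
      by (intro nn_integral_cong) (auto simp: indicator_def)
    show ?case
    proof (cases "integrable lborel (\<lambda>t. indicator {0..u} t * g i (z + t *\<^sub>R ?e))")
      case True
      then show ?thesis
        unfolding elim eq using integral_norm_bound_ennreal[OF True] by simp
    next
      \<comment> \<open>A Bochner integral that does not exist has value 0, so here the line
        identity says f(z + u e) = f(z).\<close>
      case False
      then show ?thesis
        unfolding elim by (simp add: not_integrable_integral_eq)
    qed
  qed
  show ?thesis
  proof (cases "0 \<le> s")
    case True
    show ?thesis
      using nonneg[OF True]
    proof eventually_elim
      case (elim z)
      show ?case
      proof (intro impI)
        assume z: "z \<in> cb c r" "z + s *\<^sub>R ?e \<in> cb c r" "z \<notin> bad_lines i c r \<P>"
        have "(\<integral>\<^sup>+t. indicator {0..s} t * ennreal \<bar>g i (z + t *\<^sub>R ?e)\<bar> \<partial>lborel) \<le> line_mass i c r U z"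
          unfolding line_mass_def
          using good[OF z] assms(2) by (intro nn_integral_mono) (auto simp: indicator_def)
        with elim show "ennreal \<bar>f (z + s *\<^sub>R ?e) - f z\<bar> \<le> line_mass i c r U z"
          by (rule order_trans)
      qed
    qed
  next
    case False
    \<comment> \<open>For s < 0 the bound for the step -s is applied at the point z + s e, and the
      variable of the line integral is shifted back.\<close>
    then have "0 \<le> - s" by simp
    from AE_lborel_translate[OF nonneg[OF this], of "s *\<^sub>R ?e"] show ?thesis
    proof eventually_elim
      case (elim z)
      show ?case
      proof (intro impI)
        assume z: "z \<in> cb c r" "z + s *\<^sub>R ?e \<in> cb c r" "z \<notin> bad_lines i c r \<P>"
        have "(\<integral>\<^sup>+t. indicator {0..-s} t * ennreal \<bar>g i (z + s *\<^sub>R ?e + t *\<^sub>R ?e)\<bar> \<partial>lborel)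
          = (\<integral>\<^sup>+t. indicator {0..-s} (t + (- s)) * ennreal \<bar>g i (z + s *\<^sub>R ?e + (t + (- s)) *\<^sub>R ?e)\<bar> \<partial>lborel)"
          by (rule nn_integral_lborel_translate[where f="\<lambda>t. indicator {0..-s} t * ennreal \<bar>g i (z + s *\<^sub>R ?e + t *\<^sub>R ?e)\<bar>", symmetric]) measurable
        also have "\<dots> \<le> line_mass i c r U z"
          unfolding line_mass_def
          using good[OF z] assms(2) False by (intro nn_integral_mono) (auto simp: indicator_def algebra_simps)
        finally show "ennreal \<bar>f (z + s *\<^sub>R ?e) - f z\<bar> \<le> line_mass i c r U z"
          using elim by (simp add: abs_minus_commute)
      qed
    qed
  qed
qed

end

context weak_partials
begin

text \<open>Induction over the set of moved directions. All corners lie in the cube, since each of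
  their coordinates is one of x or of x + h. Y adds the line masses at the corners, B collects the
  pairs for which a corner lies on a bad line. Both are measurable in (x, h) jointly, because x and
  h are integrated in turn later, while the bounds hold for each h separately.\<close>

lemma AE_path_bound:
  fixes \<P> :: "((real ^ 'n) \<times> real) set" and r :: real
  assumes fin: "finite \<P>" and "finite S" and r: "0 < r"
  defines "U \<equiv> \<Union>(a, l)\<in>\<P>. cb a l"
  shows "\<exists>Y B. Y \<in> borel_measurable (borel \<Otimes>\<^sub>M borel) \<and> B \<in> sets (borel \<Otimes>\<^sub>M borel) \<and>
    (\<forall>h. (\<forall>i. \<bar>h $ i\<bar> \<le> r) \<longrightarrow> (AE x in lborel. x \<in> cb c r \<longrightarrow> x + h \<in> cb c r \<longrightarrow> (x, h) \<notin> B \<longrightarrow>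
        ennreal \<bar>f (x + coord_proj S h) - f x\<bar> \<le> Y (x, h))) \<and>
    (\<forall>h. (\<integral>\<^sup>+x. Y (x, h) \<partial>lborel) \<le> (\<Sum>i\<in>S. ennreal (2 * r) * (\<integral>\<^sup>+z. ennreal \<bar>g i z\<bar> * indicator (cb c r - U) z \<partial>lborel))) \<and>
    (\<forall>h. emeasure lborel {x. (x, h) \<in> B} \<le> (\<Sum>i\<in>S. emeasure lborel (bad_lines i c r \<P>)))"
  using assms(2)
proof (induction S rule: finite_induct)
  case empty
  show ?case
    by (intro exI[of _ "\<lambda>_. 0"] exI[of _ "{}"]) (simp add: coord_proj_def zero_vec_def[symmetric])
next
  case (insert i S)
  then obtain Y B where [measurable]: "Y \<in> borel_measurable (borel \<Otimes>\<^sub>M borel)" "B \<in> sets (borel \<Otimes>\<^sub>M borel)"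
    and Y1: "\<And>h. (\<forall>i. \<bar>h $ i\<bar> \<le> r) \<Longrightarrow> AE x in lborel. x \<in> cb c r \<longrightarrow> x + h \<in> cb c r \<longrightarrow> (x, h) \<notin> B \<longrightarrow>
        ennreal \<bar>f (x + coord_proj S h) - f x\<bar> \<le> Y (x, h)"
    and Y2: "\<And>h. (\<integral>\<^sup>+x. Y (x, h) \<partial>lborel) \<le> (\<Sum>i\<in>S. ennreal (2 * r) * (\<integral>\<^sup>+z. ennreal \<bar>g i z\<bar> * indicator (cb c r - U) z \<partial>lborel))"
    and Y3: "\<And>h. emeasure lborel {x. (x, h) \<in> B} \<le> (\<Sum>i\<in>S. emeasure lborel (bad_lines i c r \<P>))"
    by blast
  have [measurable]: "U \<in> sets borel"
    unfolding U_def using fin by (intro sets.finite_UN) auto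
  have [measurable]: "bad_lines i c r \<P> \<in> sets borel"
    using fin by measurable
  define Y' where "Y' = (\<lambda>(x, h). Y (x, h) + line_mass i c r U (x + coord_proj S h))"
  define B' where "B' = B \<union> {(x, h). x + coord_proj S h \<in> bad_lines i c r \<P>}"
  show ?case
  proof (intro exI[of _ Y'] exI[of _ B'] conjI allI impI)
    show "Y' \<in> borel_measurable (borel \<Otimes>\<^sub>M borel)"
      unfolding Y'_def by measurable
    have "{p \<in> space (borel \<Otimes>\<^sub>M borel). fst p + coord_proj S (snd p) \<in> bad_lines i c r \<P>} \<in> sets (borel \<Otimes>\<^sub>M borel)"
      by measurable
    then show "B' \<in> sets (borel \<Otimes>\<^sub>M borel)"
      unfolding B'_def by (intro sets.Un) (auto simp: space_pair_measure case_prod_unfold)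
  next
    fix h :: "real ^ 'n" assume h: "\<forall>i. \<bar>h $ i\<bar> \<le> r"
    from AE_lborel_translate[OF AE_line_bound[OF fin h[rule_format, of i], of c i], of "coord_proj S h"] Y1[OF h]
    show "AE x in lborel. x \<in> cb c r \<longrightarrow> x + h \<in> cb c r \<longrightarrow> (x, h) \<notin> B' \<longrightarrow>
        ennreal \<bar>f (x + coord_proj (insert i S) h) - f x\<bar> \<le> Y' (x, h)"
    proof eventually_elim
      case (elim x)
      show ?case
      proof (intro impI)
        assume x: "x \<in> cb c r" "x + h \<in> cb c r" "(x, h) \<notin> B'"
        have p: "x + coord_proj T h \<in> cb c r" for T
          using x(1,2) by (auto simp: mem_cb)
        have eq: "x + coord_proj (insert i S) h = x + coord_proj S h + h $ i *\<^sub>R axis i 1"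
          using insert.hyps by (simp add: coord_proj_insert add.assoc)
        have 1: "ennreal \<bar>f (x + coord_proj (insert i S) h) - f (x + coord_proj S h)\<bar> \<le> line_mass i c r U (x + coord_proj S h)"
          using elim(1) p[of S] p[of "insert i S"] x(3) unfolding eq U_def B'_def by auto
        have 2: "ennreal \<bar>f (x + coord_proj S h) - f x\<bar> \<le> Y (x, h)"
          using elim(2) x unfolding B'_def by auto
        have "ennreal \<bar>f (x + coord_proj (insert i S) h) - f x\<bar> \<le>
            ennreal (\<bar>f (x + coord_proj S h) - f x\<bar> + \<bar>f (x + coord_proj (insert i S) h) - f (x + coord_proj S h)\<bar>)"
          by (intro ennreal_leI) linarith
        also have "\<dots> \<le> Y' (x, h)"
          using 1 2 by (auto simp: Y'_def intro!: add_mono)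
        finally show "ennreal \<bar>f (x + coord_proj (insert i S) h) - f x\<bar> \<le> Y' (x, h)" .
      qed
    qed
  next
    fix h :: "real ^ 'n"
    have "(\<integral>\<^sup>+x. Y' (x, h) \<partial>lborel) = (\<integral>\<^sup>+x. Y (x, h) \<partial>lborel) + (\<integral>\<^sup>+x. line_mass i c r U (x + coord_proj S h) \<partial>lborel)"
      unfolding Y'_def by (simp add: nn_integral_add)
    also have "(\<integral>\<^sup>+x. line_mass i c r U (x + coord_proj S h) \<partial>lborel) = ennreal (2 * r) * (\<integral>\<^sup>+z. ennreal \<bar>g i z\<bar> * indicator (cb c r - U) z \<partial>lborel)"
      by (simp add: nn_integral_lborel_translate nn_integral_line_mass r)
    finally show "(\<integral>\<^sup>+x. Y' (x, h) \<partial>lborel) \<le> (\<Sum>i\<in>insert i S. ennreal (2 * r) * (\<integral>\<^sup>+z. ennreal \<bar>g i z\<bar> * indicator (cb c r - U) z \<partial>lborel))"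
      using insert.hyps Y2[of h] by (simp add: add.commute add_left_mono)
  next
    fix h :: "real ^ 'n"
    have [measurable]: "{x. (x, h) \<in> B} \<in> sets lborel"
      using measurable_sets[of "\<lambda>x. (x, h)" borel "borel \<Otimes>\<^sub>M borel" B] by (simp add: vimage_def)
    have [measurable]: "{x. x + coord_proj S h \<in> bad_lines i c r \<P>} \<in> sets lborel"
      using measurable_sets[of "\<lambda>x. x + coord_proj S h" borel borel "bad_lines i c r \<P>"] by (simp add: vimage_def)
    have "emeasure lborel {x. x + coord_proj S h \<in> bad_lines i c r \<P>} = (\<integral>\<^sup>+x. indicator {x. x + coord_proj S h \<in> bad_lines i c r \<P>} x \<partial>lborel)"
      by simp
    also have "\<dots> = (\<integral>\<^sup>+x. indicator (bad_lines i c r \<P>) (x + coord_proj S h) \<partial>lborel)"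
      by (intro nn_integral_cong) (simp add: indicator_def)
    also have "\<dots> = emeasure lborel (bad_lines i c r \<P>)"
      by (subst nn_integral_lborel_translate) auto
    finally have 1: "emeasure lborel {x. x + coord_proj S h \<in> bad_lines i c r \<P>} = emeasure lborel (bad_lines i c r \<P>)" .
    have "{x. (x, h) \<in> B'} = {x. (x, h) \<in> B} \<union> {x. x + coord_proj S h \<in> bad_lines i c r \<P>}"
      by (auto simp: B'_def)
    then have "emeasure lborel {x. (x, h) \<in> B'} \<le> emeasure lborel {x. (x, h) \<in> B} + emeasure lborel {x. x + coord_proj S h \<in> bad_lines i c r \<P>}"
      by (auto intro!: emeasure_subadditive)
    then show "emeasure lborel {x. (x, h) \<in> B'} \<le> (\<Sum>i\<in>insert i S. emeasure lborel (bad_lines i c r \<P>))"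
      using insert.hyps Y3[of h] unfolding 1 by (simp add: add.commute) (meson add_left_mono order_trans)
  qed
qed

text \<open>Substituting y = x + h and exchanging the integrals leaves an integral over x for each
  difference h; the differences of points of the cube fill a box of volume (2r)^n.\<close>

lemma nn_integral_pairs_translate:
  fixes F :: "(real ^ 'n) \<times> (real ^ 'n) \<Rightarrow> ennreal"
  assumes [measurable]: "F \<in> borel_measurable (borel \<Otimes>\<^sub>M borel)" and r: "0 < r"
    and supp: "\<And>x y. F (x, y) \<noteq> 0 \<Longrightarrow> x \<in> cb c r \<and> y \<in> cb c r"
    and le: "\<And>h. (\<forall>i. \<bar>h $ i\<bar> \<le> r) \<Longrightarrow> (\<integral>\<^sup>+x. F (x, x + h) \<partial>lborel) \<le> K"
  shows "(\<integral>\<^sup>+x. (\<integral>\<^sup>+y. F (x, y) \<partial>lborel) \<partial>lborel) \<le> ennreal ((2 * r) ^ CARD('n)) * K"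
proof -
  have "(\<integral>\<^sup>+x. (\<integral>\<^sup>+y. F (x, y) \<partial>lborel) \<partial>lborel) = (\<integral>\<^sup>+x. (\<integral>\<^sup>+h. F (x, x + h) \<partial>lborel) \<partial>lborel)"
  proof (rule nn_integral_cong)
    fix x :: "real ^ 'n"
    show "(\<integral>\<^sup>+y. F (x, y) \<partial>lborel) = (\<integral>\<^sup>+h. F (x, x + h) \<partial>lborel)"
      using nn_integral_lborel_translate[of "\<lambda>y. F (x, y)" x] by (simp add: add.commute)
  qed
  also have "\<dots> = (\<integral>\<^sup>+h. (\<integral>\<^sup>+x. F (x, x + h) \<partial>lborel) \<partial>lborel)"
    by (rule lborel_pair.Fubini'[symmetric]) measurable
  also have "\<dots> \<le> (\<integral>\<^sup>+h. K * indicator (box (- vec r) (vec r)) (h :: real ^ 'n) \<partial>lborel)"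
  proof (rule nn_integral_mono)
    fix h :: "real ^ 'n"
    show "(\<integral>\<^sup>+x. F (x, x + h) \<partial>lborel) \<le> K * indicator (box (- vec r) (vec r)) h"
    proof (cases "h \<in> box (- vec r) (vec r)")
      case True
      then have "\<forall>i. - r < h $ i \<and> h $ i < r" by (simp add: mem_box_cart)
      then have "\<forall>i. \<bar>h $ i\<bar> \<le> r" by (simp add: abs_le_iff) (meson less_imp_le minus_le_iff)
      then show ?thesis using le True by simp
    next
      case False
      have "F (x, x + h) = 0" for x
      proof (rule ccontr)
        assume "F (x, x + h) \<noteq> 0"
        then have *: "c $ i < x $ i \<and> x $ i < c $ i + r \<and> c $ i < x $ i + h $ i \<and> x $ i + h $ i < c $ i + r" for i
          using supp[of x "x + h"] by (auto simp: mem_cb)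
        have "- r < h $ i \<and> h $ i < r" for i
          using *[of i] by linarith
        then show False using False by (simp add: mem_box_cart)
      qed
      then show ?thesis by simp
    qed
  qed
  also have "\<dots> = ennreal ((2 * r) ^ CARD('n)) * K"
    using r by (subst nn_integral_cmult_indicator) (auto simp: emeasure_box_cart mult.commute)
  finally show ?thesis .
qed

text \<open>The path bound is integrated over pairs of points of the cube, and so is the indicator
  of the bad pairs. Some x stays below three times the average in both respects. Then m = f(x), and
  N is the set of y for which (x, y) is a bad pair: removing holes on the right costs an exceptional
  set on the left.\<close>

lemma poincare_with_holes:
  fixes \<P> :: "((real ^ 'n) \<times> real) set" and r :: real
  assumes fin: "finite \<P>" and pos: "\<And>a l. (a, l) \<in> \<P> \<Longrightarrow> 0 < l" and r: "0 < r"
  defines "U \<equiv> \<Union>(a, l)\<in>\<P>. cb a l"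
  shows "\<exists>m N. N \<in> sets borel \<and>
    emeasure lborel N \<le> ennreal (3 * 2 ^ CARD('n) * CARD('n) * (\<Sum>(a, l)\<in>\<P>. r * l ^ (CARD('n) - 1))) \<and>
    (\<integral>\<^sup>+y. ennreal \<bar>f y - m\<bar> * indicator (cb c r - N) y \<partial>lborel)
      \<le> ennreal (6 * 2 ^ CARD('n) * r) * (\<Sum>i\<in>UNIV. \<integral>\<^sup>+z. ennreal \<bar>g i z\<bar> * indicator (cb c r - U) z \<partial>lborel)"
proof -
  let ?R = "cb c r" and ?n = "CARD('n)"
  define X where "X = (\<Sum>i\<in>(UNIV :: 'n set). \<integral>\<^sup>+z. ennreal \<bar>g i z\<bar> * indicator (?R - U) z \<partial>lborel)"
  define \<beta> where "\<beta> = ?n * (\<Sum>(a, l)\<in>\<P>. r * l ^ (?n - 1))"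
  have \<beta>: "0 \<le> \<beta>"
    using pos r unfolding \<beta>_def by (intro mult_nonneg_nonneg sum_nonneg) (auto intro!: mult_nonneg_nonneg zero_le_power less_imp_le)
  obtain Y B where [measurable]: "Y \<in> borel_measurable (borel \<Otimes>\<^sub>M borel)" "B \<in> sets (borel \<Otimes>\<^sub>M borel)"
    and Y1: "\<And>h :: real ^ 'n. (\<forall>i. \<bar>h $ i\<bar> \<le> r) \<Longrightarrow> AE x in lborel. x \<in> ?R \<longrightarrow> x + h \<in> ?R \<longrightarrow> (x, h) \<notin> B \<longrightarrow>
        ennreal \<bar>f (x + h) - f x\<bar> \<le> Y (x, h)"
    and Y2: "\<And>h :: real ^ 'n. (\<integral>\<^sup>+x. Y (x, h) \<partial>lborel) \<le> ennreal (2 * r) * X"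
    and Y3: "\<And>h :: real ^ 'n. emeasure lborel {x. (x, h) \<in> B} \<le> (\<Sum>i\<in>UNIV. emeasure lborel (bad_lines i c r \<P>))"
    using AE_path_bound[OF fin finite[of UNIV] r, of c]
    unfolding X_def U_def sum_distrib_left coord_proj_UNIV by blast
  have Y3': "emeasure lborel {x. (x, h) \<in> B} \<le> ennreal \<beta>" for h
  proof -
    have "(\<Sum>i\<in>(UNIV :: 'n set). emeasure lborel (bad_lines i c r \<P>)) \<le> (\<Sum>i\<in>(UNIV :: 'n set). ennreal (\<Sum>(a, l)\<in>\<P>. r * l ^ (?n - 1)))"
      by (intro sum_mono emeasure_bad_lines[OF fin r pos])
    also have "\<dots> = ennreal \<beta>"
      by (simp add: \<beta>_def ennreal_mult' ennreal_of_nat_eq_real_of_nat)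
    finally show ?thesis using Y3[of h] by (rule order_trans[rotated])
  qed
  \<comment> \<open>From the shift h back to the end point y = x + h.\<close>
  define B' where "B' = {(x, y). (x, y - x) \<in> B}"
  have "{p \<in> space (borel \<Otimes>\<^sub>M borel). (fst p, snd p - fst p) \<in> B} \<in> sets (borel \<Otimes>\<^sub>M borel)"
    by measurable
  then have [measurable]: "B' \<in> sets (borel \<Otimes>\<^sub>M borel)"
    by (simp add: B'_def space_pair_measure case_prod_unfold)
  define F where "F = (\<lambda>p. indicator (?R \<times> ?R - B') p * ennreal \<bar>f (snd p) - f (fst p)\<bar>)"
  define H where "H = (\<lambda>p. indicator (?R \<times> ?R \<inter> B') p :: ennreal)"
  have [measurable]: "F \<in> borel_measurable (borel \<Otimes>\<^sub>M borel)" "H \<in> borel_measurable (borel \<Otimes>\<^sub>M borel)"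
    unfolding F_def H_def by measurable
  have intF: "(\<integral>\<^sup>+x. (\<integral>\<^sup>+y. F (x, y) \<partial>lborel) \<partial>lborel) \<le> ennreal ((2 * r) ^ ?n) * (ennreal (2 * r) * X)"
  proof (rule nn_integral_pairs_translate[OF _ r])
    show "x \<in> ?R \<and> y \<in> ?R" if "F (x, y) \<noteq> 0" for x y
      using that by (auto simp: F_def indicator_def split: if_splits)
    fix h :: "real ^ 'n" assume h: "\<forall>i. \<bar>h $ i\<bar> \<le> r"
    have "(\<integral>\<^sup>+x. F (x, x + h) \<partial>lborel) \<le> (\<integral>\<^sup>+x. Y (x, h) \<partial>lborel)"
      using Y1[OF h] by (intro nn_integral_mono_AE, eventually_elim) (auto simp: F_def B'_def indicator_def)
    also have "\<dots> \<le> ennreal (2 * r) * X" by (rule Y2)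
    finally show "(\<integral>\<^sup>+x. F (x, x + h) \<partial>lborel) \<le> ennreal (2 * r) * X" .
  qed measurable
  have intH: "(\<integral>\<^sup>+x. (\<integral>\<^sup>+y. H (x, y) \<partial>lborel) \<partial>lborel) \<le> ennreal ((2 * r) ^ ?n) * ennreal \<beta>"
  proof (rule nn_integral_pairs_translate[OF _ r])
    show "x \<in> ?R \<and> y \<in> ?R" if "H (x, y) \<noteq> 0" for x y
      using that by (auto simp: H_def indicator_def split: if_splits)
    fix h :: "real ^ 'n"
    have [measurable]: "{x. (x, h) \<in> B} \<in> sets lborel"
      using measurable_sets[of "\<lambda>x. (x, h)" borel "borel \<Otimes>\<^sub>M borel" B] by (simp add: vimage_def)
    have "(\<integral>\<^sup>+x. H (x, x + h) \<partial>lborel) \<le> (\<integral>\<^sup>+x. indicator {x. (x, h) \<in> B} x \<partial>lborel)"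
      by (intro nn_integral_mono) (auto simp: H_def B'_def indicator_def)
    also have "\<dots> \<le> ennreal \<beta>" using Y3' by simp
    finally show "(\<integral>\<^sup>+x. H (x, x + h) \<partial>lborel) \<le> ennreal \<beta>" .
  qed measurable
  have "\<exists>x\<in>?R. (\<integral>\<^sup>+y. H (x, y) \<partial>lborel) \<le> 3 * (ennreal ((2 * r) ^ ?n) * ennreal \<beta>) / ennreal (r ^ ?n) \<and>
      (\<integral>\<^sup>+y. F (x, y) \<partial>lborel) \<le> 3 * (ennreal ((2 * r) ^ ?n) * (ennreal (2 * r) * X)) / ennreal (r ^ ?n)"
  proof (rule exists_point_below_averages[where M=lborel])
    show "emeasure lborel ?R = ennreal (r ^ ?n)" using r by (simp add: emeasure_cb)
    show "(\<integral>\<^sup>+x. (\<integral>\<^sup>+y. H (x, y) \<partial>lborel) * indicator ?R x \<partial>lborel) \<le> ennreal ((2 * r) ^ ?n) * ennreal \<beta>"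
      by (rule order_trans[OF _ intH]) (auto intro!: nn_integral_mono simp: indicator_def)
    show "(\<integral>\<^sup>+x. (\<integral>\<^sup>+y. F (x, y) \<partial>lborel) * indicator ?R x \<partial>lborel) \<le> ennreal ((2 * r) ^ ?n) * (ennreal (2 * r) * X)"
      by (rule order_trans[OF _ intF]) (auto intro!: nn_integral_mono simp: indicator_def)
  qed (use r in \<open>measurable, auto\<close>)
  then obtain x where x: "x \<in> ?R"
    and xH: "(\<integral>\<^sup>+y. H (x, y) \<partial>lborel) \<le> 3 * (ennreal ((2 * r) ^ ?n) * ennreal \<beta>) / ennreal (r ^ ?n)"
    and xF: "(\<integral>\<^sup>+y. F (x, y) \<partial>lborel) \<le> 3 * (ennreal ((2 * r) ^ ?n) * (ennreal (2 * r) * X)) / ennreal (r ^ ?n)"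
    by blast
  define N where "N = {y. (x, y) \<in> ?R \<times> ?R \<inter> B'}"
  have N: "N \<in> sets borel"
    unfolding N_def using measurable_sets[of "\<lambda>y. (x, y)" borel "borel \<Otimes>\<^sub>M borel" "?R \<times> ?R \<inter> B'"] by (simp add: vimage_def)
  have div: "3 * (ennreal ((2 * r) ^ ?n) * Z) / ennreal (r ^ ?n) = ennreal (3 * 2 ^ ?n) * Z" for Z
  proof -
    have "3 * (ennreal ((2 * r) ^ ?n) * Z) / ennreal (r ^ ?n) = ennreal (3 * (2 * r) ^ ?n) * Z / ennreal (r ^ ?n)"
      using r by (simp add: ennreal_mult' mult.assoc)
    also have "\<dots> = Z * (ennreal (3 * (2 * r) ^ ?n) / ennreal (r ^ ?n))"
      by (simp add: ennreal_times_divide mult.commute)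
    also have "ennreal (3 * (2 * r) ^ ?n) / ennreal (r ^ ?n) = ennreal (3 * 2 ^ ?n)"
      using r by (simp add: divide_ennreal power_mult_distrib)
    finally show ?thesis by (simp add: mult.commute)
  qed
  have "emeasure lborel N = (\<integral>\<^sup>+y. indicator N y \<partial>lborel)"
    using N by simp
  also have "\<dots> = (\<integral>\<^sup>+y. H (x, y) \<partial>lborel)"
    by (intro nn_integral_cong) (simp add: H_def N_def indicator_def)
  also have "\<dots> \<le> ennreal (3 * 2 ^ ?n) * ennreal \<beta>"
    using xH unfolding div .
  also have "\<dots> = ennreal (3 * 2 ^ ?n * ?n * (\<Sum>(a, l)\<in>\<P>. r * l ^ (?n - 1)))"
    using \<beta> by (simp add: ennreal_mult'[symmetric] \<beta>_def mult.assoc)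
  finally have 1: "emeasure lborel N \<le> ennreal (3 * 2 ^ ?n * ?n * (\<Sum>(a, l)\<in>\<P>. r * l ^ (?n - 1)))" .
  have "(\<integral>\<^sup>+y. ennreal \<bar>f y - f x\<bar> * indicator (?R - N) y \<partial>lborel) = (\<integral>\<^sup>+y. F (x, y) \<partial>lborel)"
    using x by (intro nn_integral_cong) (auto simp: F_def N_def indicator_def)
  also have "\<dots> \<le> ennreal (3 * 2 ^ ?n) * (ennreal (2 * r) * X)"
    using xF unfolding div .
  also have "\<dots> = ennreal (6 * 2 ^ ?n * r) * X"
    using r by (simp add: mult.assoc[symmetric] ennreal_mult'[symmetric])
  finally show ?thesis
    using N 1 unfolding X_def by blast
qed

end

section \<open>Passage from Borel to Lebesgue-measurable functions\<close>

lemma locally_integrable_measurable: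
  fixes f :: "real ^ 'n \<Rightarrow> 'b::{banach, second_countable_topology}"
  assumes "locally_integrable f"
  shows "f \<in> borel_measurable lebesgue"
proof (rule borel_measurable_LIMSEQ_metric)
  show "(\<lambda>x. indicator (cball 0 (real k)) x *\<^sub>R f x) \<in> borel_measurable lebesgue" for k
    by (rule borel_measurable_integrable)
       (use assms compact_cball in \<open>simp add: locally_integrable_def set_integrable_def\<close>)
  show "(\<lambda>k. indicator (cball 0 (real k)) x *\<^sub>R f x) \<longlonglongrightarrow> f x" for x
  proof (rule tendsto_eventually)
    obtain k0 :: nat where "norm x \<le> real k0" using real_arch_simple by blast
    then show "\<forall>\<^sub>F k in sequentially. indicator (cball 0 (real k)) x *\<^sub>R f x = f x"
      by (intro eventually_sequentiallyI[of k0]) (auto simp: indicator_def)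
  qed
qed

text \<open>Translations and product measures are handled on \<open>lborel\<close>. A
  Lebesgue-measurable function need only be changed on a null set, which the integrals in the weak
  identity do not notice.\<close>

lemma borel_representative:
  fixes f :: "real ^ 'n \<Rightarrow> real"
  assumes f: "f \<in> borel_measurable lebesgue"
    and int: "\<And>a b. set_integrable lebesgue (cbox a b) f"
  obtains f' where "f' \<in> borel_measurable borel" "AE x in lborel. f x = f' x"
    "\<And>a b. set_integrable lborel (cbox a b) f'"
    "\<And>\<phi>. \<phi> \<in> borel_measurable borel \<Longrightarrow> (\<integral>x. f x * \<phi> x \<partial>lebesgue) = (\<integral>x. f' x * \<phi> x \<partial>lborel)"
proof -
  obtain f' where f': "f' \<in> borel_measurable lborel" "AE x in lborel. f x = f' x"
    using completion_ex_borel_measurable_real[OF f] by blast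
  then have [measurable]: "f' \<in> borel_measurable borel"
    by (simp add: measurable_lborel1)
  have AE: "AE x in lebesgue. f x = f' x" using f'(2) by (rule AE_completion)
  have eq: "(\<integral>x. f x * \<phi> x \<partial>lebesgue) = (\<integral>x. f' x * \<phi> x \<partial>lborel)" if [measurable]: "\<phi> \<in> borel_measurable borel" for \<phi>
  proof -
    have "(\<integral>x. f x * \<phi> x \<partial>lebesgue) = (\<integral>x. f' x * \<phi> x \<partial>lebesgue)"
    proof (rule integral_cong_AE)
      show "(\<lambda>x. f x * \<phi> x) \<in> borel_measurable lebesgue" "(\<lambda>x. f' x * \<phi> x) \<in> borel_measurable lebesgue"
        by (intro borel_measurable_times f measurable_completion; simp)+
      show "AE x in lebesgue. f x * \<phi> x = f' x * \<phi> x"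
        using AE by eventually_elim simp
    qed
    also have "\<dots> = (\<integral>x. f' x * \<phi> x \<partial>lborel)"
      by (rule integral_completion) measurable
    finally show ?thesis .
  qed
  have "set_integrable lborel (cbox a b) f'" for a b
  proof -
    have i: "integrable lebesgue (\<lambda>x. indicator (cbox a b) x *\<^sub>R f x)"
      using int[of a b] by (simp add: set_integrable_def)
    have "integrable lebesgue (\<lambda>x. indicator (cbox a b) x *\<^sub>R f' x)"
    proof (rule integrable_cong_AE[THEN iffD1, OF _ _ _ i])
      show "(\<lambda>x. indicator (cbox a b) x *\<^sub>R f' x) \<in> borel_measurable lebesgue"
        by (intro measurable_completion) measurable
      show "AE x in lebesgue. indicator (cbox a b) x *\<^sub>R f x = indicator (cbox a b) x *\<^sub>R f' x"
        using AE by eventually_elim simp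
    qed (use i in auto)
    then show ?thesis
      unfolding set_integrable_def by (subst (asm) integrable_completion) auto
  qed
  then show thesis
    using f' eq by (intro that[of f']) auto
qed

text \<open>Each partial derivative is bounded by |G|, which costs a factor n on the right.\<close>

lemma weak_gradient_poincare_with_holes:
  fixes f :: "real ^ 'n \<Rightarrow> real" and \<P> :: "((real ^ 'n) \<times> real) set" and r :: real
  assumes f: "locally_integrable f" and G: "has_weak_gradient f G"
    and fin: "finite \<P>" and pos: "\<And>a l. (a, l) \<in> \<P> \<Longrightarrow> 0 < l" and r: "0 < r"
  defines "U \<equiv> \<Union>(a, l)\<in>\<P>. cb a l"
  shows "\<exists>m N. N \<in> sets borel \<and>
    emeasure lborel N \<le> ennreal (3 * 2 ^ CARD('n) * CARD('n) * (\<Sum>(a, l)\<in>\<P>. r * l ^ (CARD('n) - 1))) \<and>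
    (\<integral>\<^sup>+y. ennreal \<bar>f y - m\<bar> * indicator (cb c r - N) y \<partial>lebesgue)
      \<le> ennreal (6 * 2 ^ CARD('n) * CARD('n) * r) * (\<integral>\<^sup>+z. ennreal (norm (G z)) * indicator (cb c r - U) z \<partial>lebesgue)"
proof -
  have fm: "f \<in> borel_measurable lebesgue" using f by (rule locally_integrable_measurable)
  have GI: "locally_integrable G" using G by (simp add: has_weak_gradient_def)
  have "set_integrable lebesgue (cbox a b) f" for a b
    using f by (simp add: locally_integrable_def)
  from borel_representative[OF fm this] obtain f' where f': "f' \<in> borel_measurable borel" "AE x in lborel. f x = f' x"
    "\<And>a b. set_integrable lborel (cbox a b) f'"
    "\<And>\<phi>. \<phi> \<in> borel_measurable borel \<Longrightarrow> (\<integral>x. f x * \<phi> x \<partial>lebesgue) = (\<integral>x. f' x * \<phi> x \<partial>lborel)"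
    by blast
  have "\<exists>g. g \<in> borel_measurable borel \<and> (AE x in lborel. G x $ i = g x) \<and>
    (\<forall>a b. set_integrable lborel (cbox a b) g) \<and>
    (\<forall>\<phi>\<in>borel_measurable borel. (\<integral>x. G x $ i * \<phi> x \<partial>lebesgue) = (\<integral>x. g x * \<phi> x \<partial>lborel))" for i
  proof -
    have Gm: "G \<in> borel_measurable lebesgue" using GI by (rule locally_integrable_measurable)
    have "(\<lambda>x. x $ i) \<in> borel_measurable (borel :: (real ^ 'n) measure)"
      by (intro borel_measurable_continuous_onI continuous_intros)
    then have 1: "(\<lambda>x. G x $ i) \<in> borel_measurable lebesgue"
      by (rule measurable_compose[OF Gm])
    have 2: "set_integrable lebesgue (cbox a b) (\<lambda>x. G x $ i)" for a b
    proof -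
      have "integrable lebesgue (\<lambda>x. indicator (cbox a b) x *\<^sub>R G x)"
        using GI by (simp add: locally_integrable_def set_integrable_def)
      then have "integrable lebesgue (\<lambda>x. (indicator (cbox a b) x *\<^sub>R G x) $ i)"
        by (rule integrable_bounded_linear[OF bounded_linear_vec_nth])
      then show ?thesis by (simp add: set_integrable_def)
    qed
    from borel_representative[OF 1 2] obtain g where "g \<in> borel_measurable borel" "AE x in lborel. G x $ i = g x"
      "\<And>a b. set_integrable lborel (cbox a b) g"
      "\<And>\<phi>. \<phi> \<in> borel_measurable borel \<Longrightarrow> (\<integral>x. G x $ i * \<phi> x \<partial>lebesgue) = (\<integral>x. g x * \<phi> x \<partial>lborel)"
      by blast
    then show ?thesis by (intro exI[of _ g]) simp
  qed
  then have gex: "\<forall>i. \<exists>g. g \<in> borel_measurable borel \<and> (AE x in lborel. G x $ i = g x) \<and>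
    (\<forall>a b. set_integrable lborel (cbox a b) g) \<and>
    (\<forall>\<phi>\<in>borel_measurable borel. (\<integral>x. G x $ i * \<phi> x \<partial>lebesgue) = (\<integral>x. g x * \<phi> x \<partial>lborel))"
    ..
  from choice[OF gex] obtain g where g: "\<And>i. g i \<in> borel_measurable borel" "\<And>i. AE x in lborel. G x $ i = g i x"
    "\<And>i a b. set_integrable lborel (cbox a b) (g i)"
    "\<And>i \<phi>. \<phi> \<in> borel_measurable borel \<Longrightarrow> (\<integral>x. G x $ i * \<phi> x \<partial>lebesgue) = (\<integral>x. g i x * \<phi> x \<partial>lborel)"
    by blast
  interpret weak_partials f' g
  proof
    fix i :: 'n and a b :: "real ^ 'n" and m
    have [measurable]: "partial i (box_bump a b m) \<in> borel_measurable borel" "box_bump a b m \<in> borel_measurable borel"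
      by (intro borel_measurable_continuous_onI smooth_fun_continuous smooth_fun_partial smooth_fun_box_bump)+
    have "(\<integral>x. f x * partial i (box_bump a b m) x \<partial>lebesgue) = - (\<integral>x. G x $ i * box_bump a b m x \<partial>lebesgue)"
      using G test_function_box_bump[of a b m] unfolding has_weak_gradient_def by blast
    then show "(\<integral>x. f' x * partial i (box_bump a b m) x \<partial>lborel) = - (\<integral>x. g i x * box_bump a b m x \<partial>lborel)"
      by (simp add: f'(4) g(4))
  qed (use f' g in auto)
  obtain m N where N: "N \<in> sets borel"
    "emeasure lborel N \<le> ennreal (3 * 2 ^ CARD('n) * CARD('n) * (\<Sum>(a, l)\<in>\<P>. r * l ^ (CARD('n) - 1)))"
    "(\<integral>\<^sup>+y. ennreal \<bar>f' y - m\<bar> * indicator (cb c r - N) y \<partial>lborel)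
      \<le> ennreal (6 * 2 ^ CARD('n) * r) * (\<Sum>i\<in>UNIV. \<integral>\<^sup>+z. ennreal \<bar>g i z\<bar> * indicator (cb c r - U) z \<partial>lborel)"
  proof -
    note * = poincare_with_holes[where \<P>=\<P> and r=r and c=c, OF fin _ r, folded U_def]
    show thesis
      by (rule exE[OF *]) (use pos that in blast)+
  qed
  have S: "(\<Sum>i\<in>UNIV. \<integral>\<^sup>+z. ennreal \<bar>g i z\<bar> * indicator (cb c r - U) z \<partial>lborel)
      \<le> (\<Sum>i\<in>(UNIV :: 'n set). \<integral>\<^sup>+z. ennreal (norm (G z)) * indicator (cb c r - U) z \<partial>lebesgue)"
  proof (rule sum_mono)
    fix i
    have "(\<integral>\<^sup>+z. ennreal \<bar>g i z\<bar> * indicator (cb c r - U) z \<partial>lborel) \<le> (\<integral>\<^sup>+z. ennreal (norm (G z)) * indicator (cb c r - U) z \<partial>lborel)"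
    proof (rule nn_integral_mono_AE)
      show "AE z in lborel. ennreal \<bar>g i z\<bar> * indicator (cb c r - U) z \<le> ennreal (norm (G z)) * indicator (cb c r - U) z"
        using g(2)[of i]
      proof eventually_elim
        case (elim z)
        then show ?case
          using component_le_norm_cart[of "G z" i] by (auto intro!: mult_right_mono ennreal_leI)
      qed
    qed
    then show "(\<integral>\<^sup>+z. ennreal \<bar>g i z\<bar> * indicator (cb c r - U) z \<partial>lborel) \<le> (\<integral>\<^sup>+z. ennreal (norm (G z)) * indicator (cb c r - U) z \<partial>lebesgue)"
      by (simp only: nn_integral_completion)
  qed
  have E1: "(\<integral>\<^sup>+y. ennreal \<bar>f y - m\<bar> * indicator (cb c r - N) y \<partial>lebesgue) = (\<integral>\<^sup>+y. ennreal \<bar>f' y - m\<bar> * indicator (cb c r - N) y \<partial>lborel)"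
    unfolding nn_integral_completion using f'(2) by (intro nn_integral_cong_AE) (auto elim!: eventually_mono)
  have E3: "ennreal (6 * 2 ^ CARD('n) * r) * (\<Sum>i\<in>UNIV. \<integral>\<^sup>+z. ennreal \<bar>g i z\<bar> * indicator (cb c r - U) z \<partial>lborel) \<le>
      ennreal (6 * 2 ^ CARD('n) * r) * (\<Sum>i\<in>(UNIV :: 'n set). \<integral>\<^sup>+z. ennreal (norm (G z)) * indicator (cb c r - U) z \<partial>lebesgue)"
    by (intro mult_left_mono S) simp
  have E4: "ennreal (6 * 2 ^ CARD('n) * r) * (\<Sum>i\<in>(UNIV :: 'n set). \<integral>\<^sup>+z. ennreal (norm (G z)) * indicator (cb c r - U) z \<partial>lebesgue)
     = ennreal (6 * 2 ^ CARD('n) * CARD('n) * r) * (\<integral>\<^sup>+z. ennreal (norm (G z)) * indicator (cb c r - U) z \<partial>lebesgue)"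
  proof -
    have "ennreal (6 * 2 ^ CARD('n) * CARD('n) * r) = ennreal (6 * 2 ^ CARD('n) * r) * of_nat CARD('n)"
      using r by (subst ennreal_of_nat_eq_real_of_nat, subst ennreal_mult[symmetric]) (auto simp: mult_ac)
    then show ?thesis by (simp only: sum_constant mult.assoc)
  qed
  have *: "(\<integral>\<^sup>+y. ennreal \<bar>f y - m\<bar> * indicator (cb c r - N) y \<partial>lebesgue)
      \<le> ennreal (6 * 2 ^ CARD('n) * CARD('n) * r) * (\<integral>\<^sup>+z. ennreal (norm (G z)) * indicator (cb c r - U) z \<partial>lebesgue)"
    by (rule order_trans[OF eq_refl[OF E1] order_trans[OF N(3) order_trans[OF E3 eq_refl[OF E4]]]])
  show ?thesis
  proof (rule exI[of _ m], rule exI[of _ N], rule conjI[OF _ conjI])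
    show "N \<in> sets borel" by (rule N)
  next
    show "emeasure lborel N \<le> ennreal (3 * 2 ^ CARD('n) * CARD('n) * (\<Sum>(a, l)\<in>\<P>. r * l ^ (CARD('n) - 1)))" by (rule N)
  next
    show "(\<integral>\<^sup>+y. ennreal \<bar>f y - m\<bar> * indicator (cb c r - N) y \<partial>lebesgue)
      \<le> ennreal (6 * 2 ^ CARD('n) * CARD('n) * r) * (\<integral>\<^sup>+z. ennreal (norm (G z)) * indicator (cb c r - U) z \<partial>lebesgue)" by (rule *)
  qed
qed

text \<open>The factors are 3 * 2^n from the choice of the base point, 2 from the length 2r of the
  line segments, and n from the directions.\<close>

definition poincare_const :: "nat \<Rightarrow> real" where
  "poincare_const n = 6 * 2 ^ n * n"

text \<open>The default value 0 of a Bochner integral that does not exist only helps. The double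
  integral in \<open>oscillation\<close> can thus be estimated without checking that it
  exists.\<close>

lemma ennreal_integral_le_nn_integral:
  fixes u :: "'a \<Rightarrow> real"
  assumes "\<And>x. 0 \<le> u x"
  shows "ennreal (\<integral>x. u x \<partial>M) \<le> (\<integral>\<^sup>+x. ennreal (u x) \<partial>M)"
  by (cases "integrable M u")
     (auto simp: assms nn_integral_eq_integral not_integrable_integral_eq)

text \<open>The boundary of a cube is a null set, and completeness of the Lebesgue measure makes
  every set between the open and the closed cube measurable, whatever end points it
  contains.\<close>

lemma cube_AE:
  fixes a :: "real ^ 'n"
  assumes l: "0 < l" and Q: "cb a l \<subseteq> Q" "Q \<subseteq> cbox a (a + vec l)"
  shows "AE x in lebesgue. x \<in> Q \<longleftrightarrow> x \<in> cb a l"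
    and "Q \<in> sets lebesgue"
    and "emeasure lebesgue Q = ennreal (l ^ CARD('n))"
    and "measure lebesgue Q = l ^ CARD('n)"
proof -
  let ?D = "cbox a (a + vec l) - cb a l"
  have "emeasure lborel ?D = emeasure lborel (cbox a (a + vec l)) - emeasure lborel (cb a l)"
    using box_subset_cbox[of a "a + vec l"]
    using emeasure_lborel_box_finite[of a "a + vec l"] by (intro emeasure_Diff) (auto simp: cb_def)
  also have "emeasure lborel (cbox a (a + vec l)) = emeasure lborel (cb a l)"
    by (simp add: cb_def emeasure_lborel_box_eq emeasure_lborel_cbox_eq)
  finally have "?D \<in> null_sets lborel"
    using l by (auto simp: null_sets_def emeasure_cb)
  then have nD: "?D \<in> null_sets lebesgue"
    by (rule null_sets_completionI)
  then have "AE x in lebesgue. x \<notin> ?D"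
    by (rule AE_not_in)
  then show AE: "AE x in lebesgue. x \<in> Q \<longleftrightarrow> x \<in> cb a l"
    by eventually_elim (use Q in auto)
  have "Q - cb a l \<in> null_sets lebesgue"
    using Q by (intro null_sets_completion_subset[OF _ nD]) auto
  moreover have cbm: "cb a l \<in> sets lebesgue"
    by (simp add: sets_completionI_sets)
  moreover have "Q = cb a l \<union> (Q - cb a l)" using Q by auto
  ultimately show Qm: "Q \<in> sets lebesgue"
    by (metis null_setsD2 sets.Un)
  have "emeasure lebesgue Q = emeasure lebesgue (cb a l)"
    using AE Qm cbm by (intro emeasure_eq_AE) auto
  also have "\<dots> = ennreal (l ^ CARD('n))"
    using l by (simp add: emeasure_cb)
  finally show "emeasure lebesgue Q = ennreal (l ^ CARD('n))" .
  then show "measure lebesgue Q = l ^ CARD('n)"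
    using l by (simp add: measure_def)
qed

text \<open>Split |f(x) - f(y)| at the value m. Each part integrates to |Q| times the total
  deviation from m, and |Q|^(-1 - 1/n) |Q| = 1/l.\<close>

lemma oscillation_le_mean_deviation:
  fixes f :: "real ^ 'n \<Rightarrow> real"
  assumes f [measurable]: "f \<in> borel_measurable lebesgue" and l: "0 < l"
    and Q: "cb a l \<subseteq> Q" "Q \<subseteq> cbox a (a + vec l)"
  shows "ennreal (oscillation Q f) \<le> ennreal (2 / l) * (\<integral>\<^sup>+x. ennreal \<bar>f x - m\<bar> * indicator (cb a l) x \<partial>lebesgue)"
proof -
  note Qf = cube_AE[OF l Q]
  have [measurable]: "Q \<in> sets lebesgue" by (rule Qf)
  let ?T = "\<integral>\<^sup>+x. ennreal \<bar>f x - m\<bar> * indicator Q x \<partial>lebesgue"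
  let ?L = "ennreal (l ^ CARD('n))"
  have T: "?T = (\<integral>\<^sup>+x. ennreal \<bar>f x - m\<bar> * indicator (cb a l) x \<partial>lebesgue)"
    using Qf(1) by (intro nn_integral_cong_AE, eventually_elim) (auto simp: indicator_def)
  have one: "(\<integral>\<^sup>+x. c * indicator Q x \<partial>lebesgue) = c * ?L" for c :: ennreal
    by (simp add: nn_integral_cmult_indicator Qf)
  have inner: "ennreal (LINT x:Q|lebesgue. \<bar>f x - f y\<bar>) \<le> ?T + ennreal \<bar>f y - m\<bar> * ?L" for y
  proof -
    have "ennreal (LINT x:Q|lebesgue. \<bar>f x - f y\<bar>) \<le> (\<integral>\<^sup>+x. ennreal (indicator Q x *\<^sub>R \<bar>f x - f y\<bar>) \<partial>lebesgue)"
      unfolding set_lebesgue_integral_def by (rule ennreal_integral_le_nn_integral) simp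
    also have "\<dots> \<le> (\<integral>\<^sup>+x. ennreal \<bar>f x - m\<bar> * indicator Q x + ennreal \<bar>f y - m\<bar> * indicator Q x \<partial>lebesgue)"
    proof (rule nn_integral_mono)
      fix x
      have "ennreal \<bar>f x - f y\<bar> \<le> ennreal (\<bar>f x - m\<bar> + \<bar>f y - m\<bar>)" by (intro ennreal_leI) linarith
      then show "ennreal (indicator Q x *\<^sub>R \<bar>f x - f y\<bar>) \<le> ennreal \<bar>f x - m\<bar> * indicator Q x + ennreal \<bar>f y - m\<bar> * indicator Q x"
        by (auto simp: indicator_def)
    qed
    also have "\<dots> = ?T + ennreal \<bar>f y - m\<bar> * ?L"
      by (subst nn_integral_add) (auto simp: one)
    finally show ?thesis .
  qed
  have "ennreal (LINT y:Q|lebesgue. (LINT x:Q|lebesgue. \<bar>f x - f y\<bar>)) \<le> (\<integral>\<^sup>+y. ennreal (indicator Q y *\<^sub>R (LINT x:Q|lebesgue. \<bar>f x - f y\<bar>)) \<partial>lebesgue)"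
    unfolding set_lebesgue_integral_def by (rule ennreal_integral_le_nn_integral) simp
  also have "\<dots> \<le> (\<integral>\<^sup>+y. ?T * indicator Q y + (ennreal \<bar>f y - m\<bar> * indicator Q y) * ?L \<partial>lebesgue)"
    using inner by (intro nn_integral_mono) (auto simp: indicator_def)
  also have "\<dots> = 2 * ?L * ?T"
  proof (subst nn_integral_add)
    show "(\<integral>\<^sup>+y. ?T * indicator Q y \<partial>lebesgue) + (\<integral>\<^sup>+y. ennreal \<bar>f y - m\<bar> * indicator Q y * ?L \<partial>lebesgue) = 2 * ?L * ?T"
      unfolding one by (subst nn_integral_multc) (auto simp: mult_2 distrib_right mult.commute[of ?L])
  qed auto
  finally have le: "ennreal (LINT y:Q|lebesgue. (LINT x:Q|lebesgue. \<bar>f x - f y\<bar>)) \<le> 2 * ?L * ?T" .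
  have pw: "(l ^ CARD('n)) powr (- 1 - 1 / real CARD('n)) * l ^ CARD('n) = 1 / l"
    using l by (simp add: powr_realpow[symmetric] powr_powr powr_add[symmetric] field_simps powr_minus_divide)
  have "ennreal (oscillation Q f) = ennreal ((l ^ CARD('n)) powr (- 1 - 1 / real CARD('n))) * ennreal (LINT y:Q|lebesgue. (LINT x:Q|lebesgue. \<bar>f x - f y\<bar>))"
    unfolding oscillation_def Qf by (simp add: ennreal_mult')
  also have "\<dots> \<le> ennreal ((l ^ CARD('n)) powr (- 1 - 1 / real CARD('n))) * (2 * ?L * ?T)"
    by (intro mult_left_mono le) simp
  also have "\<dots> = ennreal (2 * ((l ^ CARD('n)) powr (- 1 - 1 / real CARD('n)) * l ^ CARD('n))) * ?T"
    using l by (simp add: ennreal_mult' mult_ac)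
  also have "\<dots> = ennreal (2 / l) * ?T"
    unfolding pw by simp
  finally show ?thesis unfolding T .
qed

text \<open>The case without holes: N is a null set, and the factor r of the Poincare inequality
  cancels 1/l.\<close>

lemma oscillation_le:
  fixes f :: "real ^ 'n \<Rightarrow> real"
  assumes f: "locally_integrable f" and G: "has_weak_gradient f G" and l: "0 < l"
    and Q: "cb a l \<subseteq> Q" "Q \<subseteq> cbox a (a + vec l)"
  shows "ennreal (oscillation Q f) \<le> ennreal (2 * poincare_const CARD('n)) * (\<integral>\<^sup>+z. ennreal (norm (G z)) * indicator (cb a l) z \<partial>lebesgue)"
proof -
  obtain m N where N: "N \<in> sets borel" "emeasure lborel N \<le> 0"
    and le: "(\<integral>\<^sup>+y. ennreal \<bar>f y - m\<bar> * indicator (cb a l - N) y \<partial>lebesgue)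
      \<le> ennreal (poincare_const CARD('n) * l) * (\<integral>\<^sup>+z. ennreal (norm (G z)) * indicator (cb a l) z \<partial>lebesgue)"
    using weak_gradient_poincare_with_holes[OF f G finite.emptyI _ l, of a] by (auto simp: poincare_const_def)
  then have "N \<in> null_sets lborel" by (auto simp: null_sets_def)
  then have "AE x in lebesgue. x \<notin> N"
    by (intro AE_not_in null_sets_completionI)
  then have "(\<integral>\<^sup>+y. ennreal \<bar>f y - m\<bar> * indicator (cb a l) y \<partial>lebesgue) \<le> (\<integral>\<^sup>+y. ennreal \<bar>f y - m\<bar> * indicator (cb a l - N) y \<partial>lebesgue)"
    by (intro nn_integral_mono_AE, eventually_elim) (auto simp: indicator_def)
  note le2 = order_trans[OF this le]
  have "ennreal (oscillation Q f) \<le> ennreal (2 / l) * (\<integral>\<^sup>+y. ennreal \<bar>f y - m\<bar> * indicator (cb a l) y \<partial>lebesgue)"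
    by (rule oscillation_le_mean_deviation[OF locally_integrable_measurable[OF f] l Q])
  also have "\<dots> \<le> ennreal (2 / l) * (ennreal (poincare_const CARD('n) * l) * (\<integral>\<^sup>+z. ennreal (norm (G z)) * indicator (cb a l) z \<partial>lebesgue))"
    by (intro mult_left_mono le2) simp
  also have "\<dots> = ennreal (2 * poincare_const CARD('n)) * (\<integral>\<^sup>+z. ennreal (norm (G z)) * indicator (cb a l) z \<partial>lebesgue)"
    using l by (simp add: mult.assoc[symmetric] ennreal_mult'[symmetric] poincare_const_def)
  finally show ?thesis .
qed

section \<open>Finite laminar families of cubes\<close>

text \<open>The sum of the geometric series with ratio 2^(-\<theta>).\<close>

definition geom_const :: "real \<Rightarrow> real" where
  "geom_const \<theta> = 1 / (1 - 2 powr (- \<theta>))"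

lemma geom_const_pos: "0 < \<theta> \<Longrightarrow> 0 < geom_const \<theta>"
  by (simp add: geom_const_def powr_less_one)

lemma sum_powr_le_up:
  fixes k :: "'a \<Rightarrow> int" and \<theta> \<eta> q c X :: real
  assumes \<theta>: "0 < \<theta>" and fin: "finite A" and inj: "inj_on k A" and m: "\<And>a. a \<in> A \<Longrightarrow> m \<le> k a"
  shows "(\<Sum>a\<in>A. 2 powr (- \<theta> * k a)) \<le> 2 powr (- \<theta> * m) * geom_const \<theta>"
proof -
  define r where "r = 2 powr (- \<theta>)"
  have r: "0 < r" "r < 1" using \<theta> by (auto simp: r_def powr_less_one)
  let ?j = "\<lambda>a. nat (k a - m)"
  have eq: "2 powr (- \<theta> * k a) = 2 powr (- \<theta> * m) * r ^ ?j a" if "a \<in> A" for a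
  proof -
    have "r ^ ?j a = 2 powr (- \<theta> * (k a - m))"
      using m[OF that] by (simp add: r_def powr_powr powr_realpow[symmetric])
    then show ?thesis
      by (simp add: powr_add[symmetric] algebra_simps)
  qed
  have "inj_on ?j A"
    using inj m by (auto simp: inj_on_def) (metis diff_ge_0_iff_ge eq_iff_diff_eq_0 diff_add_cancel nat_eq_iff2)
  then have "(\<Sum>a\<in>A. r ^ ?j a) = (\<Sum>j\<in>?j ` A. r ^ j)"
    by (simp add: sum.reindex)
  also have "\<dots> \<le> (\<Sum>j. r ^ j)"
    using r fin by (intro sum_le_suminf summable_geometric) auto
  also have "\<dots> = geom_const \<theta>"
    using r by (simp add: suminf_geometric geom_const_def r_def)
  finally have "2 powr (- \<theta> * m) * (\<Sum>a\<in>A. r ^ ?j a) \<le> 2 powr (- \<theta> * m) * geom_const \<theta>"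
    by (intro mult_left_mono) auto
  moreover have "(\<Sum>a\<in>A. 2 powr (- \<theta> * k a)) = (\<Sum>a\<in>A. 2 powr (- \<theta> * m) * r ^ ?j a)"
    by (rule sum.cong[OF refl eq])
  ultimately show ?thesis
    by (simp only: sum_distrib_left)
qed

lemma sum_powr_le_down:
  fixes k :: "'a \<Rightarrow> int" and \<theta> \<eta> q c X :: real
  assumes \<theta>: "0 < \<theta>" and fin: "finite A" and inj: "inj_on k A" and m: "\<And>a. a \<in> A \<Longrightarrow> k a \<le> m"
  shows "(\<Sum>a\<in>A. 2 powr (\<theta> * k a)) \<le> 2 powr (\<theta> * m) * geom_const \<theta>"
proof -
  have "inj_on (\<lambda>a. - k a) A" using inj by (auto simp: inj_on_def)
  from sum_powr_le_up[OF \<theta> fin this, of "- m"] m show ?thesis by simp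
qed

text \<open>A geometric sum is comparable to its largest term, which sits at the top or the bottom
  scale according to the sign of \<eta> and does not exceed X^q. For \<eta> = 0 the sum would merely
  count the scales; this is what excludes \<beta> = 1/p.\<close>

lemma sum_powr_below_threshold:
  fixes k :: "'a \<Rightarrow> int" and \<theta> \<eta> q c X :: real
  assumes "\<eta> \<noteq> 0" "0 < q" "0 < c" and fin: "finite A" and inj: "inj_on k A"
    and le: "\<And>a. a \<in> A \<Longrightarrow> c * 2 powr (\<eta> * k a) \<le> X"
  shows "(\<Sum>a\<in>A. (c * 2 powr (\<eta> * k a)) powr q) \<le> geom_const (\<bar>\<eta>\<bar> * q) * X powr q"
proof (cases "A = {}")
  case True
  then show ?thesis using geom_const_pos[of "\<bar>\<eta>\<bar> * q"] assms by simp
next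
  case False
  have pw: "(c * 2 powr (\<eta> * k a)) powr q = c powr q * 2 powr (\<eta> * q * k a)" for a
    using assms by (simp add: powr_mult powr_powr mult_ac)
  have "\<exists>b\<in>A. (\<Sum>a\<in>A. 2 powr (\<eta> * q * k a)) \<le> 2 powr (\<eta> * q * k b) * geom_const (\<bar>\<eta>\<bar> * q)"
  proof (cases "0 < \<eta>")
    case True
    have "Max (k ` A) \<in> k ` A" using fin False by simp
    then obtain b where "b \<in> A" "k b = Max (k ` A)" by auto
    have "(\<Sum>a\<in>A. 2 powr (\<eta> * q * k a)) \<le> 2 powr (\<eta> * q * k b) * geom_const (\<eta> * q)"
      by (rule sum_powr_le_down) (use True assms \<open>k b = _\<close> in auto)
    with \<open>b \<in> A\<close> show ?thesis
      using True by (intro bexI[of _ b]) auto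
  next
    case 2: False
    have "Min (k ` A) \<in> k ` A" using fin False by simp
    then obtain b where "b \<in> A" "k b = Min (k ` A)" by auto
    have "(\<Sum>a\<in>A. 2 powr (- (- \<eta> * q) * k a)) \<le> 2 powr (- (- \<eta> * q) * k b) * geom_const (- \<eta> * q)"
      by (rule sum_powr_le_up) (use 2 assms \<open>k b = _\<close> in \<open>auto simp: mult_neg_pos\<close>)
    with \<open>b \<in> A\<close> show ?thesis
      using 2 by (intro bexI[of _ b]) (auto simp: abs_if)
  qed
  then obtain b where b: "b \<in> A" "(\<Sum>a\<in>A. 2 powr (\<eta> * q * k a)) \<le> 2 powr (\<eta> * q * k b) * geom_const (\<bar>\<eta>\<bar> * q)"
    by blast
  have "(\<Sum>a\<in>A. (c * 2 powr (\<eta> * k a)) powr q) = c powr q * (\<Sum>a\<in>A. 2 powr (\<eta> * q * k a))"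
    by (simp add: pw sum_distrib_left)
  also have "\<dots> \<le> c powr q * (2 powr (\<eta> * q * k b) * geom_const (\<bar>\<eta>\<bar> * q))"
    by (intro mult_left_mono b) simp
  also have "\<dots> = (c * 2 powr (\<eta> * k b)) powr q * geom_const (\<bar>\<eta>\<bar> * q)"
    by (simp add: pw)
  also have "\<dots> \<le> X powr q * geom_const (\<bar>\<eta>\<bar> * q)"
    using assms geom_const_pos[of "\<bar>\<eta>\<bar> * q"] le[OF b(1)] by (intro mult_right_mono powr_mono2) auto
  finally show ?thesis by (simp add: mult.commute)
qed

definition ell :: "int \<times> (real ^ 'n) \<Rightarrow> real" where
  "ell q = 2 powr real_of_int (fst q)"

text \<open>
  A cube of a dyadic grid is replaced by its interior, coded by the exponent of its edge length and
  its corner. A grid may contain cubes that differ only on the boundary; the number of cubes with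
  a given code is bounded by the number of choices of end points.
\<close>

definition sc :: "int \<times> (real ^ 'n) \<Rightarrow> (real ^ 'n) set" where
  "sc q = cb (snd q) (ell q)"

lemma ell_pos [simp]: "0 < ell q" "0 \<le> ell q" "ell q \<noteq> 0"
  by (auto simp: ell_def)

lemma sc_measurable [measurable]: "sc q \<in> sets borel" "sc q \<in> sets lebesgue"
  by (auto simp: sc_def sets_completionI_sets)

lemma emeasure_sc: "emeasure lebesgue (sc (q :: int \<times> (real ^ 'n))) = ennreal (ell q ^ CARD('n))"
  by (simp add: sc_def emeasure_cb)

lemma cb_subset_imp:
  fixes a b :: "real ^ 'n"
  assumes "0 < l" "cb a l \<subseteq> cb b m"
  shows "b $ i \<le> a $ i" "a $ i + l \<le> b $ i + m"
proof -
  have "(\<forall>i. b $ i \<le> a $ i \<and> (a + vec l) $ i \<le> (b + vec m) $ i)"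
    using assms unfolding cb_def subset_interval_cart by auto
  then show "b $ i \<le> a $ i" "a $ i + l \<le> b $ i + m" by auto
qed

lemma sc_mono: "sc p \<subseteq> sc q \<Longrightarrow> fst p \<le> fst q"
proof -
  assume "sc p \<subseteq> sc q"
  from cb_subset_imp[OF ell_pos(1) this[unfolded sc_def], of undefined] have "ell p \<le> ell q"
    by linarith
  then show ?thesis by (simp add: ell_def)
qed

lemma sc_eq_of_subset: "sc p \<subseteq> sc q \<Longrightarrow> fst p = fst q \<Longrightarrow> p = q"
proof -
  assume "sc p \<subseteq> sc q" "fst p = fst q"
  then have e: "ell p = ell q" by (simp add: ell_def)
  have "snd p $ i = snd q $ i" for i
    using cb_subset_imp[OF _ \<open>sc p \<subseteq> sc q\<close>[unfolded sc_def], of i] e ell_pos(1)[of p] by auto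
  with \<open>fst p = fst q\<close> show "p = q" by (simp add: prod_eq_iff vec_eq_iff)
qed

definition laminar :: "(int \<times> (real ^ 'n)) set \<Rightarrow> bool" where
  "laminar F \<longleftrightarrow> (\<forall>p\<in>F. \<forall>q\<in>F. sc p \<inter> sc q = {} \<or> sc p \<subseteq> sc q \<or> sc q \<subseteq> sc p)"

lemma laminar_subset: "laminar F \<Longrightarrow> E \<subseteq> F \<Longrightarrow> laminar E"
  unfolding laminar_def by blast

lemma laminar_nested:
  assumes "laminar F" "p \<in> F" "q \<in> F" "x \<in> sc p" "x \<in> sc q" "fst p \<le> fst q"
  shows "sc p \<subseteq> sc q"
proof -
  have "sc p \<subseteq> sc q \<or> sc q \<subseteq> sc p" using assms unfolding laminar_def by blast
  then show ?thesis
  proof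
    assume s: "sc q \<subseteq> sc p"
    then have "fst q = fst p" using sc_mono[OF s] assms(6) by simp
    then show ?thesis using sc_eq_of_subset[OF s] by simp
  qed
qed

text \<open>Two cubes of one size with a common point coincide, so the cubes through a point form a
  tower with at most one cube per scale. This turns sums over cubes into geometric series.\<close>

lemma laminar_inj_on_fst: "laminar F \<Longrightarrow> inj_on fst {q\<in>F. x \<in> sc q}"
  by (rule inj_onI) (metis (mono_tags, lifting) laminar_nested mem_Collect_eq order_refl sc_eq_of_subset)

lemma laminar_inj_on_fst_super:
  assumes "laminar F"
  shows "inj_on fst {q\<in>F. sc p \<subseteq> sc q}"
proof -
  have "snd p + vec (ell p / 2) \<in> sc p"
    by (simp add: sc_def mem_cb)
  then obtain x where "x \<in> sc p" by blast
  then have "{q\<in>F. sc p \<subseteq> sc q} \<subseteq> {q\<in>F. x \<in> sc q}" by blast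
  then show ?thesis using laminar_inj_on_fst[OF assms] inj_on_subset by blast
qed

text \<open>Existential in Q, because one code may stand for several grid cubes and
  \<open>oscillation\<close> is a function of the set itself.\<close>

definition heavy :: "(real ^ 'n \<Rightarrow> real) \<Rightarrow> real \<Rightarrow> int \<times> (real ^ 'n) \<Rightarrow> bool" where
  "heavy f c q \<longleftrightarrow> (\<exists>Q. sc q \<subseteq> Q \<and> Q \<subseteq> cbox (snd q) (snd q + vec (ell q)) \<and> c < oscillation Q f)"

definition cube_mass :: "(real ^ 'n \<Rightarrow> ennreal) \<Rightarrow> int \<times> (real ^ 'n) \<Rightarrow> ennreal" where
  "cube_mass h q = (\<integral>\<^sup>+x. h x * indicator (sc q) x \<partial>lebesgue)"

text \<open>A sum of nonnegative extended reals is the supremum of its finite subsums. A finite set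
  of grid cubes is mapped to the codes of its members; inclusion passes to interiors, so the codes
  are laminar, and the factor counts the choices of end points in each coordinate.\<close>

lemma level_sup_le:
  fixes v :: "real ^ 'n \<Rightarrow> real" and B :: ennreal and p \<beta> :: real
  assumes D: "dyadic_grid D"
    and le: "\<And>lam F. 0 < lam \<Longrightarrow> finite F \<Longrightarrow> laminar F \<Longrightarrow>
        (\<And>q. q \<in> F \<Longrightarrow> heavy f (lam * ell q powr (CARD('n) * (\<beta> + 1 - 1 / p))) q) \<Longrightarrow>
        (\<Sum>q\<in>F. ennreal (lam powr p * ell q powr (CARD('n) * (\<beta> * p - 1))) * cube_mass (\<lambda>x. ennreal (v x)) q) \<le> B"
  shows "level_sup p \<beta> v D f \<le> of_nat (CARD('n \<Rightarrow> bool \<times> bool)) * B"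
  unfolding level_sup_def
proof (rule SUP_least)
  fix lam :: real assume "lam \<in> {0<..}"
  then have lam: "0 < lam" by simp
  let ?b = "\<beta> + 1 - 1 / p" and ?N = "CARD('n \<Rightarrow> bool \<times> bool)"
  let ?L = "level_cubes D lam ?b f"
  let ?w = "\<lambda>Q. ennreal (measure lebesgue Q powr (\<beta> * p - 1)) * weight_of v Q"
  let ?u = "\<lambda>q. ennreal (lam powr p * ell q powr (CARD('n) * (\<beta> * p - 1))) * cube_mass (\<lambda>x. ennreal (v x)) q"
  \<comment> \<open>\<open>w\<close> records for each coordinate whether the left and the right end
    point belong to the cube.\<close>
  define code :: "int \<times> (real ^ 'n) \<Rightarrow> ('n \<Rightarrow> bool \<times> bool) \<Rightarrow> (real ^ 'n) set" where
    "code = (\<lambda>q w. {x. \<forall>i. (snd q $ i < x $ i \<and> x $ i < snd q $ i + ell q) \<or> (x $ i = snd q $ i \<and> fst (w i)) \<or> (x $ i = snd q $ i + ell q \<and> snd (w i))})"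
  have ex: "\<exists>q. \<exists>w. Q = code q w" if Q: "Q \<in> D" for Q
  proof -
    obtain k :: int where "is_cube (2 powi k) Q" using D Q unfolding dyadic_grid_def by blast
    then obtain a J where J: "\<And>i. {a $ i <..< a $ i + 2 powi k} \<subseteq> J i" "\<And>i. J i \<subseteq> {a $ i .. a $ i + 2 powi k}"
      and QJ: "Q = {x. \<forall>i. x $ i \<in> J i}"
      unfolding is_cube_def by blast
    have l: "ell (k, a) = 2 powi k" by (simp add: ell_def powr_real_of_int')
    have Jeq: "t \<in> J i \<longleftrightarrow> (a $ i < t \<and> t < a $ i + 2 powi k) \<or> (t = a $ i \<and> a $ i \<in> J i) \<or> (t = a $ i + 2 powi k \<and> a $ i + 2 powi k \<in> J i)" for i t
    proof -
      have "t \<in> J i \<Longrightarrow> a $ i \<le> t \<and> t \<le> a $ i + 2 powi k" using J(2)[of i] by (meson atLeastAtMost_iff subsetD)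
      moreover have "a $ i < t \<and> t < a $ i + 2 powi k \<Longrightarrow> t \<in> J i" using J(1)[of i] by (meson greaterThanLessThan_iff subsetD)
      ultimately show ?thesis
        by (cases "t = a $ i"; cases "t = a $ i + 2 powi k") auto
    qed
    have "Q = code (k, a) (\<lambda>i. (a $ i \<in> J i, a $ i + 2 powi k \<in> J i))"
      unfolding QJ code_def l fst_conv snd_conv by (intro Collect_cong all_cong1 Jeq)
    then show ?thesis by blast
  qed
  define \<kappa> where "\<kappa> = (\<lambda>Q. SOME q. \<exists>w. Q = code q w)"
  have \<kappa>: "\<exists>w. Q = code (\<kappa> Q) w" if "Q \<in> D" for Q
    unfolding \<kappa>_def using ex[OF that] by (rule someI_ex)
  have box: "sc q \<subseteq> code q w" "code q w \<subseteq> cbox (snd q) (snd q + vec (ell q))" for q w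
  proof -
    show "sc q \<subseteq> code q w" by (auto simp: code_def sc_def mem_cb)
    show "code q w \<subseteq> cbox (snd q) (snd q + vec (ell q))"
    proof
      fix x assume x: "x \<in> code q w"
      have "snd q $ i \<le> x $ i \<and> x $ i \<le> snd q $ i + ell q" for i
        using x[unfolded code_def, simplified, rule_format, of i] ell_pos(1)[of q] by auto
      then show "x \<in> cbox (snd q) (snd q + vec (ell q))" by (simp add: mem_box_cart)
    qed
  qed
  have \<kappa>box: "sc (\<kappa> Q) \<subseteq> Q" "Q \<subseteq> cbox (snd (\<kappa> Q)) (snd (\<kappa> Q) + vec (ell (\<kappa> Q)))" if QD: "Q \<in> D" for Q
  proof -
    obtain w where w: "Q = code (\<kappa> Q) w" using \<kappa>[OF QD] ..
    show "sc (\<kappa> Q) \<subseteq> Q" by (subst (2) w) (rule box)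
    show "Q \<subseteq> cbox (snd (\<kappa> Q)) (snd (\<kappa> Q) + vec (ell (\<kappa> Q)))" by (subst (1) w) (rule box)
  qed
  have w_eq: "ennreal (lam powr p) * ?w Q = ?u (\<kappa> Q)" if "Q \<in> D" for Q
  proof -
    note c = cube_AE[OF ell_pos(1) \<kappa>box(1)[OF that, unfolded sc_def] \<kappa>box(2)[OF that]]
    have "weight_of v Q = cube_mass (\<lambda>x. ennreal (v x)) (\<kappa> Q)"
      unfolding weight_of_def cube_mass_def sc_def
      using c(1) by (intro nn_integral_cong_AE, eventually_elim) (auto simp: indicator_def)
    moreover have "measure lebesgue Q powr (\<beta> * p - 1) = ell (\<kappa> Q) powr (CARD('n) * (\<beta> * p - 1))"
      using ell_pos(1)[of "\<kappa> Q"] by (simp add: c powr_realpow[symmetric] powr_powr)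
    ultimately show ?thesis
      by (simp add: ennreal_mult' mult.assoc)
  qed
  have fin_le: "ennreal (lam powr p) * sum ?w F0 \<le> of_nat ?N * B" if F0: "finite F0" "F0 \<subseteq> ?L" for F0
  proof -
    have FD: "F0 \<subseteq> D" using F0 by (auto simp: level_cubes_def)
    let ?F = "\<kappa> ` F0"
    have lam_F: "laminar ?F"
      unfolding laminar_def
    proof (intro ballI)
      fix p q assume "p \<in> ?F" "q \<in> ?F"
      then obtain P Q where PQ: "P \<in> D" "Q \<in> D" "p = \<kappa> P" "q = \<kappa> Q" using FD by auto
      \<comment> \<open>\<open>sc\<close> is the interior of the closed cube, so it contains every
        open subset of the closed cube.\<close>
      have sub: "sc (\<kappa> P) \<subseteq> sc (\<kappa> Q)" if "P \<subseteq> Q" "P \<in> D" "Q \<in> D" for P Q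
      proof -
        have "sc (\<kappa> P) \<subseteq> cbox (snd (\<kappa> Q)) (snd (\<kappa> Q) + vec (ell (\<kappa> Q)))"
          using \<kappa>box that by blast
        then have "sc (\<kappa> P) \<subseteq> interior (cbox (snd (\<kappa> Q)) (snd (\<kappa> Q) + vec (ell (\<kappa> Q))))"
          by (rule interior_maximal) (simp add: sc_def cb_def open_box)
        then show ?thesis by (simp add: sc_def cb_def interior_cbox)
      qed
      have "P \<inter> Q = {} \<or> P \<inter> Q = P \<or> P \<inter> Q = Q"
        using D PQ unfolding dyadic_grid_def by blast
      then show "sc p \<inter> sc q = {} \<or> sc p \<subseteq> sc q \<or> sc q \<subseteq> sc p"
        using sub[of P Q] sub[of Q P] PQ \<kappa>box(1)[of P] \<kappa>box(1)[of Q] by blast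
    qed
    have hv: "heavy f (lam * ell q powr (CARD('n) * ?b)) q" if qF: "q \<in> ?F" for q
    proof -
      obtain Q where Q: "Q \<in> F0" "q = \<kappa> Q" using qF by auto
      then have QD: "Q \<in> D" and osc: "lam * measure lebesgue Q powr ?b < oscillation Q f"
        using F0 by (auto simp: level_cubes_def)
      note c = cube_AE[OF ell_pos(1) \<kappa>box(1)[OF QD, unfolded sc_def] \<kappa>box(2)[OF QD]]
      have "measure lebesgue Q powr ?b = ell (\<kappa> Q) powr (CARD('n) * ?b)"
        using ell_pos(1)[of "\<kappa> Q"] by (simp add: c powr_realpow[symmetric] powr_powr)
      then show ?thesis
        unfolding heavy_def using Q osc \<kappa>box[OF QD] by auto
    qed
    have "ennreal (lam powr p) * sum ?w F0 = (\<Sum>Q\<in>F0. ?u (\<kappa> Q))"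
      unfolding sum_distrib_left using FD by (intro sum.cong refl w_eq) auto
    also have "\<dots> = (\<Sum>q\<in>?F. \<Sum>Q\<in>{Q\<in>F0. \<kappa> Q = q}. ?u (\<kappa> Q))"
      by (rule sum.image_gen[OF F0(1)])
    also have "\<dots> \<le> (\<Sum>q\<in>?F. of_nat ?N * ?u q)"
    proof (rule sum_mono)
      fix q
      have "{Q\<in>F0. \<kappa> Q = q} \<subseteq> range (code q)" using \<kappa> FD by blast
      then have "card {Q\<in>F0. \<kappa> Q = q} \<le> card (range (code q))" by (intro card_mono) auto
      also have "\<dots> \<le> ?N" by (intro card_image_le) auto
      finally have c: "card {Q\<in>F0. \<kappa> Q = q} \<le> ?N" .
      have "(\<Sum>Q\<in>{Q\<in>F0. \<kappa> Q = q}. ?u (\<kappa> Q)) = of_nat (card {Q\<in>F0. \<kappa> Q = q}) * ?u q"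
        by simp
      also have "\<dots> \<le> of_nat ?N * ?u q"
        using c by (intro mult_right_mono) (simp_all del: card_fun)
      finally show "(\<Sum>Q\<in>{Q\<in>F0. \<kappa> Q = q}. ?u (\<kappa> Q)) \<le> of_nat ?N * ?u q" .
    qed
    also have "\<dots> = of_nat ?N * (\<Sum>q\<in>?F. ?u q)" by (simp add: sum_distrib_left)
    also have "\<dots> \<le> of_nat ?N * B"
      using F0(1) by (intro mult_left_mono le lam lam_F hv) auto
    finally show ?thesis .
  qed
  have "ennreal (lam powr p) * infsum ?w ?L = (SUP F\<in>{F. finite F \<and> F \<subseteq> ?L}. ennreal (lam powr p) * sum ?w F)"
    by (subst nonneg_infsum_complete) (auto simp: SUP_mult_left_ennreal)
  also have "\<dots> \<le> of_nat ?N * B"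
    using fin_le by (intro SUP_least) auto
  finally show "ennreal (lam powr p) * infsum ?w ?L \<le> of_nat ?N * B" .
qed

section \<open>Consequences of the Muckenhoupt condition\<close>

lemma sc_in_cubes: "sc q \<in> cubes"
  unfolding cubes_def is_cube_def mem_Collect_eq
  by (intro exI[of _ "ell q"] conjI exI[of _ "snd q"] exI[of _ "\<lambda>i. {snd q $ i <..< snd q $ i + ell q}"])
     (auto simp: sc_def mem_cb)

lemma cube_mass_finite:
  fixes h :: "real ^ 'n \<Rightarrow> real"
  assumes "locally_integrable h" "\<And>x. 0 \<le> h x"
  shows "cube_mass (\<lambda>x. ennreal (h x)) q < top"
proof -
  let ?K = "cbox (snd q) (snd q + vec (ell q))"
  have "cube_mass (\<lambda>x. ennreal (h x)) q \<le> (\<integral>\<^sup>+x. ennreal (norm (indicator ?K x *\<^sub>R h x)) \<partial>lebesgue)"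
    unfolding cube_mass_def sc_def cb_def
    using assms(2) box_subset_cbox[of "snd q" "snd q + vec (ell q)"] by (intro nn_integral_mono) (auto simp: indicator_def)
  also have "\<dots> < top"
    using assms(1) unfolding locally_integrable_def set_integrable_def
    by (auto simp: integrable_iff_bounded simp del: norm_scaleR)
  finally show ?thesis .
qed

lemma average_sc: "average (sc (q :: int \<times> (real ^ 'n))) g = cube_mass g q / ennreal (ell q ^ CARD('n))"
  by (simp add: average_def cube_mass_def emeasure_sc)

lemma A_const_ge_1:
  "average (sc q) (\<lambda>x. ennreal (v x)) * esssup (restrict_space lebesgue (sc q)) (\<lambda>x. inverse (ennreal (v x))) \<le> A_const 1 v"
  by (auto simp: A_const_def intro!: SUP_upper2[OF sc_in_cubes])

lemma A_const_ge:
  "p \<noteq> 1 \<Longrightarrow> average (sc q) (\<lambda>x. ennreal (v x)) *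
    ennpow (average (sc q) (\<lambda>x. ennpow (ennreal (v x)) (- 1 / (p - 1)))) (p - 1) \<le> A_const p v"
  by (auto simp: A_const_def intro!: SUP_upper2[OF sc_in_cubes])

text \<open>The essential infimum of \<open>v\<close> on the cube.\<close>

definition low :: "(real ^ 'n \<Rightarrow> real) \<Rightarrow> int \<times> (real ^ 'n) \<Rightarrow> ennreal" where
  "low v q = inverse (esssup (restrict_space lebesgue (sc q)) (\<lambda>x. inverse (ennreal (v x))))"

lemma inverse_le_imp_le_ennreal: "inverse a \<le> b \<Longrightarrow> inverse b \<le> (a :: ennreal)"
proof (cases a; cases b)
  fix r s assume "inverse a \<le> b" "0 \<le> r" "a = ennreal r" "0 \<le> s" "b = ennreal s"
  then show ?thesis
    by (cases "r = 0"; cases "s = 0") (auto simp: inverse_ennreal top_unique field_simps)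
qed auto

lemma inverse_antimono_ennreal: "a \<le> b \<Longrightarrow> inverse b \<le> inverse (a :: ennreal)"
proof (cases a; cases b)
  fix r s assume "a \<le> b" "0 \<le> r" "a = ennreal r" "0 \<le> s" "b = ennreal s"
  then show ?thesis
    by (cases "r = 0"; cases "s = 0") (auto simp: inverse_ennreal top_unique field_simps)
qed (auto simp: top_unique)

lemma A_class_measurable: "v \<in> A_class p \<Longrightarrow> v \<in> borel_measurable lebesgue"
  by (auto simp: A_class_def weight_def intro: locally_integrable_measurable)

lemma AE_low_le: "AE x in lebesgue. x \<in> sc q \<longrightarrow> low v q \<le> ennreal (v x)"
proof -
  have "AE x in restrict_space lebesgue (sc q). inverse (ennreal (v x)) \<le> esssup (restrict_space lebesgue (sc q)) (\<lambda>x. inverse (ennreal (v x)))"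
    by (rule esssup_AE)
  then have "AE x in lebesgue. x \<in> sc q \<longrightarrow> inverse (ennreal (v x)) \<le> esssup (restrict_space lebesgue (sc q)) (\<lambda>x. inverse (ennreal (v x)))"
    by (subst (asm) AE_restrict_space_iff) auto
  then show ?thesis
    by eventually_elim (auto simp: low_def intro: inverse_le_imp_le_ennreal)
qed

lemma low_antimono:
  assumes [measurable]: "v \<in> borel_measurable lebesgue" and s: "sc p \<subseteq> sc q"
  shows "low v q \<le> low v p"
proof -
  have "esssup (restrict_space lebesgue (sc p)) (\<lambda>x. inverse (ennreal (v x))) \<le> esssup (restrict_space lebesgue (sc q)) (\<lambda>x. inverse (ennreal (v x)))"
  proof (rule esssup_I)
    show "(\<lambda>x. inverse (ennreal (v x))) \<in> borel_measurable (restrict_space lebesgue (sc p))"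
      by (intro measurable_restrict_space1) measurable
    have "AE x in restrict_space lebesgue (sc q). inverse (ennreal (v x)) \<le> esssup (restrict_space lebesgue (sc q)) (\<lambda>x. inverse (ennreal (v x)))"
      by (rule esssup_AE)
    then have "AE x in lebesgue. x \<in> sc q \<longrightarrow> inverse (ennreal (v x)) \<le> esssup (restrict_space lebesgue (sc q)) (\<lambda>x. inverse (ennreal (v x)))"
      by (subst (asm) AE_restrict_space_iff) auto
    then have "AE x in lebesgue. x \<in> sc p \<longrightarrow> inverse (ennreal (v x)) \<le> esssup (restrict_space lebesgue (sc q)) (\<lambda>x. inverse (ennreal (v x)))"
      by eventually_elim (use s in auto)
    then show "AE x in restrict_space lebesgue (sc p). inverse (ennreal (v x)) \<le> esssup (restrict_space lebesgue (sc q)) (\<lambda>x. inverse (ennreal (v x)))"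
      by (subst AE_restrict_space_iff) auto
  qed
  then show ?thesis
    unfolding low_def by (rule inverse_antimono_ennreal)
qed

text \<open>The A_1 condition solved for v(Q). In extended reals this division degenerates when the
  essential supremum of 1/v is 0 or top, and both cases need their own argument.\<close>

lemma A1_cube_mass_le:
  fixes v :: "real ^ 'n \<Rightarrow> real"
  assumes v: "v \<in> A_class 1"
  shows "cube_mass (\<lambda>x. ennreal (v x)) q \<le> A_const 1 v * ennreal (ell q ^ CARD('n)) * low v q"
proof -
  let ?S = "esssup (restrict_space lebesgue (sc q)) (\<lambda>x. inverse (ennreal (v x)))"
  let ?V = "cube_mass (\<lambda>x. ennreal (v x)) q" and ?l = "ell q ^ CARD('n)"
  have A: "A_const 1 v < top" using v by (simp add: A_class_def)
  have l: "0 < ?l" by simp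
  have le: "?V / ennreal ?l * ?S \<le> A_const 1 v"
    using A_const_ge_1[of q v] by (simp add: average_sc)
  have Vfin: "?V < top" using v by (intro cube_mass_finite) (auto simp: A_class_def weight_def)
  \<comment> \<open>At 0 the weight would be infinite a.e. on a cube of positive measure, but it is
    real-valued.\<close>
  have "?S \<noteq> 0"
  proof
    assume S0: "?S = 0"
    then have "low v q = top" by (simp add: low_def)
    with AE_low_le[of q v] have "AE x in lebesgue. x \<notin> sc q"
      by (auto simp: top_unique)
    then have "emeasure lebesgue (sc q) = 0"
      by (subst (asm) AE_iff_measurable[where N="sc q"]) auto
    then show False using l by (simp add: emeasure_sc)
  qed
  show ?thesis
  proof (cases ?S)
    case top
    \<comment> \<open>Here the essential infimum is 0; as the product is finite, the average of v
      must vanish.\<close>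
    then have "?V / ennreal ?l = 0"
      using le A by (auto simp: ennreal_mult_top top_unique split: if_splits)
    then have "?V = 0" using l by (auto simp: divide_ennreal_def)
    then show ?thesis by simp
  next
    case (real s)
    then have s: "0 < s" using \<open>?S \<noteq> 0\<close> by (cases "s = 0") auto
    obtain w where w: "?V = ennreal w" "0 \<le> w" using Vfin by (cases ?V) auto
    obtain a where a: "A_const 1 v = ennreal a" "0 \<le> a" using A by (cases "A_const 1 v") auto
    have "w / ?l * s \<le> a"
      using le w a s l unfolding real by (simp add: divide_ennreal ennreal_mult'[symmetric])
    then have "w \<le> a * ?l * inverse s"
      using s l by (simp add: field_simps)
    then show ?thesis
      using w a s l unfolding low_def real by (simp add: inverse_ennreal ennreal_mult'[symmetric])
  qed
qed

lemma A1_cube_mass_mult_le: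
  fixes v :: "real ^ 'n \<Rightarrow> real"
  assumes v: "v \<in> A_class 1" and [measurable]: "h \<in> borel_measurable lebesgue"
  shows "cube_mass (\<lambda>x. ennreal (v x)) q * cube_mass h q \<le> A_const 1 v * ennreal (ell q ^ CARD('n)) * cube_mass (\<lambda>x. h x * ennreal (v x)) q"
proof -
  have "low v q * cube_mass h q = (\<integral>\<^sup>+x. low v q * (h x * indicator (sc q) x) \<partial>lebesgue)"
    unfolding cube_mass_def by (rule nn_integral_cmult[symmetric]) measurable
  also have "\<dots> \<le> cube_mass (\<lambda>x. h x * ennreal (v x)) q"
    unfolding cube_mass_def using AE_low_le[of q v]
    by (intro nn_integral_mono_AE, eventually_elim) (auto simp: indicator_def mult.commute intro: mult_left_mono)
  finally have 1: "low v q * cube_mass h q \<le> cube_mass (\<lambda>x. h x * ennreal (v x)) q" .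
  have "cube_mass (\<lambda>x. ennreal (v x)) q * cube_mass h q \<le> A_const 1 v * ennreal (ell q ^ CARD('n)) * low v q * cube_mass h q"
    by (intro mult_right_mono A1_cube_mass_le v) simp
  also have "\<dots> \<le> A_const 1 v * ennreal (ell q ^ CARD('n)) * cube_mass (\<lambda>x. h x * ennreal (v x)) q"
    unfolding mult.assoc[of _ "low v q"] by (intro mult_left_mono 1) simp
  finally show ?thesis .
qed

section \<open>The A_p condition through the dual weight\<close>

lemma young_pointwise:
  fixes p h y :: real
  assumes "1 < p" "0 \<le> h" "0 < y"
  shows "h \<le> h powr p * y / p + y powr (- 1 / (p - 1)) * ((p - 1) / p)"
proof -
  define p' where "p' = p / (p - 1)"
  have p': "1 < p'" "1 / p + 1 / p' = 1" using assms by (auto simp: p'_def field_simps)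
  have y1: "(h * y powr (1 / p)) * (y powr (- 1 / p)) \<le> (h * y powr (1 / p)) powr p / p + (y powr (- 1 / p)) powr p' / p'"
    by (rule Youngs_inequality) (use assms p' in auto)
  have y2: "(h * y powr (1 / p)) * (y powr (- 1 / p)) = h"
    using assms by (simp add: mult.assoc powr_add[symmetric])
  have y3: "(h * y powr (1 / p)) powr p = h powr p * y"
    using assms by (simp add: powr_mult powr_powr)
  have y4: "(y powr (- 1 / p)) powr p' / p' = y powr (- 1 / (p - 1)) * ((p - 1) / p)"
    using assms by (simp add: powr_powr p'_def field_simps)
  show ?thesis using y1 unfolding y2 y3 y4 .
qed

text \<open>Hoelder's inequality, obtained from Young's inequality with the weight u v by optimising
  over the number u. Only a lower bound t for the integral of h is used, so that integral may be
  infinite.\<close>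

lemma weighted_holder:
  fixes h v :: "'a \<Rightarrow> real" and p t S :: real
  assumes p: "1 < p" and [measurable]: "h \<in> borel_measurable M" "v \<in> borel_measurable M" "E \<in> sets M"
    and h: "\<And>x. 0 \<le> h x" and v: "AE x in M. x \<in> E \<longrightarrow> 0 < v x"
    and S: "0 < S" "(\<integral>\<^sup>+x. ennreal (v x powr (- 1 / (p - 1))) * indicator E x \<partial>M) = ennreal S"
    and t: "0 \<le> t" "ennreal t \<le> (\<integral>\<^sup>+x. ennreal (h x) * indicator E x \<partial>M)"
  shows "ennreal (t powr p) \<le> (\<integral>\<^sup>+x. ennreal (h x powr p * v x) * indicator E x \<partial>M) * ennreal (S powr (p - 1))"
proof (cases "\<integral>\<^sup>+x. ennreal (h x powr p * v x) * indicator E x \<partial>M")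
  case top
  then show ?thesis using S by (simp add: ennreal_top_mult)
next
  case (real X)
  have bound: "t \<le> u * X / p + u powr (- 1 / (p - 1)) * S * ((p - 1) / p)" if u: "0 < u" for u
  proof -
    have "ennreal t \<le> (\<integral>\<^sup>+x. ennreal (h x) * indicator E x \<partial>M)" by (rule t)
    also have "\<dots> \<le> (\<integral>\<^sup>+x. ennreal (u / p) * (ennreal (h x powr p * v x) * indicator E x)
        + ennreal (u powr (- 1 / (p - 1)) * ((p - 1) / p)) * (ennreal (v x powr (- 1 / (p - 1))) * indicator E x) \<partial>M)"
      using v
    proof (intro nn_integral_mono_AE, eventually_elim)
      case (elim x)
      show ?case
      proof (cases "x \<in> E")
        case True
        with elim have vx: "0 < v x" by simp
        have "h x \<le> h x powr p * (u * v x) / p + (u * v x) powr (- 1 / (p - 1)) * ((p - 1) / p)"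
          by (rule young_pointwise) (use p h u vx in auto)
        also have "\<dots> = u / p * (h x powr p * v x) + u powr (- 1 / (p - 1)) * ((p - 1) / p) * v x powr (- 1 / (p - 1))"
          using u vx by (simp add: powr_mult mult_ac)
        finally show ?thesis
          using True p u vx by (simp add: ennreal_mult'[symmetric] ennreal_plus[symmetric] ennreal_leI del: ennreal_plus)
      qed simp
    qed
    also have "\<dots> = ennreal (u / p) * ennreal X + ennreal (u powr (- 1 / (p - 1)) * ((p - 1) / p)) * ennreal S"
      by (subst nn_integral_add, measurable, subst nn_integral_cmult, measurable, subst nn_integral_cmult, measurable)
         (simp only: real S)
    also have "\<dots> = ennreal (u * X / p + u powr (- 1 / (p - 1)) * S * ((p - 1) / p))"
      using real S p u by (simp add: ennreal_mult'[symmetric] ennreal_plus[symmetric] mult_ac del: ennreal_plus)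
    finally show ?thesis
      using real S p u by (subst (asm) ennreal_le_iff) auto
  qed
  have "t powr p \<le> X * S powr (p - 1)"
  proof (cases "X = 0")
    case True
    have "t = 0"
    proof (rule ccontr)
      assume "t \<noteq> 0"
      then have t0: "0 < t" using t by simp
      \<comment> \<open>With X = 0 only the second term survives; this u makes it t/2 times (p -
        1)/p, which is less than t.\<close>
      define u where "u = (t / (2 * S)) powr (- (p - 1))"
      have "(- (p - 1)) * (- 1 / (p - 1)) = 1" using p by (simp add: field_simps)
      then have "u powr (- 1 / (p - 1)) = t / (2 * S)"
        using t0 S unfolding u_def powr_powr by simp
      with bound[of u] have "t \<le> t / (2 * S) * S * ((p - 1) / p)"
        using True t0 S by (simp add: u_def)
      also have "\<dots> = t / 2 * ((p - 1) / p)" using S by simp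
      also have "\<dots> \<le> t / 2 * 1"
        using p t0 by (intro mult_left_mono) auto
      finally show False using t0 by simp
    qed
    then show ?thesis using True p by simp
  next
    case False
    then have X: "0 < X" using real by simp
    \<comment> \<open>The optimal u: both terms become the same z, with the factors 1/p and (p -
      1)/p that add up to 1.\<close>
    define u where "u = (S / X) powr ((p - 1) / p)"
    define z where "z = X powr (1 / p) * S powr ((p - 1) / p)"
    have e: "(p - 1) / p = 1 - 1 / p" using p by (simp add: diff_divide_distrib)
    have "u * X = z"
      unfolding u_def z_def e using X S by (simp add: powr_divide powr_diff)
    moreover have "u powr (- 1 / (p - 1)) * S = z"
    proof -
      have "(p - 1) / p * (- 1 / (p - 1)) = - (1 / p)" using p by simp
      then have "u powr (- 1 / (p - 1)) = X powr (1 / p) / S powr (1 / p)"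
        using X S unfolding u_def powr_powr by (simp add: powr_minus powr_divide)
      then show ?thesis
        unfolding z_def e using S by (simp add: powr_diff)
    qed
    ultimately have "t \<le> z / p + z * ((p - 1) / p)"
      using bound[of u] X S by (simp add: u_def)
    also have "\<dots> = z" using p by (simp add: field_simps)
    finally have "t powr p \<le> z powr p" using t p by (intro powr_mono2) auto
    also have "\<dots> = X * S powr (p - 1)"
      using X S p by (simp add: z_def powr_mult powr_powr)
    finally show ?thesis .
  qed
  then show ?thesis
    using S real by (simp add: ennreal_mult'[symmetric] ennreal_leI)
qed


text \<open>The real power is 0 where v vanishes, whereas \<open>ennpow\<close> in
  \<open>A_const\<close> is top there. For v in A_p the two agree a.e. on every cube of positive
  v-mass.\<close>

definition dual_weight :: "real \<Rightarrow> (real ^ 'n \<Rightarrow> real) \<Rightarrow> real ^ 'n \<Rightarrow> real" where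
  "dual_weight p v x = v x powr (- 1 / (p - 1))"

lemma dual_weight_measurable [measurable]:
  assumes [measurable]: "v \<in> borel_measurable M"
  shows "dual_weight p v \<in> borel_measurable M"
  unfolding dual_weight_def by measurable

text \<open>On a cube with v(Q) > 0 a finite A_p constant forces v^(-1/(p - 1)) to be integrable,
  hence v > 0 a.e. there. The last conclusion is the A_p condition cleared of denominators.\<close>

lemma Ap_dual_weight:
  fixes v :: "real ^ 'n \<Rightarrow> real" and p :: real
  assumes p: "1 < p" and v: "v \<in> A_class p" and V: "cube_mass (\<lambda>x. ennreal (v x)) q \<noteq> 0"
  obtains S where "0 < S" "cube_mass (\<lambda>x. ennreal (dual_weight p v x)) q = ennreal S"
    "AE x in lebesgue. x \<in> sc q \<longrightarrow> 0 < v x"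
    "cube_mass (\<lambda>x. ennreal (v x)) q * ennreal (S powr (p - 1)) \<le> A_const p v * ennreal (ell q powr (CARD('n) * p))"
proof -
  let ?V = "cube_mass (\<lambda>x. ennreal (v x)) q" and ?l = "ell q ^ CARD('n)"
  let ?s = "\<lambda>x. ennpow (ennreal (v x)) (- 1 / (p - 1))"
  have [measurable]: "v \<in> borel_measurable lebesgue" using v by (rule A_class_measurable)
  have v0: "0 \<le> v x" for x using v by (auto simp: A_class_def weight_def)
  have A: "A_const p v < top" using v by (simp add: A_class_def)
  have l: "0 < ?l" by simp
  have neg: "- 1 / (p - 1) < 0" using p by simp
  have s_eq: "?s x = (if v x = 0 then top else ennreal (dual_weight p v x))" for x
    using v0[of x] neg p by (auto simp: ennpow_def dual_weight_def ennreal_eq_0_iff)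
  have [measurable]: "?s \<in> borel_measurable lebesgue"
    unfolding s_eq by measurable
  obtain w where w: "?V = ennreal w" "0 < w"
    using cube_mass_finite[of v q] v V v0 by (cases ?V) (auto simp: A_class_def weight_def less_le)
  obtain a where a: "A_const p v = ennreal a" "0 \<le> a" using A by (cases "A_const p v") auto
  have le: "ennreal (w / ?l) * ennpow (cube_mass ?s q / ennreal ?l) (p - 1) \<le> ennreal a"
    using A_const_ge[of p q v] p w l a by (simp add: average_sc divide_ennreal)
  have "cube_mass ?s q \<noteq> top"
  proof
    assume "cube_mass ?s q = top"
    then have "ennpow (cube_mass ?s q / ennreal ?l) (p - 1) = top"
      using p l by (simp add: ennpow_def ennreal_top_divide)
    with le w l show False by (simp add: ennreal_mult_top top_unique)
  qed
  then have "(\<integral>\<^sup>+x. ?s x * indicator (sc q) x \<partial>lebesgue) \<noteq> \<infinity>"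
    by (simp add: cube_mass_def)
  then have "AE x in lebesgue. ?s x * indicator (sc q) x \<noteq> \<infinity>"
    by (intro nn_integral_PInf_AE) measurable
  then have pos: "AE x in lebesgue. x \<in> sc q \<longrightarrow> 0 < v x"
  proof eventually_elim
    case (elim x)
    then show ?case using v0[of x] unfolding s_eq by (auto simp: less_le)
  qed
  have mass_eq: "cube_mass ?s q = cube_mass (\<lambda>x. ennreal (dual_weight p v x)) q"
    unfolding cube_mass_def s_eq using pos by (intro nn_integral_cong_AE, eventually_elim) (auto simp: indicator_def)
  have "cube_mass (\<lambda>x. ennreal (dual_weight p v x)) q \<noteq> 0"
  proof
    assume "cube_mass (\<lambda>x. ennreal (dual_weight p v x)) q = 0"
    then have "AE x in lebesgue. ennreal (dual_weight p v x) * indicator (sc q) x = 0"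
      unfolding cube_mass_def by (subst (asm) nn_integral_0_iff_AE) measurable
    with pos have "AE x in lebesgue. x \<notin> sc q"
      by eventually_elim (auto simp: dual_weight_def indicator_def ennreal_eq_0_iff)
    then have "emeasure lebesgue (sc q) = 0"
      by (subst (asm) AE_iff_measurable[where N="sc q"]) auto
    then show False using l by (simp add: emeasure_sc)
  qed
  then obtain S where S: "0 < S" "cube_mass (\<lambda>x. ennreal (dual_weight p v x)) q = ennreal S"
    using \<open>cube_mass ?s q \<noteq> top\<close> unfolding mass_eq
    by (cases "cube_mass (\<lambda>x. ennreal (dual_weight p v x)) q") (auto simp: less_le)
  have "ennpow (cube_mass ?s q / ennreal ?l) (p - 1) = ennreal ((S / ?l) powr (p - 1))"
    using S l p unfolding mass_eq by (simp add: ennpow_def divide_ennreal ennreal_eq_0_iff not_le)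
  then have "w / ?l * (S / ?l) powr (p - 1) \<le> a"
    using le w a S l by (simp add: ennreal_mult'[symmetric])
  moreover have "w / ?l * (S / ?l) powr (p - 1) * ?l powr p = w * S powr (p - 1)"
    using S l by (simp add: powr_divide powr_diff)
  ultimately have "w * S powr (p - 1) \<le> a * ?l powr p"
    by (metis mult_right_mono powr_ge_zero)
  also have "?l powr p = ell q powr (CARD('n) * p)"
    by (simp add: powr_realpow[symmetric] powr_powr)
  finally have "?V * ennreal (S powr (p - 1)) \<le> A_const p v * ennreal (ell q powr (CARD('n) * p))"
    using w a by (simp add: ennreal_mult'[symmetric] ennreal_leI)
  then show thesis using that[of S] S pos by blast
qed

text \<open>Hoelder's inequality with the dual weight, combined with the A_p condition; for p = 1
  the essential infimum replaces the dual weight. Applied to a function that vanishes outside a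
  subcube, it compares v on a cube with the energy on a cube inside.\<close>

lemma Ap_cube_mass_le:
  fixes v h :: "real ^ 'n \<Rightarrow> real" and p t :: real
  assumes p: "1 \<le> p" and v: "v \<in> A_class p" and [measurable]: "h \<in> borel_measurable lebesgue" and h: "\<And>x. 0 \<le> h x"
    and t: "0 \<le> t" "ennreal t \<le> cube_mass (\<lambda>x. ennreal (h x)) q"
  shows "cube_mass (\<lambda>x. ennreal (v x)) q * ennreal (t powr p)
    \<le> A_const p v * ennreal (ell q powr (CARD('n) * p)) * cube_mass (\<lambda>x. ennreal (h x powr p * v x)) q"
proof (cases "p = 1")
  case True
  have v0: "0 \<le> v x" for x using v by (auto simp: A_class_def weight_def)
  have "cube_mass (\<lambda>x. ennreal (v x)) q * ennreal (t powr p) \<le> cube_mass (\<lambda>x. ennreal (v x)) q * cube_mass (\<lambda>x. ennreal (h x)) q"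
    using True t by (intro mult_left_mono) auto
  also have "\<dots> \<le> A_const 1 v * ennreal (ell q ^ CARD('n)) * cube_mass (\<lambda>x. ennreal (h x) * ennreal (v x)) q"
    using v True by (intro A1_cube_mass_mult_le) auto
  also have "\<dots> = A_const p v * ennreal (ell q powr (CARD('n) * p)) * cube_mass (\<lambda>x. ennreal (h x powr p * v x)) q"
    using True h v0 by (simp add: powr_realpow ennreal_mult'[symmetric])
  finally show ?thesis .
next
  case False
  then have p1: "1 < p" using p by simp
  show ?thesis
  proof (cases "cube_mass (\<lambda>x. ennreal (v x)) q = 0")
    case True
    then show ?thesis by simp
  next
    case False
    then obtain S where S: "0 < S" "cube_mass (\<lambda>x. ennreal (dual_weight p v x)) q = ennreal S"
      "AE x in lebesgue. x \<in> sc q \<longrightarrow> 0 < v x"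
      "cube_mass (\<lambda>x. ennreal (v x)) q * ennreal (S powr (p - 1)) \<le> A_const p v * ennreal (ell q powr (CARD('n) * p))"
      by (rule Ap_dual_weight[OF p1 v])
    have "ennreal (t powr p) \<le> cube_mass (\<lambda>x. ennreal (h x powr p * v x)) q * ennreal (S powr (p - 1))"
      unfolding cube_mass_def
      by (rule weighted_holder[OF p1 _ A_class_measurable[OF v] _ h S(3,1)])
         (use S(2) t in \<open>auto simp: cube_mass_def dual_weight_def\<close>)
    then have "cube_mass (\<lambda>x. ennreal (v x)) q * ennreal (t powr p) \<le>
        cube_mass (\<lambda>x. ennreal (v x)) q * (cube_mass (\<lambda>x. ennreal (h x powr p * v x)) q * ennreal (S powr (p - 1)))"
      by (rule mult_left_mono) simp
    also have "\<dots> = cube_mass (\<lambda>x. ennreal (v x)) q * ennreal (S powr (p - 1)) * cube_mass (\<lambda>x. ennreal (h x powr p * v x)) q"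
      by (simp only: mult_ac)
    also have "\<dots> \<le> A_const p v * ennreal (ell q powr (CARD('n) * p)) * cube_mass (\<lambda>x. ennreal (h x powr p * v x)) q"
      by (intro mult_right_mono S) simp
    finally show ?thesis .
  qed
qed

section \<open>Maximal and minimal cubes\<close>

text \<open>Exchanging sum and integral reduces an estimate over a family of cubes to one for the
  tower of cubes through a single point.\<close>

lemma sum_cube_mass_le:
  assumes fin: "finite F" and [measurable]: "\<And>q. q \<in> F \<Longrightarrow> h q \<in> borel_measurable lebesgue"
    and le: "AE x in lebesgue. (\<Sum>q\<in>{q\<in>F. x \<in> sc q}. h q x) \<le> K x"
  shows "(\<Sum>q\<in>F. cube_mass (h q) q) \<le> (\<integral>\<^sup>+x. K x \<partial>lebesgue)"
proof -
  have "(\<Sum>q\<in>F. cube_mass (h q) q) = (\<integral>\<^sup>+x. (\<Sum>q\<in>F. h q x * indicator (sc q) x) \<partial>lebesgue)"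
    unfolding cube_mass_def by (rule nn_integral_sum[symmetric]) measurable
  also have "\<dots> \<le> (\<integral>\<^sup>+x. K x \<partial>lebesgue)"
    using le
  proof (intro nn_integral_mono_AE, eventually_elim)
    case (elim x)
    have "(\<Sum>q\<in>F. h q x * indicator (sc q) x) = (\<Sum>q\<in>{q\<in>F. x \<in> sc q}. h q x)"
      using fin by (intro sum.mono_neutral_cong_right) (auto simp: indicator_def)
    then show ?case using elim by simp
  qed
  finally show ?thesis .
qed

lemma cube_mass_cmult:
  "h \<in> borel_measurable lebesgue \<Longrightarrow> c * cube_mass h q = cube_mass (\<lambda>x. c * h x) q"
  unfolding cube_mass_def mult.assoc by (subst nn_integral_cmult) auto

lemma card_le_1_at_point:
  assumes "laminar F" "E \<subseteq> F" and anti: "\<And>p q. p \<in> E \<Longrightarrow> q \<in> E \<Longrightarrow> sc p \<subseteq> sc q \<Longrightarrow> p = q"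
  shows "card {q\<in>E. x \<in> sc q} \<le> 1"
proof -
  have "p = q" if "p \<in> E" "q \<in> E" "x \<in> sc p" "x \<in> sc q" for p q
  proof -
    have F: "p \<in> F" "q \<in> F" using that assms(2) by blast+
    show ?thesis
    proof (cases "fst p \<le> fst q")
      case True
      then show ?thesis using laminar_nested[OF assms(1) F that(3,4)] anti that(1,2) by blast
    next
      case False
      then have "sc q \<subseteq> sc p" using laminar_nested[OF assms(1) F(2,1) that(4,3)] by simp
      then show ?thesis using anti that(1,2) by blast
    qed
  qed
  then have "\<exists>a. {q\<in>E. x \<in> sc q} \<subseteq> {a}" by blast
  then obtain a where "{q\<in>E. x \<in> sc q} \<subseteq> {a}" ..
  then have "card {q\<in>E. x \<in> sc q} \<le> card {a}" by (intro card_mono) auto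
  then show ?thesis by simp
qed

lemma sum_cube_mass_antichain_le:
  assumes fin: "finite F" and lam: "laminar F" and E: "E \<subseteq> F"
    and anti: "\<And>p q. p \<in> E \<Longrightarrow> q \<in> E \<Longrightarrow> sc p \<subseteq> sc q \<Longrightarrow> p = q"
    and [measurable]: "h \<in> borel_measurable lebesgue"
  shows "(\<Sum>q\<in>E. cube_mass h q) \<le> (\<integral>\<^sup>+x. h x \<partial>lebesgue)"
proof (rule sum_cube_mass_le)
  show "finite E" using fin E by (rule rev_finite_subset)
  show "AE x in lebesgue. (\<Sum>q\<in>{q\<in>E. x \<in> sc q}. h x) \<le> h x"
  proof (rule AE_I2)
    fix x
    have "of_nat (card {q\<in>E. x \<in> sc q}) * h x \<le> of_nat 1 * h x"
      using card_le_1_at_point[OF lam E anti] by (intro mult_right_mono) (auto simp del: of_nat_1)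
    then show "(\<Sum>q\<in>{q\<in>E. x \<in> sc q}. h x) \<le> h x" by simp
  qed
qed simp

text \<open>What is left of the problem once Poincare's inequality has been applied: f survives only
  in the lower bound \<open>level\<close> on the mass of g, and C0 carries the Poincare
  constant.\<close>

locale level_family =
  fixes F :: "(int \<times> (real ^ 'n)) set" and g v :: "real ^ 'n \<Rightarrow> real" and lam C0 p \<beta> :: real
  assumes fin: "finite F" and lamF: "laminar F"
    and g_meas [measurable]: "g \<in> borel_measurable lebesgue" and g0: "\<And>x. 0 \<le> g x"
    and v_meas [measurable]: "v \<in> borel_measurable lebesgue" and v0: "\<And>x. 0 \<le> v x"
    and v_fin: "\<And>q. cube_mass (\<lambda>x. ennreal (v x)) q < top"
    and lam: "0 < lam" and C0: "0 < C0" and p1: "1 \<le> p"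
    and level: "\<And>q. q \<in> F \<Longrightarrow> ennreal (lam * ell q powr (CARD('n) * (\<beta> + 1 - 1 / p))) \<le> ennreal C0 * cube_mass (\<lambda>x. ennreal (g x)) q"
begin

abbreviation V :: "int \<times> (real ^ 'n) \<Rightarrow> ennreal" where
  "V q \<equiv> cube_mass (\<lambda>x. ennreal (v x)) q"

abbreviation energy :: ennreal where
  "energy \<equiv> \<integral>\<^sup>+x. ennreal (g x powr p * v x) \<partial>lebesgue"

lemma level_mass: "q \<in> F \<Longrightarrow> ennreal (lam / C0 * ell q powr (CARD('n) * (\<beta> + 1 - 1 / p))) \<le> cube_mass (\<lambda>x. ennreal (g x)) q"
proof -
  assume "q \<in> F"
  have "ennreal C0 * ennreal (lam / C0 * ell q powr (CARD('n) * (\<beta> + 1 - 1 / p))) = ennreal (lam * ell q powr (CARD('n) * (\<beta> + 1 - 1 / p)))"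
    using C0 by (simp add: ennreal_mult'[symmetric])
  with level[OF \<open>q \<in> F\<close>] have "ennreal C0 * ennreal (lam / C0 * ell q powr (CARD('n) * (\<beta> + 1 - 1 / p))) \<le> ennreal C0 * cube_mass (\<lambda>x. ennreal (g x)) q"
    by simp
  then show ?thesis
    using C0 by (subst (asm) ennreal_mult_le_mult_iff) auto
qed

text \<open>H on q is applied to g cut off outside P, with t given by the level condition of P. The
  powers combine to (l(P)/l(q))^\<theta>: no loss for P = q, and a decay in l(q) exactly when
  \<theta> > 0, that is \<beta> < 1/p - 1.\<close>

lemma nested_cube_bound:
  assumes H: "\<And>h t q. h \<in> borel_measurable lebesgue \<Longrightarrow> (\<And>x. 0 \<le> h x) \<Longrightarrow> 0 \<le> t \<Longrightarrow> ennreal t \<le> cube_mass (\<lambda>x. ennreal (h x)) q \<Longrightarrow>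
      V q * ennreal (t powr p) \<le> A * ennreal (ell q powr (CARD('n) * p)) * cube_mass (\<lambda>x. ennreal (h x powr p * v x)) q"
    and P: "P \<in> F" "sc P \<subseteq> sc q" and \<theta>: "\<theta> = - (CARD('n) * (\<beta> * p - 1 + p))"
  shows "ennreal (lam powr p * ell q powr (CARD('n) * (\<beta> * p - 1))) * V q
    \<le> ennreal (C0 powr p * ell P powr \<theta> * ell q powr (- \<theta>)) * (A * cube_mass (\<lambda>x. ennreal (g x powr p * v x)) P)"
proof -
  define t where "t = lam / C0 * ell P powr (CARD('n) * (\<beta> + 1 - 1 / p))"
  have t: "0 \<le> t" using lam C0 by (simp add: t_def)
  let ?h = "\<lambda>x. g x * indicator (sc P) x"
  let ?\<gamma> = "CARD('n) * (\<beta> * p - 1)"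
  let ?X = "cube_mass (\<lambda>x. ennreal (g x powr p * v x)) P"
  have "cube_mass (\<lambda>x. ennreal (?h x)) q = cube_mass (\<lambda>x. ennreal (g x)) P"
    unfolding cube_mass_def using P by (intro nn_integral_cong) (auto simp: indicator_def)
  with level_mass[OF P(1)] have th: "ennreal t \<le> cube_mass (\<lambda>x. ennreal (?h x)) q"
    by (simp add: t_def)
  have "cube_mass (\<lambda>x. ennreal (?h x powr p * v x)) q = ?X"
    unfolding cube_mass_def using P p1 by (intro nn_integral_cong) (auto simp: indicator_def)
  with H[OF _ _ t th] have le: "V q * ennreal (t powr p) \<le> A * ennreal (ell q powr (CARD('n) * p)) * ?X"
    using g0 by simp
  define s where "s = C0 powr p * ell P powr \<theta> * ell q powr ?\<gamma>"
  have s: "0 \<le> s" by (simp add: s_def)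
  have tp: "t powr p = lam powr p / C0 powr p * ell P powr (- \<theta>)"
    using lam C0 p1 by (simp add: t_def powr_mult powr_divide powr_powr \<theta> algebra_simps)
  have 1: "s * t powr p = lam powr p * ell q powr ?\<gamma>"
    using C0 by (simp add: s_def tp powr_minus)
  have 2: "s * ell q powr (CARD('n) * p) = C0 powr p * ell P powr \<theta> * ell q powr (- \<theta>)"
    by (simp add: s_def \<theta> powr_add[symmetric] algebra_simps)
  have "ennreal (lam powr p * ell q powr ?\<gamma>) * V q = ennreal s * (V q * ennreal (t powr p))"
    unfolding 1[symmetric] using s by (simp add: ennreal_mult' mult_ac)
  also have "\<dots> \<le> ennreal s * (A * ennreal (ell q powr (CARD('n) * p)) * ?X)"
    by (intro mult_left_mono le) simp
  also have "\<dots> = ennreal (C0 powr p * ell P powr \<theta> * ell q powr (- \<theta>)) * (A * ?X)"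
    unfolding 2[symmetric] using s by (simp add: ennreal_mult' mult_ac)
  finally show ?thesis .
qed

text \<open>The coefficients grow with the cube, so along a tower the largest cube dominates the
  sum. The maximal cubes are disjoint, and each is paid by the energy in itself.\<close>

lemma supercritical_bound:
  assumes \<beta>: "1 / p < \<beta>"
    and H: "\<And>h t q. h \<in> borel_measurable lebesgue \<Longrightarrow> (\<And>x. 0 \<le> h x) \<Longrightarrow> 0 \<le> t \<Longrightarrow> ennreal t \<le> cube_mass (\<lambda>x. ennreal (h x)) q \<Longrightarrow>
      V q * ennreal (t powr p) \<le> A * ennreal (ell q powr (CARD('n) * p)) * cube_mass (\<lambda>x. ennreal (h x powr p * v x)) q"
  shows "(\<Sum>q\<in>F. ennreal (lam powr p * ell q powr (CARD('n) * (\<beta> * p - 1))) * V q)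
    \<le> ennreal (geom_const (CARD('n) * (\<beta> * p - 1)) * C0 powr p) * A * energy"
proof -
  define \<gamma> where "\<gamma> = CARD('n) * (\<beta> * p - 1)"
  have \<gamma>: "0 < \<gamma>" using \<beta> p1 by (simp add: \<gamma>_def field_simps)
  define E where "E = {q\<in>F. \<forall>r\<in>F. sc q \<subseteq> sc r \<longrightarrow> r = q}"
  have E: "E \<subseteq> F" "finite E" using fin by (auto simp: E_def)
  have pt: "(\<Sum>q\<in>{q\<in>F. x \<in> sc q}. ell q powr \<gamma>) \<le> geom_const \<gamma> * (\<Sum>q\<in>{q\<in>E. x \<in> sc q}. ell q powr \<gamma>)" for x
  proof (cases "{q\<in>F. x \<in> sc q} = {}")
    case True
    show ?thesis unfolding True using geom_const_pos[OF \<gamma>] by (simp add: sum_nonneg)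
  next
    case False
    let ?Fx = "{q\<in>F. x \<in> sc q}"
    have fx: "finite ?Fx" using fin by simp
    have "Max (fst ` ?Fx) \<in> fst ` ?Fx" using fx False by (intro Max_in) auto
    then obtain b where b: "b \<in> ?Fx" "fst b = Max (fst ` ?Fx)" by auto
    have bmax: "fst q \<le> fst b" if "q \<in> ?Fx" for q
      unfolding b(2) using fx that by (intro Max_ge) auto
    have "b \<in> E"
      unfolding E_def
    proof (intro CollectI conjI ballI impI)
      fix r assume r: "r \<in> F" "sc b \<subseteq> sc r"
      then have "r \<in> ?Fx" using b by auto
      then have "fst r = fst b" using bmax[of r] sc_mono[OF r(2)] by simp
      then show "r = b" using sc_eq_of_subset[OF r(2)] by simp
    qed (use b in auto)
    have "(\<Sum>q\<in>?Fx. ell q powr \<gamma>) = (\<Sum>q\<in>?Fx. 2 powr (\<gamma> * fst q))"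
      by (simp add: ell_def powr_powr mult.commute)
    also have "\<dots> \<le> 2 powr (\<gamma> * fst b) * geom_const \<gamma>"
      by (rule sum_powr_le_down[OF \<gamma> fx laminar_inj_on_fst[OF lamF] bmax])
    also have "2 powr (\<gamma> * fst b) = ell b powr \<gamma>"
      by (simp add: ell_def powr_powr mult.commute)
    also have "ell b powr \<gamma> \<le> (\<Sum>q\<in>{q\<in>E. x \<in> sc q}. ell q powr \<gamma>)"
      using E b \<open>b \<in> E\<close> by (intro member_le_sum) auto
    finally show ?thesis
      using geom_const_pos[OF \<gamma>] by (simp add: mult.commute)
  qed
  define a where "a = geom_const \<gamma> * lam powr p"
  have a: "0 \<le> a" using geom_const_pos[OF \<gamma>] by (simp add: a_def)
  have "(\<Sum>q\<in>F. ennreal (lam powr p * ell q powr \<gamma>) * V q) = (\<Sum>q\<in>F. cube_mass (\<lambda>x. ennreal (lam powr p * ell q powr \<gamma>) * ennreal (v x)) q)"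
    by (intro sum.cong refl cube_mass_cmult) measurable
  also have "\<dots> \<le> (\<integral>\<^sup>+x. (\<Sum>q\<in>E. ennreal (a * ell q powr \<gamma>) * ennreal (v x) * indicator (sc q) x) \<partial>lebesgue)"
  proof (rule sum_cube_mass_le[OF fin], measurable, rule AE_I2)
    fix x
    have "(\<Sum>q\<in>{q\<in>F. x \<in> sc q}. ennreal (lam powr p * ell q powr \<gamma>) * ennreal (v x)) = ennreal (lam powr p * (\<Sum>q\<in>{q\<in>F. x \<in> sc q}. ell q powr \<gamma>)) * ennreal (v x)"
      by (simp add: sum_distrib_right[symmetric] sum_ennreal sum_distrib_left[symmetric])
    also have "\<dots> \<le> ennreal (lam powr p * (geom_const \<gamma> * (\<Sum>q\<in>{q\<in>E. x \<in> sc q}. ell q powr \<gamma>))) * ennreal (v x)"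
      by (intro mult_right_mono ennreal_leI mult_left_mono pt) auto
    also have "lam powr p * (geom_const \<gamma> * (\<Sum>q\<in>{q\<in>E. x \<in> sc q}. ell q powr \<gamma>)) = (\<Sum>q\<in>{q\<in>E. x \<in> sc q}. a * ell q powr \<gamma>)"
      by (simp add: a_def sum_distrib_left mult_ac)
    also have "ennreal (\<Sum>q\<in>{q\<in>E. x \<in> sc q}. a * ell q powr \<gamma>) * ennreal (v x) = (\<Sum>q\<in>{q\<in>E. x \<in> sc q}. ennreal (a * ell q powr \<gamma>) * ennreal (v x))"
      using a by (simp add: sum_distrib_right[symmetric] sum_ennreal)
    also have "\<dots> = (\<Sum>q\<in>E. ennreal (a * ell q powr \<gamma>) * ennreal (v x) * indicator (sc q) x)"
      using E by (intro sum.mono_neutral_cong_left) (auto simp: indicator_def)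
    finally show "(\<Sum>q\<in>{q\<in>F. x \<in> sc q}. ennreal (lam powr p * ell q powr \<gamma>) * ennreal (v x)) \<le> \<dots>" .
  qed
  also have "\<dots> = (\<Sum>q\<in>E. cube_mass (\<lambda>x. ennreal (a * ell q powr \<gamma>) * ennreal (v x)) q)"
    unfolding cube_mass_def by (rule nn_integral_sum) measurable
  also have "\<dots> \<le> (\<Sum>q\<in>E. ennreal (geom_const \<gamma> * C0 powr p) * A * cube_mass (\<lambda>x. ennreal (g x powr p * v x)) q)"
  proof (rule sum_mono)
    fix q assume "q \<in> E"
    then have "q \<in> F" using E by auto
    define \<theta> where "\<theta> = - (CARD('n) * (\<beta> * p - 1 + p))"
    have "cube_mass (\<lambda>x. ennreal (a * ell q powr \<gamma>) * ennreal (v x)) q = ennreal (a * ell q powr \<gamma>) * V q"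
      by (rule cube_mass_cmult[symmetric]) measurable
    also have "\<dots> = ennreal (geom_const \<gamma>) * (ennreal (lam powr p * ell q powr (CARD('n) * (\<beta> * p - 1))) * V q)"
      using geom_const_pos[OF \<gamma>] by (simp add: a_def \<gamma>_def ennreal_mult' mult_ac)
    also have "\<dots> \<le> ennreal (geom_const \<gamma>) * (ennreal (C0 powr p * ell q powr \<theta> * ell q powr (- \<theta>)) * (A * cube_mass (\<lambda>x. ennreal (g x powr p * v x)) q))"
      by (intro mult_left_mono nested_cube_bound[OF H \<open>q \<in> F\<close> subset_refl \<theta>_def]) auto
    also have "\<dots> = ennreal (geom_const \<gamma> * C0 powr p) * A * cube_mass (\<lambda>x. ennreal (g x powr p * v x)) q"
      using geom_const_pos[OF \<gamma>] by (simp add: mult.assoc powr_add[symmetric] ennreal_mult')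
    finally show "cube_mass (\<lambda>x. ennreal (a * ell q powr \<gamma>) * ennreal (v x)) q \<le> \<dots>" .
  qed
  also have "\<dots> = ennreal (geom_const \<gamma> * C0 powr p) * A * (\<Sum>q\<in>E. cube_mass (\<lambda>x. ennreal (g x powr p * v x)) q)"
    by (simp add: sum_distrib_left)
  also have "\<dots> \<le> ennreal (geom_const \<gamma> * C0 powr p) * A * energy"
    by (intro mult_left_mono sum_cube_mass_antichain_le[OF fin lamF E(1)]) (auto simp: E_def)
  finally show ?thesis unfolding \<gamma>_def .
qed

text \<open>Every cube contains a minimal one and is charged to it with the decay of
  \<open>nested_cube_bound\<close>. The cubes around a minimal cube form a tower, and the minimal
  cubes are disjoint.\<close>

lemma subcritical_bound:
  assumes \<beta>: "\<beta> < 1 / p - 1"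
    and H: "\<And>h t q. h \<in> borel_measurable lebesgue \<Longrightarrow> (\<And>x. 0 \<le> h x) \<Longrightarrow> 0 \<le> t \<Longrightarrow> ennreal t \<le> cube_mass (\<lambda>x. ennreal (h x)) q \<Longrightarrow>
      V q * ennreal (t powr p) \<le> A * ennreal (ell q powr (CARD('n) * p)) * cube_mass (\<lambda>x. ennreal (h x powr p * v x)) q"
  shows "(\<Sum>q\<in>F. ennreal (lam powr p * ell q powr (CARD('n) * (\<beta> * p - 1))) * V q)
    \<le> ennreal (geom_const (- (CARD('n) * (\<beta> * p - 1 + p))) * C0 powr p) * A * energy"
proof -
  define \<theta> where "\<theta> = - (CARD('n) * (\<beta> * p - 1 + p))"
  have "\<beta> * p - 1 + p < 0" using \<beta> p1 by (simp add: field_simps)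
  then have \<theta>: "0 < \<theta>" by (simp add: \<theta>_def mult_pos_neg)
  define E where "E = {q\<in>F. \<forall>r\<in>F. sc r \<subseteq> sc q \<longrightarrow> r = q}"
  have E: "E \<subseteq> F" "finite E" using fin by (auto simp: E_def)
  have ex: "\<exists>P\<in>E. sc P \<subseteq> sc q" if "q \<in> F" for q
  proof -
    let ?S = "{r\<in>F. sc r \<subseteq> sc q}"
    have "q \<in> ?S" using that by simp
    then have S: "finite ?S" "?S \<noteq> {}" using fin by (simp, blast)
    have "Min (fst ` ?S) \<in> fst ` ?S" using S by (intro Min_in) auto
    then obtain b where b: "b \<in> ?S" "fst b = Min (fst ` ?S)" by auto
    have "b \<in> E"
      unfolding E_def
    proof (intro CollectI conjI ballI impI)
      fix r assume r: "r \<in> F" "sc r \<subseteq> sc b"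
      then have "r \<in> ?S" using b by auto
      then have "fst b \<le> fst r" unfolding b(2) using S by (intro Min_le) auto
      then have "fst r = fst b" using sc_mono[OF r(2)] by simp
      then show "r = b" using sc_eq_of_subset[OF r(2)] by simp
    qed (use b in auto)
    then show ?thesis using b by auto
  qed
  let ?X = "\<lambda>P. A * cube_mass (\<lambda>x. ennreal (g x powr p * v x)) P"
  let ?w = "\<lambda>q. ennreal (lam powr p * ell q powr (CARD('n) * (\<beta> * p - 1))) * V q"
  have "(\<Sum>q\<in>F. ?w q) \<le> (\<Sum>q\<in>F. \<Sum>P\<in>{P\<in>E. sc P \<subseteq> sc q}. ennreal (C0 powr p * ell P powr \<theta> * ell q powr (- \<theta>)) * ?X P)"
  proof (rule sum_mono)
    fix q assume "q \<in> F"
    then obtain P where P: "P \<in> E" "sc P \<subseteq> sc q" using ex by blast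
    have "?w q \<le> ennreal (C0 powr p * ell P powr \<theta> * ell q powr (- \<theta>)) * ?X P"
      using P E by (intro nested_cube_bound[OF H]) (auto simp: \<theta>_def)
    \<comment> \<open>Summing over all minimal cubes inside q, instead of choosing one, allows the
      order of summation to be exchanged.\<close>
    also have "\<dots> \<le> (\<Sum>P\<in>{P\<in>E. sc P \<subseteq> sc q}. ennreal (C0 powr p * ell P powr \<theta> * ell q powr (- \<theta>)) * ?X P)"
      using P E by (intro member_le_sum) auto
    finally show "?w q \<le> \<dots>" .
  qed
  also have "\<dots> = (\<Sum>P\<in>E. \<Sum>q\<in>{q\<in>F. sc P \<subseteq> sc q}. ennreal (C0 powr p * ell P powr \<theta> * ell q powr (- \<theta>)) * ?X P)"
    using fin E by (intro sum.swap_restrict) auto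
  also have "\<dots> \<le> (\<Sum>P\<in>E. ennreal (geom_const \<theta> * C0 powr p) * ?X P)"
  proof (rule sum_mono)
    fix P assume "P \<in> E"
    let ?S = "{q\<in>F. sc P \<subseteq> sc q}"
    have "(\<Sum>q\<in>?S. ell q powr (- \<theta>)) = (\<Sum>q\<in>?S. 2 powr (- \<theta> * fst q))"
      by (simp add: ell_def powr_powr mult.commute)
    also have "\<dots> \<le> 2 powr (- \<theta> * fst P) * geom_const \<theta>"
      using fin by (intro sum_powr_le_up[OF \<theta>] laminar_inj_on_fst_super[OF lamF]) (auto intro: sc_mono)
    also have "2 powr (- \<theta> * fst P) = ell P powr (- \<theta>)"
      by (simp add: ell_def powr_powr mult.commute)
    finally have le: "(\<Sum>q\<in>?S. ell q powr (- \<theta>)) \<le> ell P powr (- \<theta>) * geom_const \<theta>" .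
    have "(\<Sum>q\<in>?S. ennreal (C0 powr p * ell P powr \<theta> * ell q powr (- \<theta>)) * ?X P) = ennreal (C0 powr p * ell P powr \<theta> * (\<Sum>q\<in>?S. ell q powr (- \<theta>))) * ?X P"
      by (simp add: sum_distrib_right[symmetric] sum_ennreal sum_distrib_left[symmetric])
    also have "\<dots> \<le> ennreal (C0 powr p * ell P powr \<theta> * (ell P powr (- \<theta>) * geom_const \<theta>)) * ?X P"
      by (intro mult_right_mono ennreal_leI mult_left_mono le) auto
    also have "C0 powr p * ell P powr \<theta> * (ell P powr (- \<theta>) * geom_const \<theta>) = geom_const \<theta> * C0 powr p"
      by (simp add: powr_minus)
    finally show "(\<Sum>q\<in>?S. ennreal (C0 powr p * ell P powr \<theta> * ell q powr (- \<theta>)) * ?X P) \<le> ennreal (geom_const \<theta> * C0 powr p) * ?X P" .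
  qed
  also have "\<dots> = ennreal (geom_const \<theta> * C0 powr p) * A * (\<Sum>q\<in>E. cube_mass (\<lambda>x. ennreal (g x powr p * v x)) q)"
    by (simp add: sum_distrib_left mult.assoc)
  also have "\<dots> \<le> ennreal (geom_const \<theta> * C0 powr p) * A * energy"
    by (intro mult_left_mono sum_cube_mass_antichain_le[OF fin lamF E(1)]) (auto simp: E_def)
  finally show ?thesis unfolding \<theta>_def .
qed

end

section \<open>Truncation\<close>

text \<open>Where 2h \<le> u, the mass of h is at most half the mass of u; the rest of h must carry
  the other half. Finiteness of the mass of u permits the cancellation.\<close>

lemma cube_mass_truncate:
  fixes h u :: "real ^ 'n \<Rightarrow> real"
  assumes [measurable]: "h \<in> borel_measurable lebesgue" "u \<in> borel_measurable lebesgue"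
    and h: "\<And>x. 0 \<le> h x" and u: "\<And>x. 0 \<le> u x"
    and le: "cube_mass (\<lambda>x. ennreal (u x)) q \<le> cube_mass (\<lambda>x. ennreal (h x)) q"
    and fin: "cube_mass (\<lambda>x. ennreal (u x)) q < top"
  shows "cube_mass (\<lambda>x. ennreal (u x)) q \<le> 2 * cube_mass (\<lambda>x. ennreal (h x * indicator {x. u x < 2 * h x} x)) q"
proof -
  let ?h = "\<lambda>x. h x * indicator {x. u x < 2 * h x} x"
  have [measurable]: "Measurable.pred lebesgue (\<lambda>x. u x < 2 * h x)" by measurable
  have [measurable]: "?h \<in> borel_measurable lebesgue"
    unfolding indicator_def by measurable
  let ?m = "cube_mass (\<lambda>x. ennreal (u x / 2)) q"
  have half: "cube_mass (\<lambda>x. ennreal (u x)) q = ?m + ?m"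
    unfolding cube_mass_def
    by (subst nn_integral_add[symmetric]) (auto intro!: nn_integral_cong simp: u distrib_right[symmetric] ennreal_plus[symmetric] simp del: ennreal_plus)
  have "cube_mass (\<lambda>x. ennreal (h x)) q \<le> (\<integral>\<^sup>+x. ennreal (?h x) * indicator (sc q) x + ennreal (u x / 2) * indicator (sc q) x \<partial>lebesgue)"
    unfolding cube_mass_def
    by (intro nn_integral_mono) (auto simp: indicator_def intro!: ennreal_leI)
  also have "\<dots> = cube_mass (\<lambda>x. ennreal (?h x)) q + ?m"
    unfolding cube_mass_def by (rule nn_integral_add) measurable
  also have "\<dots> = ?m + cube_mass (\<lambda>x. ennreal (?h x)) q"
    by (rule add.commute)
  finally have "?m + ?m \<le> ?m + cube_mass (\<lambda>x. ennreal (?h x)) q"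
    using le unfolding half by (rule order_trans[rotated])
  moreover have "?m \<noteq> top"
  proof
    assume "?m = top"
    with fin show False unfolding half by simp
  qed
  ultimately have "?m \<le> cube_mass (\<lambda>x. ennreal (?h x)) q"
    by (simp add: ennreal_add_left_cancel_le)
  then show ?thesis
    unfolding half mult_2 by (intro add_mono)
qed

context level_family
begin

text \<open>The height \<lambda>/C0 |Q|^(\<beta> - 1/p), a lower bound for the average of g on the
  cubes of the family, written as a power of 2 in the scale so that it fits
  \<open>sum_powr_below_threshold\<close>.\<close>

definition thr :: "int \<times> (real ^ 'n) \<Rightarrow> real" where
  "thr q = lam / C0 * 2 powr (CARD('n) * (\<beta> - 1 / p) * real_of_int (fst q))"

lemma thr_pos [simp]: "0 < thr q"
  using lam C0 by (simp add: thr_def)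

lemma thr_nonneg [simp]: "0 \<le> thr q"
  using thr_pos[of q] by (rule less_imp_le)

lemma thr_mass: "q \<in> F \<Longrightarrow> ennreal (thr q * ell q ^ CARD('n)) \<le> cube_mass (\<lambda>x. ennreal (g x)) q"
proof -
  have "thr q * ell q ^ CARD('n) = lam / C0 * (2 powr (CARD('n) * (\<beta> - 1 / p) * real_of_int (fst q)) * 2 powr (real_of_int (fst q) * CARD('n)))"
    by (simp add: thr_def ell_def powr_realpow[symmetric] powr_powr)
  also have "2 powr (CARD('n) * (\<beta> - 1 / p) * real_of_int (fst q)) * 2 powr (real_of_int (fst q) * CARD('n)) = ell q powr (CARD('n) * (\<beta> + 1 - 1 / p))"
    unfolding powr_add[symmetric] ell_def powr_powr by (simp add: algebra_simps)
  finally show "q \<in> F \<Longrightarrow> ennreal (thr q * ell q ^ CARD('n)) \<le> cube_mass (\<lambda>x. ennreal (g x)) q"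
    using level_mass[of q] by simp
qed

lemma weight_eq_thr: "lam powr p * ell q powr (CARD('n) * (\<beta> * p - 1)) = C0 powr p * thr q powr p"
proof -
  have "thr q powr p = (lam / C0) powr p * 2 powr (CARD('n) * (\<beta> - 1 / p) * real_of_int (fst q) * p)"
    unfolding thr_def using lam C0 by (subst powr_mult) (auto simp: powr_powr)
  also have "2 powr (CARD('n) * (\<beta> - 1 / p) * real_of_int (fst q) * p) = ell q powr (CARD('n) * (\<beta> * p - 1))"
  proof -
    have E1: "(\<beta> - 1 / p) * p = \<beta> * p - 1" using p1 by (simp add: left_diff_distrib)
    have E2: "CARD('n) * (\<beta> - 1 / p) * real_of_int (fst q) * p = real_of_int (fst q) * (CARD('n) * ((\<beta> - 1 / p) * p))"
      by (simp only: mult_ac)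
    show ?thesis unfolding ell_def powr_powr E2 E1 ..
  qed
  finally show ?thesis
    using lam C0 by (simp add: powr_divide)
qed

lemma sum_thr_le:
  assumes "\<beta> \<noteq> 1 / p" "0 < r" "E \<subseteq> {q\<in>F. x \<in> sc q}" "\<And>q. q \<in> E \<Longrightarrow> thr q \<le> X"
  shows "(\<Sum>q\<in>E. thr q powr r) \<le> geom_const (\<bar>CARD('n) * (\<beta> - 1 / p)\<bar> * r) * X powr r"
proof -
  have "(\<Sum>q\<in>E. (lam / C0 * 2 powr (CARD('n) * (\<beta> - 1 / p) * real_of_int (fst q))) powr r)
      \<le> geom_const (\<bar>CARD('n) * (\<beta> - 1 / p)\<bar> * r) * X powr r"
  proof (rule sum_powr_below_threshold[where k=fst and c="lam / C0" and \<eta>="CARD('n) * (\<beta> - 1 / p)" and q=r and A=E])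
    show "finite E" using fin by (intro finite_subset[OF assms(3)]) simp
    show "inj_on fst E" using laminar_inj_on_fst[OF lamF] assms(3) by (rule inj_on_subset)
    show "lam / C0 * 2 powr (CARD('n) * (\<beta> - 1 / p) * real_of_int (fst q)) \<le> X" if "q \<in> E" for q
      using assms(4)[OF that] unfolding thr_def .
    show "CARD('n) * (\<beta> - 1 / p) \<noteq> 0" "0 < r" "0 < lam / C0"
      using assms(1,2) lam C0 by simp_all
  qed
  then show ?thesis unfolding thr_def .
qed

text \<open>One factor of \<open>thr\<close>^p is spent on the A_1 condition for the truncated g:
  \<open>thr\<close> v(Q) is at most 2 A times the integral of g v over the points of Q with
  \<open>thr\<close> < 2 g. At x the remaining powers \<open>thr\<close>^(p - 1) over the cubes with
  \<open>thr\<close> < 2 g(x) sum to a multiple of (2 g(x))^(p - 1), as p > 1. The A_1 constant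
  enters only once.\<close>

lemma A1_bound:
  assumes p: "1 < p" and \<beta>: "\<beta> \<noteq> 1 / p"
    and H: "\<And>h q. h \<in> borel_measurable lebesgue \<Longrightarrow>
      V q * cube_mass h q \<le> A * ennreal (ell q ^ CARD('n)) * cube_mass (\<lambda>x. h x * ennreal (v x)) q"
  shows "(\<Sum>q\<in>F. ennreal (lam powr p * ell q powr (CARD('n) * (\<beta> * p - 1))) * V q)
    \<le> ennreal (2 powr p * C0 powr p * geom_const (\<bar>CARD('n) * (\<beta> - 1 / p)\<bar> * (p - 1))) * A * energy"
proof -
  define K where "K = geom_const (\<bar>CARD('n) * (\<beta> - 1 / p)\<bar> * (p - 1))"
  have K: "0 \<le> K" unfolding K_def using p \<beta> by (intro less_imp_le geom_const_pos) auto
  let ?h = "\<lambda>q x. g x * indicator {x. thr q < 2 * g x} x"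
  have [measurable]: "?h q \<in> borel_measurable lebesgue" for q
    unfolding indicator_def by measurable
  have one: "ennreal (thr q) * V q \<le> 2 * A * cube_mass (\<lambda>x. ennreal (?h q x) * ennreal (v x)) q" if "q \<in> F" for q
  proof -
    let ?l = "ell q ^ CARD('n)"
    have c: "cube_mass (\<lambda>x. ennreal (thr q)) q = ennreal (thr q * ?l)"
      unfolding cube_mass_def by (simp add: nn_integral_cmult_indicator emeasure_sc ennreal_mult less_imp_le)
    have "ennreal (thr q * ?l) \<le> 2 * cube_mass (\<lambda>x. ennreal (?h q x)) q"
      using cube_mass_truncate[of g "\<lambda>_. thr q" q] thr_mass[OF that] g0 thr_pos[of q] unfolding c by (simp add: less_imp_le)
    then have "V q * ennreal (thr q * ?l) \<le> V q * (2 * cube_mass (\<lambda>x. ennreal (?h q x)) q)"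
      by (rule mult_left_mono) simp
    also have "\<dots> = 2 * (V q * cube_mass (\<lambda>x. ennreal (?h q x)) q)"
      by (simp only: mult_ac)
    also have "\<dots> \<le> 2 * (A * ennreal ?l * cube_mass (\<lambda>x. ennreal (?h q x) * ennreal (v x)) q)"
      by (intro mult_left_mono H) auto
    finally have "ennreal ?l * (ennreal (thr q) * V q) \<le> ennreal ?l * (2 * A * cube_mass (\<lambda>x. ennreal (?h q x) * ennreal (v x)) q)"
      by (simp add: ennreal_mult' mult_ac)
    then show ?thesis
      by (subst (asm) ennreal_mult_le_mult_iff) auto
  qed
  have "(\<Sum>q\<in>F. ennreal (lam powr p * ell q powr (CARD('n) * (\<beta> * p - 1))) * V q)
      \<le> (\<Sum>q\<in>F. ennreal (2 * C0 powr p) * A * cube_mass (\<lambda>x. ennreal (thr q powr (p - 1)) * (ennreal (?h q x) * ennreal (v x))) q)"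
  proof (rule sum_mono)
    fix q assume q: "q \<in> F"
    have tp: "thr q powr p = thr q powr (p - 1) * thr q"
      using powr_add[of "thr q" "p - 1" 1] thr_pos[of q] by (simp add: less_imp_le)
    have "ennreal (lam powr p * ell q powr (CARD('n) * (\<beta> * p - 1))) * V q = ennreal (C0 powr p * thr q powr (p - 1)) * (ennreal (thr q) * V q)"
      unfolding weight_eq_thr tp by (simp add: ennreal_mult mult_ac)
    also have "\<dots> \<le> ennreal (C0 powr p * thr q powr (p - 1)) * (2 * A * cube_mass (\<lambda>x. ennreal (?h q x) * ennreal (v x)) q)"
      by (intro mult_left_mono one q) simp
    also have "\<dots> = ennreal (2 * C0 powr p) * A * (ennreal (thr q powr (p - 1)) * cube_mass (\<lambda>x. ennreal (?h q x) * ennreal (v x)) q)"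
      by (simp add: ennreal_mult' mult_ac)
    also have "ennreal (thr q powr (p - 1)) * cube_mass (\<lambda>x. ennreal (?h q x) * ennreal (v x)) q = cube_mass (\<lambda>x. ennreal (thr q powr (p - 1)) * (ennreal (?h q x) * ennreal (v x))) q"
      by (rule cube_mass_cmult) measurable
    finally show "ennreal (lam powr p * ell q powr (CARD('n) * (\<beta> * p - 1))) * V q
        \<le> ennreal (2 * C0 powr p) * A * cube_mass (\<lambda>x. ennreal (thr q powr (p - 1)) * (ennreal (?h q x) * ennreal (v x))) q" .
  qed
  also have "\<dots> = ennreal (2 * C0 powr p) * A * (\<Sum>q\<in>F. cube_mass (\<lambda>x. ennreal (thr q powr (p - 1)) * (ennreal (?h q x) * ennreal (v x))) q)"
    by (simp add: sum_distrib_left)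
  also have "(\<Sum>q\<in>F. cube_mass (\<lambda>x. ennreal (thr q powr (p - 1)) * (ennreal (?h q x) * ennreal (v x))) q)
     \<le> (\<integral>\<^sup>+x. ennreal (K * 2 powr (p - 1)) * ennreal (g x powr p * v x) \<partial>lebesgue)"
  proof (rule sum_cube_mass_le[OF fin], measurable, rule AE_I2)
    fix x
    let ?E = "{q\<in>{q\<in>F. x \<in> sc q}. thr q < 2 * g x}"
    have "(\<Sum>q\<in>{q\<in>F. x \<in> sc q}. ennreal (thr q powr (p - 1)) * (ennreal (?h q x) * ennreal (v x)))
       = (\<Sum>q\<in>?E. ennreal (thr q powr (p - 1)) * (ennreal (g x) * ennreal (v x)))"
      using fin by (intro sum.mono_neutral_cong_right) (auto simp: indicator_def)
    also have "\<dots> = ennreal (\<Sum>q\<in>?E. thr q powr (p - 1)) * (ennreal (g x) * ennreal (v x))"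
      by (simp add: sum_distrib_right[symmetric] sum_ennreal)
    also have "\<dots> \<le> ennreal (K * (2 * g x) powr (p - 1)) * (ennreal (g x) * ennreal (v x))"
      unfolding K_def using p \<beta> by (intro mult_right_mono ennreal_leI sum_thr_le[of _ _ x]) auto
    also have "\<dots> = ennreal (K * 2 powr (p - 1)) * ennreal (g x powr p * v x)"
    proof -
      have "g x powr p = g x powr (p - 1) * g x"
        using powr_add[of "g x" "p - 1" 1] g0[of x] by (cases "g x = 0") auto
      then show ?thesis
        using K g0[of x] v0[of x] by (simp add: ennreal_mult'[symmetric] powr_mult mult_ac)
    qed
    finally show "(\<Sum>q\<in>{q\<in>F. x \<in> sc q}. ennreal (thr q powr (p - 1)) * (ennreal (?h q x) * ennreal (v x))) \<le> \<dots>" .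
  qed
  also have "(\<integral>\<^sup>+x. ennreal (K * 2 powr (p - 1)) * ennreal (g x powr p * v x) \<partial>lebesgue) = ennreal (K * 2 powr (p - 1)) * energy"
    by (rule nn_integral_cmult) measurable
  also have "ennreal (2 * C0 powr p) * A * (ennreal (K * 2 powr (p - 1)) * energy) = ennreal (2 * C0 powr p * (K * 2 powr (p - 1))) * A * energy"
    using K by (simp add: ennreal_mult mult_ac)
  also have "2 * C0 powr p * (K * 2 powr (p - 1)) = 2 powr p * C0 powr p * K"
    by (simp add: powr_diff)
  finally show ?thesis unfolding K_def by (auto simp: mult_left_mono)
qed

end

section \<open>Maximal functions and the dual weight\<close>

lemma ex_maximal_cube:
  assumes "finite T" "q \<in> T"
  shows "\<exists>b\<in>T. sc q \<subseteq> sc b \<and> (\<forall>r\<in>T. sc b \<subseteq> sc r \<longrightarrow> r = b)"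
proof -
  let ?S = "{r\<in>T. sc q \<subseteq> sc r}"
  have "q \<in> ?S" using assms by simp
  then have S: "finite ?S" "?S \<noteq> {}" using assms by (simp, blast)
  have "Max (fst ` ?S) \<in> fst ` ?S" using S by (intro Max_in) auto
  then obtain b where b: "b \<in> ?S" "fst b = Max (fst ` ?S)" by auto
  have "r = b" if r: "r \<in> T" "sc b \<subseteq> sc r" for r
  proof -
    have "r \<in> ?S" using r b by auto
    then have "fst r \<le> fst b" unfolding b(2) using S by (intro Max_ge) auto
    then have "fst b = fst r" using sc_mono[OF r(2)] by simp
    then show "r = b" using sc_eq_of_subset[OF r(2)] by simp
  qed
  then show ?thesis using b by auto
qed

text \<open>The ceiling minus 1, not the floor, puts c above 2^j strictly, as the superlevel sets of
  \<open>M\<close> require.\<close>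

lemma dyadic_bracket:
  assumes "0 < (c :: real)"
  shows "2 powr real_of_int (\<lceil>log 2 c\<rceil> - 1) < c" "c \<le> 2 powr (real_of_int (\<lceil>log 2 c\<rceil> - 1) + 1)"
proof -
  have "real_of_int (\<lceil>log 2 c\<rceil> - 1) < log 2 c" by linarith
  then show "2 powr real_of_int (\<lceil>log 2 c\<rceil> - 1) < c"
    using assms by (simp add: less_log_iff)
  have "log 2 c \<le> real_of_int (\<lceil>log 2 c\<rceil> - 1) + 1" by simp
  then show "c \<le> 2 powr (real_of_int (\<lceil>log 2 c\<rceil> - 1) + 1)"
    using assms by (simp only: log_le_iff)
qed

text \<open>Here a is the A_p constant as a real number, and \<open>dual\<close> is the A_p
  condition with v^(-1/(p - 1)) as second weight.\<close>

locale dual_level_family = level_family F g v lam C0 p \<beta>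
  for F :: "(int \<times> (real ^ 'n)) set" and g v :: "real ^ 'n \<Rightarrow> real" and lam C0 p \<beta> :: real +
  fixes a :: real
  assumes p: "1 < p" and a0: "0 \<le> a"
    and gfin: "\<And>q. cube_mass (\<lambda>x. ennreal (g x)) q < top"
    and dual: "\<And>q. V q \<noteq> 0 \<Longrightarrow> \<exists>S>0. cube_mass (\<lambda>x. ennreal (dual_weight p v x)) q = ennreal S \<and>
      (AE x in lebesgue. x \<in> sc q \<longrightarrow> 0 < v x) \<and> V q * ennreal (S powr (p - 1)) \<le> ennreal a * ennreal (ell q powr (CARD('n) * p))"
begin

definition "E = {q\<in>F. V q \<noteq> 0}"
definition "W = (\<Union>q\<in>E. sc q)"
definition "\<sigma> = dual_weight p v"
definition "S q = enn2real (cube_mass (\<lambda>x. ennreal (\<sigma> x)) q)"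
definition "I q = enn2real (cube_mass (\<lambda>x. ennreal (g x)) q)"
text \<open>The average of g/\<sigma> over the cube with respect to the measure \<sigma> dx.\<close>

definition "c q = I q / S q"
text \<open>The maximal function of g/\<sigma> for the measure \<sigma> dx over the cubes of E.
  \<open>None\<close> contributes the value 0, so the maximum is taken over a nonempty set even if E
  is empty.\<close>

definition "M x = Max ((\<lambda>z. case z of None \<Rightarrow> 0 | Some q \<Rightarrow> c q * indicator (sc q) x) ` insert None (Some ` E))"

lemma E_props: "finite E" "E \<subseteq> F" "laminar E"
  using fin lamF by (auto simp: E_def intro: laminar_subset)

lemma W_meas [measurable]: "W \<in> sets lebesgue"
  unfolding W_def using E_props by (intro sets.finite_UN) auto

lemma \<sigma>_meas [measurable]: "\<sigma> \<in> borel_measurable lebesgue"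
  unfolding \<sigma>_def by measurable

lemma \<sigma>0: "0 \<le> \<sigma> x"
  by (simp add: \<sigma>_def dual_weight_def)

lemma S_props: assumes "q \<in> E" shows "0 < S q" "cube_mass (\<lambda>x. ennreal (\<sigma> x)) q = ennreal (S q)"
    "AE x in lebesgue. x \<in> sc q \<longrightarrow> 0 < v x"
    "V q * ennreal (S q powr (p - 1)) \<le> ennreal a * ennreal (ell q powr (CARD('n) * p))"
  using dual[of q] assms unfolding E_def S_def \<sigma>_def by auto

lemma I_props: "cube_mass (\<lambda>x. ennreal (g x)) q = ennreal (I q)" "0 \<le> I q"
  using gfin[of q] by (auto simp: I_def)

lemma c0: "0 \<le> c q"
  by (simp add: c_def I_def S_def)

lemma M_meas [measurable]: "M \<in> borel_measurable lebesgue"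
proof -
  have "(\<lambda>x. Max ((\<lambda>z. (case z of None \<Rightarrow> 0 | Some q \<Rightarrow> c q * indicator (sc q) x) :: real) ` insert None (Some ` E))) \<in> borel_measurable lebesgue"
    using E_props by (intro borel_measurable_Max) (auto split: option.split)
  then show ?thesis unfolding M_def[abs_def] .
qed

lemma M_ge: "0 \<le> M x" "q \<in> E \<Longrightarrow> x \<in> sc q \<Longrightarrow> c q \<le> M x"
proof -
  have f: "finite ((\<lambda>z. (case z of None \<Rightarrow> 0 | Some q \<Rightarrow> c q * indicator (sc q) x) :: real) ` insert None (Some ` E))"
    using E_props by simp
  show "0 \<le> M x" unfolding M_def by (rule Max_ge[OF f]) force
  show "c q \<le> M x" if "q \<in> E" "x \<in> sc q"
    unfolding M_def by (rule Max_ge[OF f]) (use that in force)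
qed

lemma M_attained: "M x = 0 \<or> (\<exists>q\<in>E. x \<in> sc q \<and> M x = c q)"
proof -
  have "M x \<in> (\<lambda>z. (case z of None \<Rightarrow> 0 | Some q \<Rightarrow> c q * indicator (sc q) x) :: real) ` insert None (Some ` E)"
    unfolding M_def using E_props by (intro Max_in) auto
  then show ?thesis by (auto simp: indicator_def split: if_splits)
qed

lemma AE_W_pos: "AE x in lebesgue. x \<in> W \<longrightarrow> 0 < v x"
proof -
  have "AE x in lebesgue. \<forall>q\<in>E. x \<in> sc q \<longrightarrow> 0 < v x"
    using E_props(1) S_props(3) by (intro AE_finite_allI)
  then show ?thesis by eventually_elim (auto simp: W_def)
qed

text \<open>The set where M > s is covered by the disjoint maximal cubes with c > s, on which s
  \<sigma>(Q) is at most the mass of g; truncation then discards the points where g is small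
  compared with s \<sigma>.\<close>

lemma maximal_weak_type:
  assumes s: "0 < s"
  shows "ennreal s * (\<integral>\<^sup>+x. ennreal (\<sigma> x) * indicator {x. s < M x} x \<partial>lebesgue)
    \<le> 2 * (\<integral>\<^sup>+x. ennreal (g x * indicator {x. s * \<sigma> x < 2 * g x} x) * indicator W x \<partial>lebesgue)"
proof -
  let ?Es = "{q\<in>E. s < c q}"
  define T where "T = {q\<in>?Es. \<forall>r\<in>?Es. sc q \<subseteq> sc r \<longrightarrow> r = q}"
  have T: "finite T" "T \<subseteq> E" "\<And>q. q \<in> T \<Longrightarrow> s < c q" using E_props by (auto simp: T_def)
  let ?h = "\<lambda>x. g x * indicator {x. s * \<sigma> x < 2 * g x} x"
  have [measurable]: "?h \<in> borel_measurable lebesgue"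
    unfolding indicator_def by measurable
  have "(\<integral>\<^sup>+x. ennreal (\<sigma> x) * indicator {x. s < M x} x \<partial>lebesgue) \<le> (\<integral>\<^sup>+x. (\<Sum>q\<in>T. ennreal (\<sigma> x) * indicator (sc q) x) \<partial>lebesgue)"
  proof (rule nn_integral_mono)
    fix x
    show "ennreal (\<sigma> x) * indicator {x. s < M x} x \<le> (\<Sum>q\<in>T. ennreal (\<sigma> x) * indicator (sc q) x)"
    proof (cases "s < M x")
      case True
      then obtain q where q: "q \<in> E" "x \<in> sc q" "M x = c q" using M_attained[of x] s by auto
      then have "q \<in> ?Es" using True by simp
      then obtain b where b: "b \<in> ?Es" "sc q \<subseteq> sc b" "\<forall>r\<in>?Es. sc b \<subseteq> sc r \<longrightarrow> r = b"
        using ex_maximal_cube[of ?Es q] E_props(1) by auto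
      then have "b \<in> T" "x \<in> sc b" using q by (auto simp: T_def)
      then have "ennreal (\<sigma> x) * indicator (sc b) x \<le> (\<Sum>q\<in>T. ennreal (\<sigma> x) * indicator (sc q) x)"
        using T by (intro member_le_sum) auto
      then show ?thesis using True \<open>x \<in> sc b\<close> by simp
    qed simp
  qed
  also have "\<dots> = (\<Sum>q\<in>T. cube_mass (\<lambda>x. ennreal (\<sigma> x)) q)"
    unfolding cube_mass_def by (rule nn_integral_sum) measurable
  finally have "ennreal s * (\<integral>\<^sup>+x. ennreal (\<sigma> x) * indicator {x. s < M x} x \<partial>lebesgue) \<le> ennreal s * (\<Sum>q\<in>T. cube_mass (\<lambda>x. ennreal (\<sigma> x)) q)"
    by (rule mult_left_mono) simp
  also have "\<dots> = (\<Sum>q\<in>T. ennreal s * cube_mass (\<lambda>x. ennreal (\<sigma> x)) q)"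
    by (rule sum_distrib_left)
  also have "\<dots> \<le> (\<Sum>q\<in>T. 2 * cube_mass (\<lambda>x. ennreal (?h x) * indicator W x) q)"
  proof (rule sum_mono)
    fix q assume q: "q \<in> T"
    then have qE: "q \<in> E" using T by auto
    have u: "ennreal s * cube_mass (\<lambda>x. ennreal (\<sigma> x)) q = cube_mass (\<lambda>x. ennreal (s * \<sigma> x)) q"
      using s \<sigma>0 by (subst cube_mass_cmult) (auto simp: ennreal_mult)
    have u2: "ennreal s * cube_mass (\<lambda>x. ennreal (\<sigma> x)) q = ennreal (s * S q)"
      using S_props[OF qE] s by (simp add: ennreal_mult)
    have "s * S q \<le> I q"
      using T(3)[OF q] S_props(1)[OF qE] by (simp add: c_def field_simps)
    then have "cube_mass (\<lambda>x. ennreal (s * \<sigma> x)) q \<le> 2 * cube_mass (\<lambda>x. ennreal (?h x)) q"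
      using s \<sigma>0 g0 by (intro cube_mass_truncate) (auto simp: u[symmetric] u2 I_props ennreal_leI)
    also have "cube_mass (\<lambda>x. ennreal (?h x)) q = cube_mass (\<lambda>x. ennreal (?h x) * indicator W x) q"
      unfolding cube_mass_def using qE by (intro nn_integral_cong) (auto simp: W_def indicator_def)
    finally show "ennreal s * cube_mass (\<lambda>x. ennreal (\<sigma> x)) q \<le> 2 * cube_mass (\<lambda>x. ennreal (?h x) * indicator W x) q"
      unfolding u .
  qed
  also have "\<dots> = 2 * (\<Sum>q\<in>T. cube_mass (\<lambda>x. ennreal (?h x) * indicator W x) q)"
    by (simp add: sum_distrib_left)
  also have "\<dots> \<le> 2 * (\<integral>\<^sup>+x. ennreal (?h x) * indicator W x \<partial>lebesgue)"
  proof (intro mult_left_mono sum_cube_mass_antichain_le[OF E_props(1,3) T(2)])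
    show "p = q" if "p \<in> T" "q \<in> T" "sc p \<subseteq> sc q" for p q
      using that unfolding T_def by blast
  qed simp_all
  finally show ?thesis .
qed

text \<open>The truncated weak-type bound is summed over dyadic heights s. At x the heights with s
  \<sigma>(x) < 2 g(x) form a geometric series, and \<sigma>^(p - 1) = 1/v turns the result into the
  energy. As averages are taken with respect to \<sigma> itself, the constant does not depend on the
  weight.\<close>

lemma maximal_strong_type:
  "(\<integral>\<^sup>+x. ennreal (M x powr p * \<sigma> x) * indicator W x \<partial>lebesgue) \<le> ennreal (4 powr p * geom_const (p - 1)) * energy"
proof -
  let ?j = "\<lambda>q. \<lceil>log 2 (c q)\<rceil> - 1"
  \<comment> \<open>M takes finitely many values, so finitely many dyadic heights suffice.\<close>
  define J where "J = ?j ` {q\<in>E. 0 < c q}"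
  have J: "finite J" using E_props by (simp add: J_def)
  let ?s = "\<lambda>j::int. 2 powr real_of_int j"
  let ?h = "\<lambda>j x. g x * indicator {x. ?s j * \<sigma> x < 2 * g x} x"
  have [measurable]: "?h j \<in> borel_measurable lebesgue" for j
    unfolding indicator_def by measurable
  have [measurable]: "(\<lambda>x. indicator {x. ?s j < M x} x :: ennreal) \<in> borel_measurable lebesgue" for j
    unfolding indicator_def by measurable
  have G: "0 < geom_const (p - 1)" using p by (intro geom_const_pos) simp
  have "(\<integral>\<^sup>+x. ennreal (M x powr p * \<sigma> x) * indicator W x \<partial>lebesgue)
      \<le> (\<integral>\<^sup>+x. (\<Sum>j\<in>J. ennreal (2 powr p * ?s j powr p) * (ennreal (\<sigma> x) * indicator {x. ?s j < M x} x)) \<partial>lebesgue)"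
  proof (rule nn_integral_mono)
    fix x
    show "ennreal (M x powr p * \<sigma> x) * indicator W x \<le> (\<Sum>j\<in>J. ennreal (2 powr p * ?s j powr p) * (ennreal (\<sigma> x) * indicator {x. ?s j < M x} x))"
    proof (cases "M x = 0")
      case True
      then show ?thesis using p by simp
    next
      case False
      then obtain q where q: "q \<in> E" "x \<in> sc q" "M x = c q" using M_attained[of x] by auto
      then have cq: "0 < c q" using False c0[of q] by simp
      define j where "j = ?j q"
      have jJ: "j \<in> J" using q cq by (auto simp: J_def j_def)
      have b: "?s j < c q" "c q \<le> 2 * ?s j"
      proof -
        have "2 powr (real_of_int j + 1) = 2 * ?s j" by (simp add: powr_add)
        then show "?s j < c q" "c q \<le> 2 * ?s j"
          using dyadic_bracket[OF cq] unfolding j_def[symmetric] by simp_all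
      qed
      have "M x powr p \<le> (2 * ?s j) powr p"
        unfolding q(3) using b cq p by (intro powr_mono2) auto
      then have "ennreal (M x powr p * \<sigma> x) * indicator W x \<le> ennreal (2 powr p * ?s j powr p * \<sigma> x)"
        using \<sigma>0[of x] by (auto simp: indicator_def powr_mult intro!: ennreal_leI mult_right_mono)
      also have "\<dots> = ennreal (2 powr p * ?s j powr p) * (ennreal (\<sigma> x) * indicator {x. ?s j < M x} x)"
        using b q \<sigma>0[of x] by (simp add: ennreal_mult)
      also have "\<dots> \<le> (\<Sum>j\<in>J. ennreal (2 powr p * ?s j powr p) * (ennreal (\<sigma> x) * indicator {x. ?s j < M x} x))"
        using J jJ by (intro member_le_sum[of j J "\<lambda>j. ennreal (2 powr p * ?s j powr p) * (ennreal (\<sigma> x) * indicator {x. ?s j < M x} x)"]) auto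
      finally show ?thesis .
    qed
  qed
  also have "\<dots> = (\<Sum>j\<in>J. ennreal (2 powr p * ?s j powr p) * (\<integral>\<^sup>+x. ennreal (\<sigma> x) * indicator {x. ?s j < M x} x \<partial>lebesgue))"
    by (subst nn_integral_sum, measurable) (intro sum.cong refl nn_integral_cmult, measurable)
  also have "\<dots> \<le> (\<Sum>j\<in>J. ennreal (2 * 2 powr p * ?s j powr (p - 1)) * (\<integral>\<^sup>+x. ennreal (?h j x) * indicator W x \<partial>lebesgue))"
  proof (rule sum_mono)
    fix j
    have sp: "?s j powr p = ?s j powr (p - 1) * ?s j"
      using powr_add[of "?s j" "p - 1" 1] by simp
    have "ennreal (2 powr p * ?s j powr p) * (\<integral>\<^sup>+x. ennreal (\<sigma> x) * indicator {x. ?s j < M x} x \<partial>lebesgue)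
      = ennreal (2 powr p * ?s j powr (p - 1)) * (ennreal (?s j) * (\<integral>\<^sup>+x. ennreal (\<sigma> x) * indicator {x. ?s j < M x} x \<partial>lebesgue))"
      unfolding sp by (simp add: ennreal_mult mult_ac)
    also have "\<dots> \<le> ennreal (2 powr p * ?s j powr (p - 1)) * (2 * (\<integral>\<^sup>+x. ennreal (?h j x) * indicator W x \<partial>lebesgue))"
      by (intro mult_left_mono maximal_weak_type) auto
    also have "\<dots> = ennreal (2 * 2 powr p * ?s j powr (p - 1)) * (\<integral>\<^sup>+x. ennreal (?h j x) * indicator W x \<partial>lebesgue)"
      by (simp add: ennreal_mult mult_ac)
    finally show "ennreal (2 powr p * ?s j powr p) * (\<integral>\<^sup>+x. ennreal (\<sigma> x) * indicator {x. ?s j < M x} x \<partial>lebesgue)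
      \<le> ennreal (2 * 2 powr p * ?s j powr (p - 1)) * (\<integral>\<^sup>+x. ennreal (?h j x) * indicator W x \<partial>lebesgue)" .
  qed
  also have "\<dots> = (\<integral>\<^sup>+x. (\<Sum>j\<in>J. ennreal (2 * 2 powr p * ?s j powr (p - 1)) * (ennreal (?h j x) * indicator W x)) \<partial>lebesgue)"
    by (subst nn_integral_sum, measurable) (intro sum.cong refl nn_integral_cmult[symmetric], measurable)
  also have "\<dots> \<le> (\<integral>\<^sup>+x. ennreal (4 powr p * geom_const (p - 1)) * ennreal (g x powr p * v x) \<partial>lebesgue)"
    using AE_W_pos
  proof (intro nn_integral_mono_AE, eventually_elim)
    case (elim x)
    show ?case
    proof (cases "x \<in> W")
      case True
      with elim have vx: "0 < v x" by simp
      then have sx: "0 < \<sigma> x" by (simp add: \<sigma>_def dual_weight_def)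
      let ?Jx = "{j\<in>J. ?s j * \<sigma> x < 2 * g x}"
      have "(\<Sum>j\<in>?Jx. (1 * 2 powr (1 * real_of_int j)) powr (p - 1)) \<le> geom_const (\<bar>1\<bar> * (p - 1)) * (2 * g x / \<sigma> x) powr (p - 1)"
        using J p sx by (intro sum_powr_below_threshold) (auto simp: field_simps)
      then have le: "(\<Sum>j\<in>?Jx. ?s j powr (p - 1)) \<le> geom_const (p - 1) * (2 * g x / \<sigma> x) powr (p - 1)"
        by simp
      have "(\<Sum>j\<in>J. ennreal (2 * 2 powr p * ?s j powr (p - 1)) * (ennreal (?h j x) * indicator W x))
        = (\<Sum>j\<in>?Jx. ennreal (2 * 2 powr p * ?s j powr (p - 1)) * ennreal (g x))"
        using J True by (intro sum.mono_neutral_cong_right) (auto simp: indicator_def)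
      also have "\<dots> = ennreal (2 * 2 powr p * (\<Sum>j\<in>?Jx. ?s j powr (p - 1))) * ennreal (g x)"
        by (simp add: sum_distrib_right[symmetric] sum_ennreal sum_distrib_left[symmetric])
      also have "\<dots> \<le> ennreal (2 * 2 powr p * (geom_const (p - 1) * (2 * g x / \<sigma> x) powr (p - 1))) * ennreal (g x)"
        by (intro mult_right_mono ennreal_leI mult_left_mono le) auto
      also have "\<dots> = ennreal (4 powr p * geom_const (p - 1)) * ennreal (g x powr p * v x)"
      proof -
        have e: "\<sigma> x powr (p - 1) = 1 / v x"
          unfolding \<sigma>_def dual_weight_def powr_powr using p vx by (simp add: powr_minus_divide)
        have gp: "g x powr p = g x powr (p - 1) * g x"
          using powr_add[of "g x" "p - 1" 1] g0[of x] by (cases "g x = 0") auto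
        have four: "4 powr p = 2 powr p * (2 powr p :: real)"
          by (simp add: powr_mult[symmetric])
        have "2 * 2 powr p * (geom_const (p - 1) * (2 * g x / \<sigma> x) powr (p - 1)) * g x = 4 powr p * geom_const (p - 1) * (g x powr p * v x)"
        proof -
          have B: "2 powr p = 2 * (2 powr (p - 1) :: real)" by (simp add: powr_diff)
          have "(2 * g x / \<sigma> x) powr (p - 1) = 2 powr (p - 1) * g x powr (p - 1) * v x"
            using g0[of x] sx by (simp add: powr_mult powr_divide e)
          then have "2 * 2 powr p * (geom_const (p - 1) * (2 * g x / \<sigma> x) powr (p - 1)) * g x
              = 2 powr p * (2 * 2 powr (p - 1)) * geom_const (p - 1) * ((g x powr (p - 1) * g x) * v x)"
            by (simp only: mult_ac)
          then show ?thesis unfolding gp[symmetric] B[symmetric] four[symmetric] .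
        qed
        then show ?thesis
          using G g0[of x] vx by (simp add: ennreal_mult[symmetric])
      qed
      finally show ?thesis .
    qed simp
  qed
  also have "\<dots> = ennreal (4 powr p * geom_const (p - 1)) * energy"
    by (rule nn_integral_cmult) measurable
  finally show ?thesis .
qed

text \<open>The core of Lerner's argument. The level condition reads \<open>thr\<close> |Q| \<le> c
  \<sigma>(Q). Raised to the power p - 1 and combined with v(Q) \<sigma>(Q)^(p - 1) \<le> a |Q|^p,
  it gives \<open>thr\<close>^(p - 1) v(Q) \<le> a c^(p - 1) |Q|, and c \<le> M on Q.\<close>

lemma thr_mass_maximal:
  assumes q: "q \<in> E"
  shows "ennreal (thr q powr (p - 1)) * V q \<le> cube_mass (\<lambda>x. ennreal (a * M x powr (p - 1))) q"
proof -
  let ?l = "ell q ^ CARD('n)"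
  have l: "0 < ?l" by simp
  have lp: "?l powr r = ell q powr (CARD('n) * r)" for r :: real
    by (simp add: powr_realpow[symmetric] powr_powr)
  obtain w where w: "V q = ennreal w" "0 \<le> w" using v_fin[of q] by (cases "V q") auto
  have "thr q * ?l \<le> I q"
    using thr_mass[of q] q E_props I_props[of q] by auto
  also have "I q = c q * S q" using S_props(1)[OF q] by (simp add: c_def)
  finally have "(thr q * ?l) powr (p - 1) \<le> (c q * S q) powr (p - 1)"
    using p thr_nonneg[of q] l by (intro powr_mono2) auto
  from mult_right_mono[OF this w(2)] have "thr q powr (p - 1) * ?l powr (p - 1) * w \<le> c q powr (p - 1) * (w * S q powr (p - 1))"
    using thr_nonneg[of q] c0[of q] S_props(1)[OF q] by (simp add: powr_mult mult_ac)
  also have "w * S q powr (p - 1) \<le> a * ?l powr p"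
    unfolding lp using S_props(4)[OF q] w a0 by (simp add: ennreal_mult[symmetric])
  then have "c q powr (p - 1) * (w * S q powr (p - 1)) \<le> c q powr (p - 1) * (a * ?l powr p)"
    by (intro mult_left_mono) auto
  also have "?l powr p = ?l powr (p - 1) * ?l"
    using powr_add[of ?l "p - 1" 1] l by simp
  finally have "?l powr (p - 1) * (thr q powr (p - 1) * w) \<le> ?l powr (p - 1) * (a * c q powr (p - 1) * ?l)"
    by (simp only: mult_ac)
  then have "thr q powr (p - 1) * w \<le> a * c q powr (p - 1) * ?l"
    using l by (subst (asm) mult_le_cancel_left_pos) auto
  then have "ennreal (thr q powr (p - 1)) * V q \<le> ennreal (a * c q powr (p - 1)) * ennreal ?l"
    using w a0 by (simp add: ennreal_mult[symmetric] ennreal_leI)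
  also have "\<dots> = cube_mass (\<lambda>x. ennreal (a * c q powr (p - 1))) q"
    unfolding cube_mass_def by (subst nn_integral_cmult_indicator) (auto simp: emeasure_sc)
  also have "\<dots> \<le> cube_mass (\<lambda>x. ennreal (a * M x powr (p - 1))) q"
    unfolding cube_mass_def
    using M_ge(2)[OF q] a0 p c0[of q]
    by (intro nn_integral_mono) (auto simp: indicator_def intro!: ennreal_leI mult_left_mono powr_mono2)
  finally show ?thesis .
qed

text \<open>Truncation compares \<open>thr\<close>^(p - 1) v with a M^(p - 1). At x only cubes with
  \<open>thr\<close> at most (2a)^(1/(p - 1)) M(x) \<sigma>(x) survive, and their heights sum to a
  multiple of that bound. What remains is the integral of M^p \<sigma>, which the energy
  controls.\<close>

lemma dual_bound:
  assumes \<beta>: "\<beta> \<noteq> 1 / p"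
  shows "(\<Sum>q\<in>F. ennreal (lam powr p * ell q powr (CARD('n) * (\<beta> * p - 1))) * V q)
    \<le> ennreal (2 * 2 powr (1 / (p - 1)) * C0 powr p * geom_const (\<bar>CARD('n) * (\<beta> - 1 / p)\<bar>) * (4 powr p * geom_const (p - 1)))
        * ennreal (a powr (p / (p - 1))) * energy"
proof -
  define K where "K = geom_const (\<bar>CARD('n) * (\<beta> - 1 / p)\<bar> * 1)"
  have K: "0 \<le> K" unfolding K_def using \<beta> by (intro less_imp_le geom_const_pos) simp
  let ?h = "\<lambda>x. a * M x powr (p - 1)"
  let ?k = "\<lambda>q x. ?h x * indicator {x. thr q powr (p - 1) * v x < 2 * ?h x} x"
  have [measurable]: "?k q \<in> borel_measurable lebesgue" for q
    unfolding indicator_def by measurable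
  \<comment> \<open>The exponent p/(p - 1) = 1 + 1/(p - 1) of the A_p constant: 1 comes from
    \<open>thr_mass_maximal\<close>, 1/(p - 1) from solving the truncation condition for
    \<open>thr\<close>.\<close>
  let ?A = "a * (2 * a) powr (1 / (p - 1))"
  let ?w = "\<lambda>q. ennreal (lam powr p * ell q powr (CARD('n) * (\<beta> * p - 1))) * V q"
  have "(\<Sum>q\<in>F. ?w q) = (\<Sum>q\<in>E. ?w q)"
    using fin by (intro sum.mono_neutral_right) (auto simp: E_def)
  also have "\<dots> \<le> (\<Sum>q\<in>E. ennreal (2 * C0 powr p) * cube_mass (\<lambda>x. ennreal (thr q) * ennreal (?k q x)) q)"
  proof (rule sum_mono)
    fix q assume q: "q \<in> E"
    have tp: "thr q powr p = thr q * thr q powr (p - 1)"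
      using powr_add[of "thr q" 1 "p - 1"] by simp
    have u: "ennreal (thr q powr (p - 1)) * V q = cube_mass (\<lambda>x. ennreal (thr q powr (p - 1) * v x)) q"
      using v0 by (subst cube_mass_cmult) (auto simp: ennreal_mult)
    have "cube_mass (\<lambda>x. ennreal (thr q powr (p - 1) * v x)) q \<le> 2 * cube_mass (\<lambda>x. ennreal (?k q x)) q"
    proof (rule cube_mass_truncate)
      show "cube_mass (\<lambda>x. ennreal (thr q powr (p - 1) * v x)) q \<le> cube_mass (\<lambda>x. ennreal (?h x)) q"
        unfolding u[symmetric] by (rule thr_mass_maximal[OF q])
      show "cube_mass (\<lambda>x. ennreal (thr q powr (p - 1) * v x)) q < top"
        unfolding u[symmetric] using v_fin[of q] by (simp add: ennreal_mult_less_top)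
    qed (use a0 v0 in auto)
    then have le: "ennreal (thr q powr (p - 1)) * V q \<le> 2 * cube_mass (\<lambda>x. ennreal (?k q x)) q"
      unfolding u .
    have "?w q = ennreal (C0 powr p * thr q) * (ennreal (thr q powr (p - 1)) * V q)"
      unfolding weight_eq_thr tp by (simp add: ennreal_mult mult_ac)
    also have "\<dots> \<le> ennreal (C0 powr p * thr q) * (2 * cube_mass (\<lambda>x. ennreal (?k q x)) q)"
      by (intro mult_left_mono le) simp
    also have "\<dots> = ennreal (2 * C0 powr p) * (ennreal (thr q) * cube_mass (\<lambda>x. ennreal (?k q x)) q)"
      by (simp add: ennreal_mult mult_ac)
    also have "ennreal (thr q) * cube_mass (\<lambda>x. ennreal (?k q x)) q = cube_mass (\<lambda>x. ennreal (thr q) * ennreal (?k q x)) q"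
      by (rule cube_mass_cmult) measurable
    finally show "?w q \<le> ennreal (2 * C0 powr p) * cube_mass (\<lambda>x. ennreal (thr q) * ennreal (?k q x)) q" .
  qed
  also have "\<dots> = ennreal (2 * C0 powr p) * (\<Sum>q\<in>E. cube_mass (\<lambda>x. ennreal (thr q) * ennreal (?k q x)) q)"
    by (simp add: sum_distrib_left)
  also have "\<dots> \<le> ennreal (2 * C0 powr p) * (ennreal (K * ?A) * (ennreal (4 powr p * geom_const (p - 1)) * energy))"
  proof (rule mult_left_mono)
    have "(\<Sum>q\<in>E. cube_mass (\<lambda>x. ennreal (thr q) * ennreal (?k q x)) q)
      \<le> (\<integral>\<^sup>+x. ennreal (K * ?A) * (ennreal (M x powr p * \<sigma> x) * indicator W x) \<partial>lebesgue)"
    proof (rule sum_cube_mass_le[OF E_props(1)])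
      show "AE x in lebesgue. (\<Sum>q\<in>{q\<in>E. x \<in> sc q}. ennreal (thr q) * ennreal (?k q x))
          \<le> ennreal (K * ?A) * (ennreal (M x powr p * \<sigma> x) * indicator W x)"
        using AE_W_pos
      proof eventually_elim
        case (elim x)
        show ?case
        proof (cases "x \<in> W")
          case False
          then have "{q\<in>E. x \<in> sc q} = {}" by (auto simp: W_def)
          then show ?thesis by (simp only: sum.empty zero_le)
        next
          case True
          with elim have vx: "0 < v x" by simp
          let ?Ex = "{q\<in>{q\<in>E. x \<in> sc q}. thr q powr (p - 1) * v x < 2 * ?h x}"
          define X where "X = (2 * ?h x / v x) powr (1 / (p - 1))"
          have "thr q \<le> X" if "q \<in> ?Ex" for q
          proof -
            have "thr q powr (p - 1) \<le> 2 * ?h x / v x" using that vx by (simp add: field_simps)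
            then have "(thr q powr (p - 1)) powr (1 / (p - 1)) \<le> X"
              unfolding X_def using p by (intro powr_mono2) auto
            then show ?thesis using p by (simp add: powr_powr)
          qed
          then have le: "(\<Sum>q\<in>?Ex. thr q powr 1) \<le> K * X powr 1"
            unfolding K_def using \<beta> E_props(2) by (intro sum_thr_le[of 1 _ x]) auto
          have hX: "?h x * X = ?A * (M x powr p * \<sigma> x)"
          proof -
            have "X = (2 * a) powr (1 / (p - 1)) * M x * \<sigma> x"
              using a0 M_ge(1)[of x] vx p
              by (simp add: X_def powr_mult powr_divide powr_powr \<sigma>_def dual_weight_def powr_minus_divide)
            moreover have "M x powr p = M x powr (p - 1) * M x"
              using powr_add[of "M x" "p - 1" 1] M_ge(1)[of x] by (cases "M x = 0") auto
            ultimately show ?thesis by (simp add: mult_ac)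
          qed
          have "(\<Sum>q\<in>{q\<in>E. x \<in> sc q}. ennreal (thr q) * ennreal (?k q x)) = (\<Sum>q\<in>?Ex. ennreal (thr q) * ennreal (?h x))"
            using E_props by (intro sum.mono_neutral_cong_right) (auto simp: indicator_def)
          also have "\<dots> = ennreal (\<Sum>q\<in>?Ex. thr q) * ennreal (?h x)"
            by (simp add: sum_distrib_right[symmetric] sum_ennreal)
          also have "\<dots> \<le> ennreal (K * X) * ennreal (?h x)"
            using le by (intro mult_right_mono ennreal_leI) (auto simp: X_def)
          also have "\<dots> = ennreal (K * (?h x * X))"
            using K a0 by (simp add: ennreal_mult[symmetric] X_def mult_ac)
          also have "\<dots> = ennreal (K * ?A) * (ennreal (M x powr p * \<sigma> x) * indicator W x)"
            unfolding hX using True K a0 \<sigma>0[of x] by (simp add: ennreal_mult[symmetric] mult_ac)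
          finally show ?thesis .
        qed
      qed
    qed measurable
    also have "\<dots> = ennreal (K * ?A) * (\<integral>\<^sup>+x. ennreal (M x powr p * \<sigma> x) * indicator W x \<partial>lebesgue)"
      by (rule nn_integral_cmult) measurable
    also have "\<dots> \<le> ennreal (K * ?A) * (ennreal (4 powr p * geom_const (p - 1)) * energy)"
      by (intro mult_left_mono maximal_strong_type) simp
    finally show "(\<Sum>q\<in>E. cube_mass (\<lambda>x. ennreal (thr q) * ennreal (?k q x)) q) \<le> \<dots>" .
  qed simp
  also have "\<dots> = ennreal (2 * 2 powr (1 / (p - 1)) * C0 powr p * K * (4 powr p * geom_const (p - 1)))
        * ennreal (a powr (p / (p - 1))) * energy"
  proof -
    have "p / (p - 1) = 1 + 1 / (p - 1)" using p by (simp add: field_simps)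
    then have "?A = 2 powr (1 / (p - 1)) * a powr (p / (p - 1))"
      using a0 by (cases "a = 0") (auto simp: powr_mult powr_add)
    moreover have "0 < geom_const (p - 1)" using p by (intro geom_const_pos) simp
    ultimately show ?thesis using K by (simp add: ennreal_mult[symmetric] mult.assoc[symmetric]) (simp add: mult_ac)
  qed
  finally show ?thesis unfolding K_def by simp
qed

end

section \<open>Oscillation through chains of subcubes\<close>

abbreviation cint :: "(real ^ 'n) set \<Rightarrow> (real ^ 'n \<Rightarrow> ennreal) \<Rightarrow> ennreal" where
  "cint X h \<equiv> \<integral>\<^sup>+x. h x * indicator X x \<partial>lebesgue"

definition child :: "real ^ 'n \<Rightarrow> real \<Rightarrow> 'n set \<Rightarrow> (real ^ 'n) set" where
  "child c r S = cb (c + (\<chi> i. if i \<in> S then r / 2 else 0)) (r / 2)"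

lemma mem_child: "x \<in> child c r S \<longleftrightarrow> (\<forall>i. if i \<in> S then c $ i + r / 2 < x $ i \<and> x $ i < c $ i + r else c $ i < x $ i \<and> x $ i < c $ i + r / 2)"
  unfolding child_def mem_cb by (intro all_cong1) auto

lemma child_subset: "0 < r \<Longrightarrow> child c r S \<subseteq> cb c r"
  by (auto simp: mem_child mem_cb split: if_splits) (smt (verit, best) field_sum_of_halves)+

lemma cb_lebesgue [measurable]: "cb a l \<in> sets lebesgue" "child c r S \<in> sets lebesgue"
  by (auto simp: child_def sets_completionI_sets)

lemma AE_sum_children:
  fixes c :: "real ^ 'n"
  assumes r: "0 < r"
  shows "AE x in lebesgue. (\<Sum>S\<in>UNIV. indicator (child c r S) x) = (indicator (cb c r) x :: ennreal)"
proof -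
  have "AE x in lebesgue. \<forall>i. x $ i \<noteq> c $ i + r / 2"
  proof (rule AE_all_countable[THEN iffD2], intro allI)
    fix i
    have "{x. x $ i = c $ i + r / 2} \<in> null_sets (lebesgue :: (real ^ 'n) measure)"
      using negligible_standard_hyperplane[of "axis i 1 :: real ^ 'n" "c $ i + r / 2"] negligible_iff_null_sets
      by (auto simp: inner_axis)
    then show "AE x in lebesgue. x $ i \<noteq> c $ i + r / 2"
      using AE_not_in by force
  qed
  then show ?thesis
  proof eventually_elim
    case (elim x)
    let ?T = "{i. c $ i + r / 2 < x $ i}"
    have uniq: "x \<in> child c r S \<longleftrightarrow> x \<in> cb c r \<and> S = ?T" for S
    proof
      assume x: "x \<in> child c r S"
      have "i \<in> S \<longleftrightarrow> i \<in> ?T" for i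
        using x[unfolded mem_child, rule_format, of i] by (auto split: if_splits)
      then show "x \<in> cb c r \<and> S = ?T" using x child_subset[OF r] by blast
    next
      assume x: "x \<in> cb c r \<and> S = ?T"
      have "if i \<in> S then c $ i + r / 2 < x $ i \<and> x $ i < c $ i + r else c $ i < x $ i \<and> x $ i < c $ i + r / 2" for i
        using x elim[rule_format, of i] by (auto simp: mem_cb not_less less_le)
      then show "x \<in> child c r S" unfolding mem_child by blast
    qed
    have "(\<Sum>S\<in>UNIV. indicator (child c r S) x) = (\<Sum>S\<in>UNIV. if S = ?T then indicator (cb c r) x else 0 :: ennreal)"
      by (intro sum.cong refl) (simp add: indicator_def uniq)
    then show ?case by simp
  qed
qed

lemma nn_integral_children:
  fixes c :: "real ^ 'n"
  assumes r: "0 < r" and [measurable]: "h \<in> borel_measurable lebesgue"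
  shows "(\<Sum>S\<in>UNIV. cint (child c r S) h) = cint (cb c r) h"
proof -
  have "(\<Sum>S\<in>UNIV. cint (child c r S) h) = (\<integral>\<^sup>+x. (\<Sum>S\<in>UNIV. h x * indicator (child c r S) x) \<partial>lebesgue)"
    by (rule nn_integral_sum[symmetric]) measurable
  also have "\<dots> = cint (cb c r) h"
    using AE_sum_children[OF r, of c]
    by (intro nn_integral_cong_AE, eventually_elim) (simp add: sum_distrib_left[symmetric])
  finally show ?thesis .
qed

text \<open>The exceptional sets together fill at most half of the cube; on the rest |m - m'| \<le>
  |f - m| + |f - m'| can be integrated.\<close>

lemma mean_difference_le:
  fixes f :: "real ^ 'n \<Rightarrow> real"
  assumes [measurable]: "f \<in> borel_measurable lebesgue" "N \<in> sets lebesgue" "N' \<in> sets lebesgue" and r: "0 < r"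
    and N: "2 * (emeasure lebesgue N + emeasure lebesgue N') \<le> ennreal (r ^ CARD('n))"
  shows "ennreal (r ^ CARD('n)) * ennreal \<bar>m - m'\<bar> \<le> 2 * (cint (cb c r - N) (\<lambda>x. ennreal \<bar>f x - m\<bar>) + cint (cb c r - N') (\<lambda>x. ennreal \<bar>f x - m'\<bar>))"
proof -
  let ?R = "cb c r" and ?G = "cb c r - (N \<union> N')" and ?l = "ennreal (r ^ CARD('n))" and ?d = "ennreal \<bar>m - m'\<bar>"
  have R: "emeasure lebesgue ?R = ?l" using r by (simp add: emeasure_cb)
  have "?l \<le> emeasure lebesgue (?G \<union> (N \<union> N'))"
    unfolding R[symmetric] by (intro emeasure_mono) auto
  also have "\<dots> \<le> emeasure lebesgue ?G + (emeasure lebesgue N + emeasure lebesgue N')"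
    by (intro order_trans[OF emeasure_subadditive] add_left_mono emeasure_subadditive) auto
  finally have "2 * ?l \<le> 2 * emeasure lebesgue ?G + 2 * (emeasure lebesgue N + emeasure lebesgue N')"
    unfolding distrib_left[symmetric] by (intro mult_left_mono) auto
  also have "\<dots> \<le> 2 * emeasure lebesgue ?G + ?l"
    by (intro add_left_mono N)
  finally have "?l + ?l \<le> ?l + 2 * emeasure lebesgue ?G"
    by (simp add: mult_2 add.commute)
  then have G: "?l \<le> 2 * emeasure lebesgue ?G"
    by (simp add: ennreal_add_left_cancel_le)
  have "?l * ?d \<le> 2 * emeasure lebesgue ?G * ?d"
    by (intro mult_right_mono G) simp
  also have "\<dots> = 2 * (\<integral>\<^sup>+x. ?d * indicator ?G x \<partial>lebesgue)"
    by (subst nn_integral_cmult_indicator) (auto simp: mult_ac)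
  also have "(\<integral>\<^sup>+x. ?d * indicator ?G x \<partial>lebesgue) \<le> (\<integral>\<^sup>+x. ennreal \<bar>f x - m\<bar> * indicator (?R - N) x + ennreal \<bar>f x - m'\<bar> * indicator (?R - N') x \<partial>lebesgue)"
  proof (rule nn_integral_mono)
    fix x
    have "?d \<le> ennreal (\<bar>f x - m\<bar> + \<bar>f x - m'\<bar>)" by (intro ennreal_leI) linarith
    then show "?d * indicator ?G x \<le> ennreal \<bar>f x - m\<bar> * indicator (?R - N) x + ennreal \<bar>f x - m'\<bar> * indicator (?R - N') x"
      by (auto simp: indicator_def)
  qed
  also have "\<dots> = cint (?R - N) (\<lambda>x. ennreal \<bar>f x - m\<bar>) + cint (?R - N') (\<lambda>x. ennreal \<bar>f x - m'\<bar>)"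
    by (rule nn_integral_add) measurable
  finally show ?thesis by (simp add: mult_left_mono)
qed

text \<open>w(x)/\<kappa> bounds the scales at which x counts: in a subcube of side r only the
  points with \<kappa> r < w(x) contribute to \<open>T\<close>. From the scale r0 downwards the
  exceptional sets are null, which ends the descent.\<close>

locale local_control =
  fixes f g w :: "real ^ 'n \<Rightarrow> real" and Q :: "(real ^ 'n) set" and K \<kappa> r0 :: real
  assumes f_meas [measurable]: "f \<in> borel_measurable lebesgue"
    and g_meas [measurable]: "g \<in> borel_measurable lebesgue" and g0: "\<And>x. 0 \<le> g x"
    and w_meas [measurable]: "w \<in> borel_measurable lebesgue" and w0: "\<And>x. 0 \<le> w x"
    and K0: "0 \<le> K" and \<kappa>0: "0 < \<kappa>"
begin

definition T :: "real ^ 'n \<Rightarrow> real \<Rightarrow> ennreal" where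
  "T c r = ennreal K * cint (cb c r) (\<lambda>x. ennreal (r * g x * indicator {x. \<kappa> * r < w x} x))"

text \<open>
  The median-like value \<open>m\<close> is controlled outside the exceptional set \<open>N\<close>, which is so small that
  the sets belonging to a cube and to one of its children cannot cover the child.
\<close>

definition good :: "real ^ 'n \<Rightarrow> real \<Rightarrow> real \<Rightarrow> (real ^ 'n) set \<Rightarrow> bool" where
  "good c r m N \<longleftrightarrow> N \<in> sets lebesgue \<and>
     2 * (1 + 2 ^ CARD('n)) * emeasure lebesgue N \<le> ennreal (r ^ CARD('n)) \<and>
     cint (cb c r - N) (\<lambda>x. ennreal \<bar>f x - m\<bar>) \<le> T c r \<and>
     (r \<le> r0 \<longrightarrow> emeasure lebesgue N = 0)"

text \<open>Dominates the sum of r 2^(-i) over all i with r 2^(-i) < w(x)/\<kappa>, so it can absorb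
  one term per halving.\<close>

definition \<psi> :: "real ^ 'n \<Rightarrow> real \<Rightarrow> real" where
  "\<psi> x r = 2 * min r (w x / \<kappa>)"

lemma \<psi>_meas [measurable]: "(\<lambda>x. \<psi> x r) \<in> borel_measurable lebesgue"
  unfolding \<psi>_def by measurable

lemma ind_meas [measurable]: "(\<lambda>x. indicator {x. \<kappa> * r < w x} x :: real) \<in> borel_measurable lebesgue"
  unfolding indicator_def by measurable

lemma \<psi>0: "0 \<le> r \<Longrightarrow> 0 \<le> \<psi> x r"
  using w0[of x] \<kappa>0 by (simp add: \<psi>_def)

lemma \<psi>_step: "0 < r \<Longrightarrow> \<psi> x (r / 2) + r * indicator {x. \<kappa> * r < w x} x \<le> \<psi> x r"
  using \<kappa>0 w0[of x] by (auto simp: \<psi>_def indicator_def min_def field_simps)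

text \<open>Induction on the number of halvings that bring the side down to r0. Passing from m to
  the value of a child costs 2 T of the child, which is why 2 T is part of the claim. It also costs
  twice the integral of |f - m| over the child off N; over all children this is at most 2 T of the
  parent. Together with the 2 T of the claim it makes 4 T, which the increment of \<psi> from r/2 to
  r absorbs.\<close>

lemma chain_bound:
  assumes ex: "\<And>c r. 0 < r \<Longrightarrow> cb c r \<subseteq> Q \<Longrightarrow> \<exists>m N. good c r m N"
  assumes "0 < r" "cb c r \<subseteq> Q" "good c r m N" "r / 2 ^ j \<le> r0"
  shows "cint (cb c r) (\<lambda>x. ennreal \<bar>f x - m\<bar>) + 2 * T c r \<le> ennreal (4 * K) * cint (cb c r) (\<lambda>x. ennreal (g x * \<psi> x r))"
  using assms(2-)
proof (induction j arbitrary: c r m N)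
  case 0
  then have N: "N \<in> sets lebesgue" "emeasure lebesgue N = 0" "cint (cb c r - N) (\<lambda>x. ennreal \<bar>f x - m\<bar>) \<le> T c r"
    by (auto simp: good_def)
  then have "N \<in> null_sets lebesgue" by (simp add: null_sets_def)
  then have "AE x in lebesgue. x \<notin> N" by (rule AE_not_in)
  then have "cint (cb c r) (\<lambda>x. ennreal \<bar>f x - m\<bar>) = cint (cb c r - N) (\<lambda>x. ennreal \<bar>f x - m\<bar>)"
    by (intro nn_integral_cong_AE, eventually_elim) (auto simp: indicator_def)
  with N have "cint (cb c r) (\<lambda>x. ennreal \<bar>f x - m\<bar>) + 2 * T c r \<le> T c r + 2 * T c r"
    by (intro add_right_mono) simp
  also have "\<dots> \<le> 4 * T c r"
  proof -
    have "T c r + 2 * T c r = (1 + 2) * T c r" by (simp only: distrib_right mult_1)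
    also have "\<dots> \<le> 4 * T c r" by (intro mult_right_mono) auto
    finally show ?thesis .
  qed
  also have "\<dots> = ennreal (4 * K) * cint (cb c r) (\<lambda>x. ennreal (r * g x * indicator {x. \<kappa> * r < w x} x))"
    using K0 by (simp add: T_def ennreal_mult mult_ac)
  also have "\<dots> \<le> ennreal (4 * K) * cint (cb c r) (\<lambda>x. ennreal (g x * \<psi> x r))"
  proof (intro mult_left_mono nn_integral_mono mult_right_mono ennreal_leI)
    fix x
    have "r * indicator {x. \<kappa> * r < w x} x \<le> \<psi> x r"
      using \<psi>_step[OF 0(1), of x] \<psi>0[of "r / 2" x] 0(1) by simp
    from mult_left_mono[OF this g0[of x]]
    show "r * g x * indicator {x. \<kappa> * r < w x} x \<le> g x * \<psi> x r" by (simp add: mult_ac)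
  qed simp_all
  finally show ?case .
next
  case (Suc j)
  let ?l = "ennreal ((r / 2) ^ CARD('n))"
  let ?cc = "\<lambda>S. c + (\<chi> i. if i \<in> S then r / 2 else 0)"
  have r: "0 < r" "0 < r / 2" using Suc.prems by auto
  have sub: "child c r S \<subseteq> Q" for S using child_subset[OF r(1)] Suc.prems by blast
  have "\<forall>S. \<exists>m N. good (?cc S) (r / 2) m N"
    using ex[OF r(2)] sub unfolding child_def by blast
  then obtain m' N' where good': "\<And>S. good (?cc S) (r / 2) (m' S) (N' S)" by metis
  have IH: "cint (child c r S) (\<lambda>x. ennreal \<bar>f x - m' S\<bar>) + 2 * T (?cc S) (r / 2) \<le> ennreal (4 * K) * cint (child c r S) (\<lambda>x. ennreal (g x * \<psi> x (r / 2)))" for S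
    using Suc.IH[OF r(2) _ good'[of S]] sub[of S] Suc.prems(4) unfolding child_def by (simp add: field_simps)
  have Nm: "N \<in> sets lebesgue" and N: "2 * (1 + 2 ^ CARD('n)) * emeasure lebesgue N \<le> ennreal (r ^ CARD('n))"
    and NT: "cint (cb c r - N) (\<lambda>x. ennreal \<bar>f x - m\<bar>) \<le> T c r"
    using Suc.prems(3) by (auto simp: good_def)
  have one: "cint (child c r S) (\<lambda>x. ennreal \<bar>f x - m\<bar>) \<le> ennreal (4 * K) * cint (child c r S) (\<lambda>x. ennreal (g x * \<psi> x (r / 2))) + 2 * cint (child c r S - N) (\<lambda>x. ennreal \<bar>f x - m\<bar>)" for S
  proof -
    have N'm: "N' S \<in> sets lebesgue" and N': "2 * (1 + 2 ^ CARD('n)) * emeasure lebesgue (N' S) \<le> ?l"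
      and NT': "cint (child c r S - N' S) (\<lambda>x. ennreal \<bar>f x - m' S\<bar>) \<le> T (?cc S) (r / 2)"
      using good'[of S] by (auto simp: good_def child_def)
    \<comment> \<open>N is measured against r^n, which is 2^n times the volume of the child; the
      factor 1 + 2^n in \<open>good\<close> pays for N and N' together.\<close>
    have small: "2 * (emeasure lebesgue N + emeasure lebesgue (N' S)) \<le> ?l"
    proof -
      let ?k = "1 + 2 ^ CARD('n) :: ennreal"
      have rl: "ennreal (r ^ CARD('n)) = 2 ^ CARD('n) * ?l"
      proof -
        have "ennreal (2 ^ CARD('n)) = 2 ^ CARD('n)"
          using ennreal_power[of 2 "CARD('n)"] by simp
        moreover have "r ^ CARD('n) = 2 ^ CARD('n) * (r / 2) ^ CARD('n)"
          by (simp add: power_divide)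
        ultimately show ?thesis
          using r by (simp only: ennreal_mult zero_le_power zero_le_numeral less_imp_le)
      qed
      have "?k * (2 * (emeasure lebesgue N + emeasure lebesgue (N' S))) = 2 * ?k * emeasure lebesgue N + 2 * ?k * emeasure lebesgue (N' S)"
        by (simp add: algebra_simps)
      also have "\<dots> \<le> 2 ^ CARD('n) * ?l + ?l"
        using N N' unfolding rl by (rule add_mono)
      also have "\<dots> = ?k * ?l" by (simp add: algebra_simps)
      finally have le: "?k * (2 * (emeasure lebesgue N + emeasure lebesgue (N' S))) \<le> ?k * ?l" .
      have "(2::ennreal) ^ CARD('n) < top" by (simp add: power_less_top_ennreal)
      then have "?k \<noteq> 0" "?k < top" by auto
      with le show ?thesis
        by (subst (asm) ennreal_mult_le_mult_iff) auto
    qed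
    have "cint (child c r S) (\<lambda>x. ennreal \<bar>f x - m\<bar>) \<le> (\<integral>\<^sup>+x. ennreal \<bar>f x - m' S\<bar> * indicator (child c r S) x + ennreal \<bar>m - m' S\<bar> * indicator (child c r S) x \<partial>lebesgue)"
    proof (rule nn_integral_mono)
      fix x
      have "ennreal \<bar>f x - m\<bar> \<le> ennreal (\<bar>f x - m' S\<bar> + \<bar>m - m' S\<bar>)" by (intro ennreal_leI) linarith
      then show "ennreal \<bar>f x - m\<bar> * indicator (child c r S) x \<le> ennreal \<bar>f x - m' S\<bar> * indicator (child c r S) x + ennreal \<bar>m - m' S\<bar> * indicator (child c r S) x"
        by (auto simp: indicator_def)
    qed
    also have "\<dots> = cint (child c r S) (\<lambda>x. ennreal \<bar>f x - m' S\<bar>) + ?l * ennreal \<bar>m - m' S\<bar>"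
      using r by (subst nn_integral_add) (auto simp: nn_integral_cmult_indicator child_def emeasure_cb mult.commute)
    also have "\<dots> \<le> cint (child c r S) (\<lambda>x. ennreal \<bar>f x - m' S\<bar>) + 2 * (cint (child c r S - N) (\<lambda>x. ennreal \<bar>f x - m\<bar>) + T (?cc S) (r / 2))"
      using mean_difference_le[OF f_meas Nm N'm r(2) small, of m "m' S" "?cc S"] NT'
      unfolding child_def by (intro add_left_mono) (meson add_left_mono mult_left_mono order_trans zero_le)
    also have "\<dots> = (cint (child c r S) (\<lambda>x. ennreal \<bar>f x - m' S\<bar>) + 2 * T (?cc S) (r / 2)) + 2 * cint (child c r S - N) (\<lambda>x. ennreal \<bar>f x - m\<bar>)"
      by (simp add: distrib_left add_ac)
    also have "\<dots> \<le> ennreal (4 * K) * cint (child c r S) (\<lambda>x. ennreal (g x * \<psi> x (r / 2))) + 2 * cint (child c r S - N) (\<lambda>x. ennreal \<bar>f x - m\<bar>)"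
      by (intro add_right_mono IH)
    finally show ?thesis .
  qed
  have cN: "cint (X - N) h = cint X (\<lambda>x. h x * indicator (- N) x)" for X and h :: "real ^ 'n \<Rightarrow> ennreal"
    by (intro nn_integral_cong) (auto simp: indicator_def)
  have "cint (cb c r) (\<lambda>x. ennreal \<bar>f x - m\<bar>) = (\<Sum>S\<in>UNIV. cint (child c r S) (\<lambda>x. ennreal \<bar>f x - m\<bar>))"
    by (rule nn_integral_children[OF r(1), symmetric]) measurable
  also have "\<dots> \<le> (\<Sum>S\<in>UNIV. ennreal (4 * K) * cint (child c r S) (\<lambda>x. ennreal (g x * \<psi> x (r / 2))) + 2 * cint (child c r S - N) (\<lambda>x. ennreal \<bar>f x - m\<bar>))"
    by (intro sum_mono one)
  also have "\<dots> = ennreal (4 * K) * (\<Sum>S\<in>UNIV. cint (child c r S) (\<lambda>x. ennreal (g x * \<psi> x (r / 2)))) + 2 * (\<Sum>S\<in>UNIV. cint (child c r S - N) (\<lambda>x. ennreal \<bar>f x - m\<bar>))"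
    by (simp add: sum.distrib sum_distrib_left)
  also have "(\<Sum>S\<in>UNIV. cint (child c r S) (\<lambda>x. ennreal (g x * \<psi> x (r / 2)))) = cint (cb c r) (\<lambda>x. ennreal (g x * \<psi> x (r / 2)))"
    by (rule nn_integral_children[OF r(1)]) measurable
  also have "(\<Sum>S\<in>UNIV. cint (child c r S - N) (\<lambda>x. ennreal \<bar>f x - m\<bar>)) = cint (cb c r - N) (\<lambda>x. ennreal \<bar>f x - m\<bar>)"
  proof -
    have [measurable]: "N \<in> sets lebesgue" by (rule Nm)
    show ?thesis unfolding cN by (rule nn_integral_children[OF r(1)]) measurable
  qed
  finally have 1: "cint (cb c r) (\<lambda>x. ennreal \<bar>f x - m\<bar>) \<le> ennreal (4 * K) * cint (cb c r) (\<lambda>x. ennreal (g x * \<psi> x (r / 2))) + 2 * cint (cb c r - N) (\<lambda>x. ennreal \<bar>f x - m\<bar>)" .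
  have "cint (cb c r) (\<lambda>x. ennreal \<bar>f x - m\<bar>) + 2 * T c r \<le> (ennreal (4 * K) * cint (cb c r) (\<lambda>x. ennreal (g x * \<psi> x (r / 2))) + 2 * T c r) + 2 * T c r"
    by (intro add_right_mono order_trans[OF 1] add_left_mono mult_left_mono NT) simp
  also have "\<dots> = ennreal (4 * K) * cint (cb c r) (\<lambda>x. ennreal (g x * \<psi> x (r / 2))) + 4 * T c r"
    by (simp add: add.assoc distrib_right[symmetric])
  also have "4 * T c r = ennreal (4 * K) * cint (cb c r) (\<lambda>x. ennreal (r * g x * indicator {x. \<kappa> * r < w x} x))"
    using K0 by (simp add: T_def ennreal_mult mult_ac)
  also have "ennreal (4 * K) * cint (cb c r) (\<lambda>x. ennreal (g x * \<psi> x (r / 2))) + ennreal (4 * K) * cint (cb c r) (\<lambda>x. ennreal (r * g x * indicator {x. \<kappa> * r < w x} x))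
     = ennreal (4 * K) * (\<integral>\<^sup>+x. ennreal (g x * \<psi> x (r / 2)) * indicator (cb c r) x + ennreal (r * g x * indicator {x. \<kappa> * r < w x} x) * indicator (cb c r) x \<partial>lebesgue)"
    by (subst nn_integral_add) (auto simp: distrib_left)
  also have "\<dots> \<le> ennreal (4 * K) * cint (cb c r) (\<lambda>x. ennreal (g x * \<psi> x r))"
  proof (intro mult_left_mono nn_integral_mono)
    fix x
    from mult_left_mono[OF \<psi>_step[OF r(1), of x] g0[of x]]
    have "ennreal (g x * \<psi> x (r / 2) + r * g x * indicator {x. \<kappa> * r < w x} x) \<le> ennreal (g x * \<psi> x r)"
      by (intro ennreal_leI) (simp add: algebra_simps)
    then show "ennreal (g x * \<psi> x (r / 2)) * indicator (cb c r) x + ennreal (r * g x * indicator {x. \<kappa> * r < w x} x) * indicator (cb c r) x \<le> ennreal (g x * \<psi> x r) * indicator (cb c r) x"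
      using g0[of x] \<psi>0[of "r / 2" x] r by (auto simp: indicator_def)
  qed simp
  finally show ?case .
qed

end

text \<open>The edge length of the smallest cube of \<open>F\<close> containing \<open>x\<close>; outside \<open>\<Union>F\<close> the value is irrelevant.\<close>

definition rho :: "(int \<times> (real ^ 'n)) set \<Rightarrow> real ^ 'n \<Rightarrow> real" where
  "rho F x = Min ((\<lambda>r. if x \<in> sc r then ell r else Max (ell ` F)) ` F)"

lemma rho_meas [measurable]: "finite F \<Longrightarrow> rho F \<in> borel_measurable lebesgue"
  unfolding rho_def[abs_def] by (intro borel_measurable_Min) measurable

lemma rho_le:
  assumes "finite F" "q \<in> F" "x \<in> sc q"
  shows "rho F x \<le> ell q"
  unfolding rho_def using assms by (intro Min_le) (auto simp: image_iff intro!: bexI[of _ q])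

lemma rho_attained:
  assumes F: "finite F" "q \<in> F" "x \<in> sc q"
  obtains r where "r \<in> F" "x \<in> sc r" "rho F x = ell r"
proof -
  have "rho F x \<in> (\<lambda>r. if x \<in> sc r then ell r else Max (ell ` F)) ` F"
    unfolding rho_def using F by (intro Min_in) auto
  then obtain r where r: "r \<in> F" "rho F x = (if x \<in> sc r then ell r else Max (ell ` F))" by blast
  show thesis
  proof (cases "x \<in> sc r")
    case True
    then show ?thesis using r that by simp
  next
    \<comment> \<open>The default value is never below an edge length of F, so if it is the minimum,
      q attains the minimum as well.\<close>
    case False
    then have "rho F x = Max (ell ` F)" using r by simp
    moreover have "ell q \<le> Max (ell ` F)" using F by (intro Max_ge) auto
    ultimately have "rho F x = ell q" using rho_le[OF F] by simp
    then show ?thesis using F that by blast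
  qed
qed

text \<open>Chosen so that 3 * 2^n * n times it is 1/(2 (1 + 2^n)): if the tubes over the holes have
  total volume at most \<open>kap n\<close> r^n in each direction, the exceptional set stays within
  the limit of \<open>good\<close>.\<close>

definition kap :: "nat \<Rightarrow> real" where
  "kap n = 1 / (6 * 2 ^ n * n * (1 + 2 ^ n))"

lemma kap_bounds: "0 < n \<Longrightarrow> 0 < kap n" "0 < n \<Longrightarrow> kap n < 1"
proof -
  assume n: "0 < n"
  show "0 < kap n" using n by (simp add: kap_def add_pos_pos)
  have "1 \<le> (2::real) ^ n" by simp
  then have "1 * 1 * 1 * 1 < (6::real) * 2 ^ n * n * (1 + 2 ^ n)"
    using n by (intro mult_less_le_imp_less mult_mono) (auto intro!: mult_pos_pos)
  then show "kap n < 1" unfolding kap_def by (subst divide_less_eq_1_pos; linarith)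
qed

lemma ennreal_mult3:
  "0 \<le> x \<Longrightarrow> 0 \<le> y \<Longrightarrow> 0 \<le> z \<Longrightarrow> ennreal x * (ennreal y * (ennreal z * X)) = ennreal (x * y * z) * X"
  by (simp add: ennreal_mult mult.assoc)

lemma ell_le_iff: "ell p \<le> ell q \<longleftrightarrow> fst p \<le> fst q"
  by (simp add: ell_def)

text \<open>In a subcube of side r the cubes with edge at most t = l(q) (\<kappa> r/l(q))^(1/a) are
  removed as holes. Sparseness bounds the sum of their l^(n - 1) by t^(n - 1 - s) l(q)^s = l(q)^(n -
  1) (\<kappa> r/l(q))^(n - 1); the value of a makes these exponents match. A point that is left has
  rho > t, i.e. w > \<kappa> r with w = l(q) (rho/l(q))^a, which is what \<open>chain_bound\<close>
  asks for.\<close>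

lemma sparse_oscillation:
  fixes f :: "real ^ 'n \<Rightarrow> real" and s :: real
  assumes f: "locally_integrable f" and G: "has_weak_gradient f G"
    and n: "2 \<le> CARD('n)" and F: "finite F" "laminar F" "q \<in> F"
    and s: "s < CARD('n) - 1"
    and sparse: "(\<Sum>r\<in>{r\<in>F. sc r \<subseteq> sc q \<and> r \<noteq> q}. ell r powr s) \<le> ell q powr s"
    and Q: "sc q \<subseteq> Q" "Q \<subseteq> cbox (snd q) (snd q + vec (ell q))"
  defines "a \<equiv> (CARD('n) - 1 - s) / (CARD('n) - 1)"
  shows "ennreal (oscillation Q f) \<le> ennreal (16 * poincare_const CARD('n) / kap CARD('n)) *
    cint (sc q) (\<lambda>x. ennreal (norm (G x) * (rho F x / ell q) powr a))"
proof -
  let ?n = "CARD('n)" and ?l = "ell q"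
  define K where "K = poincare_const ?n"
  define \<kappa> where "\<kappa> = kap ?n"
  \<comment> \<open>Below every edge length of F. For r \<le> r0 the hole size t is at most
    \<delta>, so nothing is removed and N is a null set.\<close>
  define \<delta> where "\<delta> = Min (ell ` F) / 2"
  define r0 where "r0 = ?l / \<kappa> * (\<delta> / ?l) powr a"
  define w where "w = (\<lambda>x. ?l * (rho F x / ?l) powr a)"
  define g where "g = (\<lambda>x. norm (G x))"
  have n1: "0 < real ?n - 1" using n by simp
  have a: "0 < a" using s n1 by (simp add: a_def)
  have \<kappa>: "0 < \<kappa>" "\<kappa> < 1" using kap_bounds[of ?n] by (auto simp: \<kappa>_def)
  have K: "0 \<le> K" by (simp add: K_def poincare_const_def)
  have "Min (ell ` F) \<in> ell ` F" using F by (intro Min_in) auto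
  then have \<delta>: "0 < \<delta>" by (auto simp: \<delta>_def)
  have \<delta>_less: "\<delta> < ell r" if "r \<in> F" for r
  proof -
    have "Min (ell ` F) \<le> ell r" using F that by (intro Min_le) auto
    then show ?thesis using \<delta> by (simp add: \<delta>_def)
  qed
  have r0: "0 < r0" using \<delta> \<kappa> by (simp add: r0_def)
  have [measurable]: "G \<in> borel_measurable lebesgue"
    using G by (auto simp: has_weak_gradient_def intro: locally_integrable_measurable)
  have [measurable]: "rho F \<in> borel_measurable lebesgue" by (rule rho_meas[OF F(1)])
  interpret local_control f g w "sc q" K \<kappa> r0
  proof
    show "f \<in> borel_measurable lebesgue" using f by (rule locally_integrable_measurable)
    show "g \<in> borel_measurable lebesgue" unfolding g_def by measurable
    show "w \<in> borel_measurable lebesgue" unfolding w_def by measurable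
  qed (use K \<kappa> in \<open>auto simp: g_def w_def\<close>)
  have ex: "\<exists>m N. good c r m N" if r: "0 < r" and sub: "cb c r \<subseteq> sc q" for c r
  proof -
    have rl: "r \<le> ?l"
      using cb_subset_imp[OF r sub[unfolded sc_def], of undefined] by linarith
    define t where "t = ?l * (\<kappa> * r / ?l) powr (1 / a)"
    have t: "0 < t" using r \<kappa> by (simp add: t_def)
    have ta: "?l * (t / ?l) powr a = \<kappa> * r"
      using r \<kappa> a by (simp add: t_def powr_powr)
    let ?P = "{r'\<in>F. sc r' \<subseteq> sc q \<and> r' \<noteq> q}"
    let ?H = "{r'\<in>?P. ell r' \<le> t}"
    define \<P> where "\<P> = (\<lambda>r'. (snd r', ell r')) ` ?H"
    have fin: "finite \<P>" using F by (simp add: \<P>_def)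
    have U: "(\<Union>(a, l)\<in>\<P>. cb a l) = (\<Union>r'\<in>?H. sc r')"
      by (auto simp: \<P>_def sc_def)
    have pos: "0 < l" if "(a, l) \<in> \<P>" for a l using that by (auto simp: \<P>_def)
    obtain m N where N: "N \<in> sets borel"
      "emeasure lborel N \<le> ennreal (3 * 2 ^ ?n * ?n * (\<Sum>(a, l)\<in>\<P>. r * l ^ (?n - 1)))"
      "(\<integral>\<^sup>+y. ennreal \<bar>f y - m\<bar> * indicator (cb c r - N) y \<partial>lebesgue)
      \<le> ennreal (6 * 2 ^ ?n * ?n * r) * (\<integral>\<^sup>+z. ennreal (norm (G z)) * indicator (cb c r - (\<Union>(a, l)\<in>\<P>. cb a l)) z \<partial>lebesgue)"
    proof -
      note * = weak_gradient_poincare_with_holes[where \<P>=\<P> and r=r and c=c, OF f G fin _ r]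
      show thesis
        by (rule exE[OF *]) (use pos that in blast)+
    qed
    have "(\<Sum>(a, l)\<in>\<P>. r * l ^ (?n - 1)) \<le> (\<Sum>r'\<in>?H. r * ell r' ^ (?n - 1))"
      unfolding \<P>_def using F r by (intro order_trans[OF sum_image_le]) auto
    also have "\<dots> \<le> (\<Sum>r'\<in>?H. r * (ell r' powr s * t powr (?n - 1 - s)))"
    proof (intro sum_mono mult_left_mono)
      fix r' assume r': "r' \<in> ?H"
      have "ell r' ^ (?n - 1) = ell r' powr s * ell r' powr (?n - 1 - s)"
        using n by (simp add: powr_add[symmetric] powr_realpow[symmetric] of_nat_diff)
      also have "\<dots> \<le> ell r' powr s * t powr (?n - 1 - s)"
        using r' s by (intro mult_left_mono powr_mono2) auto
      finally show "ell r' ^ (?n - 1) \<le> ell r' powr s * t powr (?n - 1 - s)" .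
    qed (use r in simp)
    also have "\<dots> = r * t powr (?n - 1 - s) * (\<Sum>r'\<in>?H. ell r' powr s)"
      by (simp add: sum_distrib_left mult_ac)
    also have "\<dots> \<le> r * t powr (?n - 1 - s) * ?l powr s"
      using F r by (intro mult_left_mono order_trans[OF sum_mono2 sparse]) auto
    also have "t powr (?n - 1 - s) = ?l powr (?n - 1 - s) * (\<kappa> * r / ?l) powr (?n - 1)"
    proof -
      have "1 / a * (?n - 1 - s) = ?n - 1" using s n1 by (simp add: a_def)
      then show ?thesis
        using r \<kappa> by (simp add: t_def powr_mult powr_powr)
    qed
    also have "r * (?l powr (?n - 1 - s) * (\<kappa> * r / ?l) powr (?n - 1)) * ?l powr s = r * (?l powr (?n - 1) * (\<kappa> * r / ?l) powr (?n - 1))"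
      by (simp add: powr_diff)
    also have "?l powr (?n - 1) * (\<kappa> * r / ?l) powr (?n - 1) = (\<kappa> * r) powr (?n - 1)"
      using r \<kappa> by (simp add: powr_mult[symmetric])
    also have "r * (\<kappa> * r) powr (?n - 1) \<le> \<kappa> * r ^ ?n"
    proof -
      \<comment> \<open>The exponent n - 1 is at least 1, since n \<ge> 2, and \<kappa> < 1.\<close>
      have "\<kappa> powr (?n - 1) \<le> \<kappa> powr 1" using \<kappa> n by (intro powr_mono') auto
      moreover have "r * r powr (?n - 1) = r ^ ?n"
        using r by (simp add: powr_diff powr_realpow)
      ultimately have "\<kappa> powr (?n - 1) * (r * r powr (?n - 1)) \<le> \<kappa> * r ^ ?n"
        using r \<kappa> by (simp add: mult_right_mono)
      then show ?thesis using r \<kappa> by (simp add: powr_mult mult_ac)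
    qed
    finally have holes: "(\<Sum>(a, l)\<in>\<P>. r * l ^ (?n - 1)) \<le> \<kappa> * r ^ ?n" .
    have "2 * (1 + 2 ^ ?n) * emeasure lebesgue N \<le> ennreal (2 * (1 + 2 ^ ?n)) * ennreal (3 * 2 ^ ?n * ?n * (\<kappa> * r ^ ?n))"
    proof (rule mult_mono)
      have "ennreal (2 ^ ?n) = 2 ^ ?n" using ennreal_power[of 2 ?n] by simp
      then show "2 * (1 + 2 ^ ?n) \<le> ennreal (2 * (1 + 2 ^ ?n))"
        by (simp add: ennreal_mult ennreal_plus)
      show "emeasure lebesgue N \<le> ennreal (3 * 2 ^ ?n * ?n * (\<kappa> * r ^ ?n))"
      proof -
        have "emeasure lborel N \<le> ennreal (3 * 2 ^ ?n * ?n * (\<kappa> * r ^ ?n))"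
          by (rule order_trans[OF N(2)]) (intro ennreal_leI mult_left_mono holes; simp)
        then show ?thesis using N(1) by simp
      qed
    qed simp_all
    also have "\<dots> = ennreal (r ^ ?n)"
    proof -
      define d :: real where "d = 6 * 2 ^ ?n * ?n * (1 + 2 ^ ?n)"
      have "\<kappa> = 1 / d" by (simp add: \<kappa>_def kap_def d_def algebra_simps)
      moreover have "2 * (1 + 2 ^ ?n) * (3 * 2 ^ ?n * ?n * (\<kappa> * r ^ ?n)) = d * \<kappa> * r ^ ?n"
      proof -
        have "2 * (1 + y) * (3 * y * k * (z * R)) = 6 * y * k * (1 + y) * z * R" for y k z R :: real
          by algebra
        then show ?thesis
          unfolding d_def of_nat_mult of_nat_power of_nat_numeral of_nat_add of_nat_1 .
      qed
      ultimately have E: "2 * (1 + 2 ^ ?n) * (3 * 2 ^ ?n * ?n * (\<kappa> * r ^ ?n)) = r ^ ?n"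
        using \<kappa> by auto
      have "ennreal (2 * (1 + 2 ^ ?n)) * ennreal (3 * 2 ^ ?n * ?n * (\<kappa> * r ^ ?n)) = ennreal (2 * (1 + 2 ^ ?n) * (3 * 2 ^ ?n * ?n * (\<kappa> * r ^ ?n)))"
        by (rule ennreal_mult[symmetric]) (use r \<kappa> in simp_all)
      then show ?thesis unfolding E .
    qed
    finally have N2: "2 * (1 + 2 ^ ?n) * emeasure lebesgue N \<le> ennreal (r ^ ?n)" .
    have w_big: "\<kappa> * r < w x" if x: "x \<in> cb c r - (\<Union>r'\<in>?H. sc r')" for x
    proof -
      have xq: "x \<in> sc q" using x sub by blast
      obtain r' where r': "r' \<in> F" "x \<in> sc r'" "rho F x = ell r'"
        using rho_attained[OF F(1,3) xq] by blast
      have "ell r' \<le> ?l" using rho_le[OF F(1,3) xq] r' by simp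
      then have "sc r' \<subseteq> sc q"
        using laminar_nested[OF F(2) r'(1) F(3) r'(2) xq] by (simp add: ell_le_iff)
      have "t < ell r'"
      proof (cases "r' = q")
        case True
        \<comment> \<open>The cube q itself exceeds the hole size: \<kappa> < 1 keeps t below its
          edge length.\<close>
        have "\<kappa> * r < ?l" using \<kappa> rl r by (smt (verit) mult_less_cancel_right2)
        then have "(\<kappa> * r / ?l) powr (1 / a) < 1 powr (1 / a)"
          using r \<kappa> a by (intro powr_less_mono2) auto
        then have "?l * (\<kappa> * r / ?l) powr (1 / a) < ?l * 1"
          by (intro mult_strict_left_mono) auto
        then show ?thesis using True by (simp add: t_def)
      next
        case False
        show ?thesis
        proof (rule ccontr)
          assume "\<not> t < ell r'"
          then have "r' \<in> ?H" using r'(1) False \<open>sc r' \<subseteq> sc q\<close> by simp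
          then show False using x r'(2) by blast
        qed
      qed
      then have "(t / ?l) powr a < (ell r' / ?l) powr a"
        using t a by (intro powr_less_mono2) (auto simp: divide_strict_right_mono)
      then have "?l * (t / ?l) powr a < ?l * (ell r' / ?l) powr a"
        by (intro mult_strict_left_mono) auto
      then show ?thesis unfolding ta w_def r'(3) .
    qed
    have "ennreal (6 * 2 ^ ?n * ?n * r) * (\<integral>\<^sup>+z. ennreal (norm (G z)) * indicator (cb c r - (\<Union>(a, l)\<in>\<P>. cb a l)) z \<partial>lebesgue)
       = ennreal K * (\<integral>\<^sup>+z. ennreal r * (ennreal (norm (G z)) * indicator (cb c r - (\<Union>(a, l)\<in>\<P>. cb a l)) z) \<partial>lebesgue)"
    proof -
      have [measurable]: "(\<Union>(a, l)\<in>\<P>. cb a l) \<in> sets lebesgue"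
        using fin by (intro sets.finite_UN) auto
      have "(\<integral>\<^sup>+z. ennreal r * (ennreal (norm (G z)) * indicator (cb c r - (\<Union>(a, l)\<in>\<P>. cb a l)) z) \<partial>lebesgue)
        = ennreal r * (\<integral>\<^sup>+z. ennreal (norm (G z)) * indicator (cb c r - (\<Union>(a, l)\<in>\<P>. cb a l)) z \<partial>lebesgue)"
        by (rule nn_integral_cmult) measurable
      moreover have "ennreal (6 * 2 ^ ?n * ?n * r) = ennreal K * ennreal r"
        using r by (simp add: K_def poincare_const_def ennreal_mult[symmetric])
      ultimately show ?thesis by (simp only: mult.assoc)
    qed
    also have "\<dots> \<le> T c r"
      unfolding T_def U
      using w_big r by (intro mult_left_mono nn_integral_mono) (auto simp: indicator_def g_def ennreal_mult)
    finally have T: "cint (cb c r - N) (\<lambda>y. ennreal \<bar>f y - m\<bar>) \<le> T c r"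
      using N(3) by (rule order_trans[rotated])
    have null: "emeasure lebesgue N = 0" if "r \<le> r0"
    proof -
      have "\<kappa> * r / ?l \<le> (\<delta> / ?l) powr a"
        using that \<kappa> by (simp add: r0_def field_simps)
      then have "(\<kappa> * r / ?l) powr (1 / a) \<le> ((\<delta> / ?l) powr a) powr (1 / a)"
        using r \<kappa> a by (intro powr_mono2) auto
      also have "\<dots> = \<delta> / ?l" using a \<delta> by (simp add: powr_powr)
      finally have "t \<le> \<delta>" unfolding t_def by (simp add: field_simps)
      then have "?H = {}" using \<delta>_less by force
      then have "\<P> = {}" unfolding \<P>_def by simp
      then show ?thesis using N(1,2) by simp
    qed
    show ?thesis
      unfolding good_def
      using N(1) N2 T null by (intro exI[of _ m] exI[of _ N]) (auto simp: sets_completionI_sets)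
  qed
  obtain m N where mN: "good (snd q) ?l m N"
    using ex[of ?l "snd q"] by (auto simp: sc_def)
  obtain j where "(1 / 2) ^ j < r0 / ?l"
    using real_arch_pow_inv[of "r0 / ?l" "1 / 2"] r0 by auto
  then have j: "?l / 2 ^ j \<le> r0"
    by (simp add: power_divide field_simps)
  have "cint (sc q) (\<lambda>x. ennreal \<bar>f x - m\<bar>) \<le> cint (sc q) (\<lambda>x. ennreal \<bar>f x - m\<bar>) + 2 * T (snd q) ?l"
    by simp
  also have "\<dots> \<le> ennreal (4 * K) * cint (sc q) (\<lambda>x. ennreal (g x * \<psi> x ?l))"
    using chain_bound[OF ex _ _ mN j] unfolding sc_def by simp
  also have "\<dots> \<le> ennreal (4 * K) * (\<integral>\<^sup>+x. ennreal (2 * ?l / \<kappa>) * (ennreal (norm (G x) * (rho F x / ?l) powr a) * indicator (sc q) x) \<partial>lebesgue)"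
  proof (intro mult_left_mono nn_integral_mono)
    fix x
    have "g x * \<psi> x ?l \<le> g x * (2 * (w x / \<kappa>))"
      by (intro mult_left_mono) (auto simp: \<psi>_def g_def)
    also have "\<dots> = 2 * ?l / \<kappa> * (norm (G x) * (rho F x / ?l) powr a)"
      by (simp add: w_def g_def)
    finally show "ennreal (g x * \<psi> x ?l) * indicator (sc q) x \<le> ennreal (2 * ?l / \<kappa>) * (ennreal (norm (G x) * (rho F x / ?l) powr a) * indicator (sc q) x)"
      using \<kappa> by (auto simp: indicator_def ennreal_mult[symmetric] intro!: ennreal_leI)
  qed simp
  also have "(\<integral>\<^sup>+x. ennreal (2 * ?l / \<kappa>) * (ennreal (norm (G x) * (rho F x / ?l) powr a) * indicator (sc q) x) \<partial>lebesgue)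
      = ennreal (2 * ?l / \<kappa>) * cint (sc q) (\<lambda>x. ennreal (norm (G x) * (rho F x / ?l) powr a))"
    by (rule nn_integral_cmult) measurable
  finally have fm: "cint (sc q) (\<lambda>x. ennreal \<bar>f x - m\<bar>) \<le> ennreal (4 * K) * (ennreal (2 * ?l / \<kappa>) * cint (sc q) (\<lambda>x. ennreal (norm (G x) * (rho F x / ?l) powr a)))" .
  have "ennreal (oscillation Q f) \<le> ennreal (2 / ?l) * cint (sc q) (\<lambda>x. ennreal \<bar>f x - m\<bar>)"
    using oscillation_le_mean_deviation[OF f_meas ell_pos(1) Q[unfolded sc_def]] by (simp add: sc_def)
  also have "\<dots> \<le> ennreal (2 / ?l) * (ennreal (4 * K) * (ennreal (2 * ?l / \<kappa>) * cint (sc q) (\<lambda>x. ennreal (norm (G x) * (rho F x / ?l) powr a))))"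
    by (intro mult_left_mono fm) simp
  also have "\<dots> = ennreal (2 / ?l * (4 * K) * (2 * ?l / \<kappa>)) * cint (sc q) (\<lambda>x. ennreal (norm (G x) * (rho F x / ?l) powr a))"
    by (rule ennreal_mult3) (use K \<kappa> in simp_all)
  \<comment> \<open>2/l comes from \<open>oscillation_le_mean_deviation\<close>, 4 K from the chain,
    2 l/\<kappa> from \<psi> \<le> 2 w/\<kappa>.\<close>
  also have "2 / ?l * (4 * K) * (2 * ?l / \<kappa>) = 16 * poincare_const ?n / kap ?n"
    by (simp add: K_def \<kappa>_def)
  finally show ?thesis .
qed

section \<open>Sparse subfamilies\<close>

text \<open>A cube is kept if the cubes already kept inside it do not outweigh it. As sizes
  increase, a later cube is never inside an earlier one, so the sums formed before remain
  valid.\<close>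

lemma sparse_selection:
  fixes s :: real
  assumes "finite F"
  shows "\<exists>E\<subseteq>F. (\<forall>q\<in>E. (\<Sum>r\<in>{r\<in>E. sc r \<subseteq> sc q \<and> r \<noteq> q}. ell r powr s) \<le> ell q powr s) \<and>
    (\<forall>q\<in>F - E. ell q powr s \<le> (\<Sum>r\<in>{r\<in>E. sc r \<subseteq> sc q \<and> r \<noteq> q}. ell r powr s))"
  using assms
proof (induction F rule: finite_ranking_induct[where f=fst])
  case empty
  then show ?case by simp
next
  case (insert q F)
  then obtain E where E: "E \<subseteq> F" "\<And>p. p \<in> E \<Longrightarrow> (\<Sum>r\<in>{r\<in>E. sc r \<subseteq> sc p \<and> r \<noteq> p}. ell r powr s) \<le> ell p powr s"
    "\<And>p. p \<in> F - E \<Longrightarrow> ell p powr s \<le> (\<Sum>r\<in>{r\<in>E. sc r \<subseteq> sc p \<and> r \<noteq> p}. ell r powr s)"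
    by blast
  show ?case
  proof (cases "q \<in> F")
    case True
    then show ?thesis using E by (intro exI[of _ E]) (auto simp: insert_absorb)
  next
    case False
    show ?thesis
    proof (cases "(\<Sum>r\<in>{r\<in>E. sc r \<subseteq> sc q \<and> r \<noteq> q}. ell r powr s) \<le> ell q powr s")
      case True
      have same: "{r\<in>insert q E. sc r \<subseteq> sc p \<and> r \<noteq> p} = {r\<in>E. sc r \<subseteq> sc p \<and> r \<noteq> p}" if "p \<in> F" for p
      proof -
        have "\<not> sc q \<subseteq> sc p"
        proof
          assume sub: "sc q \<subseteq> sc p"
          then have "fst q = fst p" using sc_mono[OF sub] insert.hyps(2)[OF that] by simp
          then have "q = p" using sc_eq_of_subset[OF sub] by simp
          then show False using False that by simp
        qed
        then show ?thesis by blast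
      qed
      have sameq: "{r\<in>insert q E. sc r \<subseteq> sc q \<and> r \<noteq> q} = {r\<in>E. sc r \<subseteq> sc q \<and> r \<noteq> q}" by blast
      show ?thesis
      proof (intro exI[of _ "insert q E"] conjI ballI)
        fix p assume p: "p \<in> insert q E"
        show "(\<Sum>r\<in>{r\<in>insert q E. sc r \<subseteq> sc p \<and> r \<noteq> p}. ell r powr s) \<le> ell p powr s"
        proof (cases "p = q")
          case eq: True
          show ?thesis unfolding eq sameq by (rule True)
        next
          case False
          then have "p \<in> E" using p by blast
          then have "p \<in> F" using E(1) by blast
          show ?thesis unfolding same[OF \<open>p \<in> F\<close>] by (rule E(2)[OF \<open>p \<in> E\<close>])
        qed
      next
        fix p assume p: "p \<in> insert q F - insert q E"
        then have "p \<in> F" "p \<in> F - E" by blast+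
        show "ell p powr s \<le> (\<Sum>r\<in>{r\<in>insert q E. sc r \<subseteq> sc p \<and> r \<noteq> p}. ell r powr s)"
          unfolding same[OF \<open>p \<in> F\<close>] by (rule E(3)[OF \<open>p \<in> F - E\<close>])
      qed (use E(1) in blast)
    next
      case nle: False
      show ?thesis
      proof (intro exI[of _ E] conjI ballI)
        fix p assume p: "p \<in> insert q F - E"
        show "ell p powr s \<le> (\<Sum>r\<in>{r\<in>E. sc r \<subseteq> sc p \<and> r \<noteq> p}. ell r powr s)"
        proof (cases "p = q")
          case True
          show ?thesis unfolding True using nle by simp
        next
          case False
          then have "p \<in> F - E" using p by blast
          then show ?thesis by (rule E(3))
        qed
      qed (use E in blast)+
    qed
  qed
qed

text \<open>A rejected cube q is paid by the kept cubes r inside it: l(q)^\<tau> is at most the sum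
  of l(r)^s l(q)^(\<tau> - s), and u(q) \<le> u(r). For fixed r the cubes q around it form a tower,
  along which l(q)^(\<tau> - s) is summable as \<tau> < s.\<close>

lemma sum_le_sparse_sum:
  fixes u :: "int \<times> (real ^ 'n) \<Rightarrow> ennreal" and s \<tau> :: real
  assumes F: "finite F" "laminar F" and E: "E \<subseteq> F" and \<tau>: "\<tau> < s"
    and big: "\<And>q. q \<in> F - E \<Longrightarrow> ell q powr s \<le> (\<Sum>r\<in>{r\<in>E. sc r \<subseteq> sc q \<and> r \<noteq> q}. ell r powr s)"
    and u: "\<And>r q. sc r \<subseteq> sc q \<Longrightarrow> u q \<le> u r"
  shows "(\<Sum>q\<in>F. ennreal (ell q powr \<tau>) * u q) \<le> ennreal (1 + geom_const (s - \<tau>)) * (\<Sum>q\<in>E. ennreal (ell q powr \<tau>) * u q)"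
proof -
  have G: "0 < geom_const (s - \<tau>)" using \<tau> by (intro geom_const_pos) simp
  have finE: "finite E" using E F(1) by (rule finite_subset)
  have "(\<Sum>q\<in>F - E. ennreal (ell q powr \<tau>) * u q) \<le> (\<Sum>q\<in>F - E. \<Sum>r\<in>{r\<in>E. sc r \<subseteq> sc q}. ennreal (ell r powr s * ell q powr (- (s - \<tau>))) * u r)"
  proof (rule sum_mono)
    fix q assume q: "q \<in> F - E"
    let ?S = "{r\<in>E. sc r \<subseteq> sc q \<and> r \<noteq> q}"
    have "ell q powr \<tau> = ell q powr s * ell q powr (- (s - \<tau>))"
      by (simp add: powr_add[symmetric])
    also have "\<dots> \<le> (\<Sum>r\<in>?S. ell r powr s) * ell q powr (- (s - \<tau>))"
      by (intro mult_right_mono big[OF q]) simp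
    finally have "ennreal (ell q powr \<tau>) * u q \<le> ennreal (\<Sum>r\<in>?S. ell r powr s * ell q powr (- (s - \<tau>))) * u q"
      by (intro mult_right_mono ennreal_leI) (simp_all add: sum_distrib_right)
    also have "\<dots> = (\<Sum>r\<in>?S. ennreal (ell r powr s * ell q powr (- (s - \<tau>))) * u q)"
      by (simp add: sum_distrib_right[symmetric] sum_ennreal)
    also have "\<dots> \<le> (\<Sum>r\<in>?S. ennreal (ell r powr s * ell q powr (- (s - \<tau>))) * u r)"
      by (intro sum_mono mult_left_mono u) auto
    also have "\<dots> \<le> (\<Sum>r\<in>{r\<in>E. sc r \<subseteq> sc q}. ennreal (ell r powr s * ell q powr (- (s - \<tau>))) * u r)"
      using finE by (intro sum_mono2) auto
    finally show "ennreal (ell q powr \<tau>) * u q \<le> \<dots>" .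
  qed
  also have "\<dots> \<le> (\<Sum>q\<in>F. \<Sum>r\<in>{r\<in>E. sc r \<subseteq> sc q}. ennreal (ell r powr s * ell q powr (- (s - \<tau>))) * u r)"
    using F by (intro sum_mono2) auto
  also have "\<dots> = (\<Sum>r\<in>E. \<Sum>q\<in>{q\<in>F. sc r \<subseteq> sc q}. ennreal (ell r powr s * ell q powr (- (s - \<tau>))) * u r)"
    using F(1) finE by (rule sum.swap_restrict)
  also have "\<dots> \<le> (\<Sum>r\<in>E. ennreal (geom_const (s - \<tau>)) * (ennreal (ell r powr \<tau>) * u r))"
  proof (rule sum_mono)
    fix r assume "r \<in> E"
    let ?S = "{q\<in>F. sc r \<subseteq> sc q}"
    have "(\<Sum>q\<in>?S. ell q powr (- (s - \<tau>))) = (\<Sum>q\<in>?S. 2 powr (- (s - \<tau>) * fst q))"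
      unfolding ell_def powr_powr by (simp only: mult.commute)
    also have "\<dots> \<le> 2 powr (- (s - \<tau>) * fst r) * geom_const (s - \<tau>)"
      using F \<tau> by (intro sum_powr_le_up laminar_inj_on_fst_super) (auto intro: sc_mono)
    also have "2 powr (- (s - \<tau>) * fst r) = ell r powr (- (s - \<tau>))"
      unfolding ell_def powr_powr by (simp only: mult.commute)
    finally have le: "(\<Sum>q\<in>?S. ell q powr (- (s - \<tau>))) \<le> ell r powr (- (s - \<tau>)) * geom_const (s - \<tau>)" .
    have "(\<Sum>q\<in>?S. ennreal (ell r powr s * ell q powr (- (s - \<tau>))) * u r) = ennreal (ell r powr s * (\<Sum>q\<in>?S. ell q powr (- (s - \<tau>)))) * u r"
      by (simp add: sum_distrib_right[symmetric] sum_ennreal sum_distrib_left[symmetric])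
    also have "\<dots> \<le> ennreal (ell r powr s * (ell r powr (- (s - \<tau>)) * geom_const (s - \<tau>))) * u r"
      by (intro mult_right_mono ennreal_leI mult_left_mono le) auto
    also have "ell r powr s * (ell r powr (- (s - \<tau>)) * geom_const (s - \<tau>)) = geom_const (s - \<tau>) * ell r powr \<tau>"
    proof -
      have e: "ell r powr s * ell r powr (- (s - \<tau>)) = ell r powr \<tau>" by (simp add: powr_add[symmetric])
      show ?thesis unfolding mult.assoc[symmetric] e by (rule mult.commute)
    qed
    also have "ennreal (geom_const (s - \<tau>) * ell r powr \<tau>) * u r = ennreal (geom_const (s - \<tau>)) * (ennreal (ell r powr \<tau>) * u r)"
      using G by (simp add: ennreal_mult mult.assoc)
    finally show "(\<Sum>q\<in>?S. ennreal (ell r powr s * ell q powr (- (s - \<tau>))) * u r) \<le> ennreal (geom_const (s - \<tau>)) * (ennreal (ell r powr \<tau>) * u r)" .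
  qed
  finally have le: "(\<Sum>q\<in>F - E. ennreal (ell q powr \<tau>) * u q) \<le> ennreal (geom_const (s - \<tau>)) * (\<Sum>r\<in>E. ennreal (ell r powr \<tau>) * u r)"
    by (simp add: sum_distrib_left)
  have "(\<Sum>q\<in>F. ennreal (ell q powr \<tau>) * u q) = (\<Sum>q\<in>F - E. ennreal (ell q powr \<tau>) * u q) + (\<Sum>q\<in>E. ennreal (ell q powr \<tau>) * u q)"
    using sum.subset_diff[OF E F(1)] .
  also have "\<dots> \<le> ennreal (geom_const (s - \<tau>)) * (\<Sum>r\<in>E. ennreal (ell r powr \<tau>) * u r) + (\<Sum>q\<in>E. ennreal (ell q powr \<tau>) * u q)"
    by (intro add_right_mono le)
  also have "\<dots> = ennreal (1 + geom_const (s - \<tau>)) * (\<Sum>q\<in>E. ennreal (ell q powr \<tau>) * u q)"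
    using G by (simp add: distrib_right add.commute)
  finally show ?thesis .
qed

text \<open>By the A_1 condition v(Q) is replaced by |Q| times the essential infimum, which can only
  grow when the cube shrinks, as the passage to the sparse subfamily needs. The infimum is then
  moved under the oscillation integral, and at x the factors (rho/l(q))^a start at 1 on the smallest
  cube and form a geometric series. The value s is the midpoint between n\<beta> and n - 1, so both
  gaps are positive.\<close>

lemma critical_bound:
  fixes f v :: "real ^ 'n \<Rightarrow> real" and \<beta> lam s a :: real
  assumes f: "locally_integrable f" and G: "has_weak_gradient f G" and v: "v \<in> A_class 1"
    and n: "2 \<le> CARD('n)" and \<beta>: "0 \<le> \<beta>" "\<beta> < 1 - 1 / CARD('n)"
    and F: "finite F" "laminar F" and lam: "0 < lam"
    and heavy: "\<And>q. q \<in> F \<Longrightarrow> heavy f (lam * ell q powr (CARD('n) * \<beta>)) q"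
  defines "s \<equiv> (CARD('n) * \<beta> + CARD('n) - 1) / 2"
  defines "a \<equiv> (CARD('n) - 1 - s) / (CARD('n) - 1)"
  shows "(\<Sum>q\<in>F. ennreal (lam * ell q powr (CARD('n) * (\<beta> - 1))) * cube_mass (\<lambda>x. ennreal (v x)) q)
    \<le> ennreal ((1 + geom_const (s - CARD('n) * \<beta>)) * (16 * poincare_const CARD('n) / kap CARD('n)) * geom_const a)
        * A_const 1 v * (\<integral>\<^sup>+x. ennreal (norm (G x) * v x) \<partial>lebesgue)"
proof -
  let ?n = "CARD('n)" and ?A = "A_const 1 v"
  define \<tau> where "\<tau> = ?n * \<beta>"
  define C1 where "C1 = 16 * poincare_const ?n / kap ?n"
  have n0: "0 < real ?n - 1" using n by simp
  have "?n * \<beta> < ?n * (1 - 1 / ?n)" using \<beta>(2) by (intro mult_strict_left_mono) auto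
  also have "?n * (1 - 1 / ?n) = ?n - 1" by (simp add: right_diff_distrib)
  finally have s: "\<tau> < s" "s < ?n - 1" by (auto simp: \<tau>_def s_def mult.commute)
  have a: "0 < a" using s n0 by (simp add: a_def)
  have C1: "0 \<le> C1" using kap_bounds[of ?n] by (simp add: C1_def poincare_const_def)
  have Ga: "0 < geom_const a" using a by (rule geom_const_pos)
  have Gs: "0 < geom_const (s - \<tau>)" using s by (intro geom_const_pos) simp
  have [measurable]: "v \<in> borel_measurable lebesgue" using v by (rule A_class_measurable)
  have v0: "0 \<le> v x" for x using v by (auto simp: A_class_def weight_def)
  have [measurable]: "G \<in> borel_measurable lebesgue"
    using G by (auto simp: has_weak_gradient_def intro: locally_integrable_measurable)
  obtain E where E: "E \<subseteq> F"
    and sparse: "\<And>q. q \<in> E \<Longrightarrow> (\<Sum>r\<in>{r\<in>E. sc r \<subseteq> sc q \<and> r \<noteq> q}. ell r powr s) \<le> ell q powr s"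
    and big: "\<And>q. q \<in> F - E \<Longrightarrow> ell q powr s \<le> (\<Sum>r\<in>{r\<in>E. sc r \<subseteq> sc q \<and> r \<noteq> q}. ell r powr s)"
    using sparse_selection[OF F(1), of s] by blast
  have finE: "finite E" using E F(1) by (rule finite_subset)
  have lamE: "laminar E" using F(2) E by (rule laminar_subset)
  have [measurable]: "rho E \<in> borel_measurable lebesgue" by (rule rho_meas[OF finE])
  let ?I = "\<lambda>q x. ennreal (norm (G x) * (rho E x / ell q) powr a)"
  have one: "ennreal (lam * ell q powr \<tau>) * low v q \<le> ennreal C1 * cube_mass (\<lambda>x. ?I q x * ennreal (v x)) q" if q: "q \<in> E" for q
  proof -
    have "q \<in> F" using q E by blast
    then obtain Q where Q: "sc q \<subseteq> Q" "Q \<subseteq> cbox (snd q) (snd q + vec (ell q))" "lam * ell q powr (?n * \<beta>) < oscillation Q f"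
      using heavy unfolding heavy_def by blast
    have "ennreal (lam * ell q powr \<tau>) \<le> ennreal (oscillation Q f)"
      using Q(3) by (intro ennreal_leI) (simp add: \<tau>_def)
    also have "\<dots> \<le> ennreal C1 * cint (sc q) (?I q)"
      unfolding C1_def a_def
      by (rule sparse_oscillation[OF f G n finE lamE q s(2) sparse[OF q] Q(1,2)])
    finally have "ennreal (lam * ell q powr \<tau>) * low v q \<le> ennreal C1 * cint (sc q) (?I q) * low v q"
      by (rule mult_right_mono) simp
    also have "\<dots> = ennreal C1 * (\<integral>\<^sup>+x. ?I q x * indicator (sc q) x * low v q \<partial>lebesgue)"
      by (subst nn_integral_multc) (auto simp: mult.assoc)
    also have "\<dots> \<le> ennreal C1 * cube_mass (\<lambda>x. ?I q x * ennreal (v x)) q"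
      unfolding cube_mass_def using AE_low_le[of q v]
      by (intro mult_left_mono nn_integral_mono_AE, eventually_elim) (auto simp: indicator_def intro!: mult_left_mono)
    finally show ?thesis .
  qed
  have total: "(\<Sum>q\<in>E. cube_mass (\<lambda>x. ?I q x * ennreal (v x)) q) \<le> (\<integral>\<^sup>+x. ennreal (geom_const a) * ennreal (norm (G x) * v x) \<partial>lebesgue)"
  proof (rule sum_cube_mass_le[OF finE])
    show "AE x in lebesgue. (\<Sum>q\<in>{q\<in>E. x \<in> sc q}. ?I q x * ennreal (v x)) \<le> ennreal (geom_const a) * ennreal (norm (G x) * v x)"
    proof (rule AE_I2)
      fix x
      show "(\<Sum>q\<in>{q\<in>E. x \<in> sc q}. ?I q x * ennreal (v x)) \<le> ennreal (geom_const a) * ennreal (norm (G x) * v x)"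
      proof (cases "{q\<in>E. x \<in> sc q} = {}")
        case True
        show ?thesis unfolding True by simp
      next
        case False
        then obtain q0 where q0: "q0 \<in> E" "x \<in> sc q0" by blast
        obtain r where r: "r \<in> E" "x \<in> sc r" "rho E x = ell r"
          using rho_attained[OF finE q0] by blast
        let ?S = "{q\<in>E. x \<in> sc q}"
        have "(\<Sum>q\<in>?S. ell q powr (- a)) = (\<Sum>q\<in>?S. 2 powr (- a * fst q))"
          unfolding ell_def powr_powr by (simp only: mult.commute)
        also have "\<dots> \<le> 2 powr (- a * fst r) * geom_const a"
        proof (rule sum_powr_le_up[OF a _ laminar_inj_on_fst[OF lamE]])
          show "finite ?S" using finE by simp
          fix q assume "q \<in> ?S"
          then have "rho E x \<le> ell q" using rho_le[OF finE] by blast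
          then show "fst r \<le> fst q" unfolding r(3) ell_le_iff .
        qed
        also have "2 powr (- a * fst r) = ell r powr (- a)"
          unfolding ell_def powr_powr by (simp only: mult.commute)
        finally have le: "(\<Sum>q\<in>?S. ell q powr (- a)) \<le> ell r powr (- a) * geom_const a" .
        have "(\<Sum>q\<in>?S. (rho E x / ell q) powr a) = ell r powr a * (\<Sum>q\<in>?S. ell q powr (- a))"
          unfolding r(3) by (simp add: powr_divide powr_minus_divide sum_distrib_left)
        also have "\<dots> \<le> ell r powr a * (ell r powr (- a) * geom_const a)"
          by (intro mult_left_mono le) simp
        also have "\<dots> = geom_const a" by (simp add: powr_minus)
        finally have le: "(\<Sum>q\<in>?S. (rho E x / ell q) powr a) \<le> geom_const a" .
        have "(\<Sum>q\<in>?S. ?I q x * ennreal (v x)) = ennreal (norm (G x) * (\<Sum>q\<in>?S. (rho E x / ell q) powr a)) * ennreal (v x)"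
          unfolding sum_distrib_right[symmetric] sum_distrib_left by (subst sum_ennreal) auto
        also have "\<dots> \<le> ennreal (norm (G x) * geom_const a) * ennreal (v x)"
          by (intro mult_right_mono ennreal_leI mult_left_mono le) auto
        also have "\<dots> = ennreal (geom_const a) * ennreal (norm (G x) * v x)"
          using Ga v0 by (simp add: ennreal_mult mult_ac)
        finally show ?thesis .
      qed
    qed
  qed measurable
  also have "\<dots> = ennreal (geom_const a) * (\<integral>\<^sup>+x. ennreal (norm (G x) * v x) \<partial>lebesgue)"
    by (rule nn_integral_cmult) measurable
  finally have total: "(\<Sum>q\<in>E. cube_mass (\<lambda>x. ?I q x * ennreal (v x)) q) \<le> ennreal (geom_const a) * (\<integral>\<^sup>+x. ennreal (norm (G x) * v x) \<partial>lebesgue)" .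
  have "(\<Sum>q\<in>F. ennreal (lam * ell q powr (?n * (\<beta> - 1))) * cube_mass (\<lambda>x. ennreal (v x)) q)
      \<le> (\<Sum>q\<in>F. ?A * ennreal lam * (ennreal (ell q powr \<tau>) * low v q))"
  proof (rule sum_mono)
    fix q :: "int \<times> (real ^ 'n)"
    have e: "ell q powr (real ?n * (\<beta> - 1)) * ell q ^ ?n = ell q powr \<tau>"
      by (simp add: \<tau>_def powr_realpow[symmetric] powr_add[symmetric] algebra_simps)
    have "ennreal (lam * ell q powr (?n * (\<beta> - 1))) * cube_mass (\<lambda>x. ennreal (v x)) q
       \<le> ennreal (lam * ell q powr (?n * (\<beta> - 1))) * (?A * ennreal (ell q ^ ?n) * low v q)"
      by (intro mult_left_mono A1_cube_mass_le v) simp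
    also have "\<dots> = ?A * ennreal lam * (ennreal (ell q powr (?n * (\<beta> - 1)) * ell q ^ ?n) * low v q)"
      using lam by (simp add: ennreal_mult mult_ac)
    finally show "ennreal (lam * ell q powr (?n * (\<beta> - 1))) * cube_mass (\<lambda>x. ennreal (v x)) q \<le> ?A * ennreal lam * (ennreal (ell q powr \<tau>) * low v q)"
      unfolding e .
  qed
  also have "\<dots> = ?A * ennreal lam * (\<Sum>q\<in>F. ennreal (ell q powr \<tau>) * low v q)"
    by (rule sum_distrib_left[symmetric])
  also have "\<dots> \<le> ?A * ennreal lam * (ennreal (1 + geom_const (s - \<tau>)) * (\<Sum>q\<in>E. ennreal (ell q powr \<tau>) * low v q))"
    by (intro mult_left_mono sum_le_sparse_sum[OF F E s(1) big] low_antimono) auto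
  also have "\<dots> = ?A * ennreal (1 + geom_const (s - \<tau>)) * (\<Sum>q\<in>E. ennreal (lam * ell q powr \<tau>) * low v q)"
    using lam by (simp add: sum_distrib_left ennreal_mult mult_ac)
  also have "\<dots> \<le> ?A * ennreal (1 + geom_const (s - \<tau>)) * (\<Sum>q\<in>E. ennreal C1 * cube_mass (\<lambda>x. ?I q x * ennreal (v x)) q)"
    by (intro mult_left_mono sum_mono one) auto
  also have "\<dots> = ?A * ennreal (1 + geom_const (s - \<tau>)) * (ennreal C1 * (\<Sum>q\<in>E. cube_mass (\<lambda>x. ?I q x * ennreal (v x)) q))"
    by (simp only: sum_distrib_left)
  also have "\<dots> \<le> ?A * ennreal (1 + geom_const (s - \<tau>)) * (ennreal C1 * (ennreal (geom_const a) * (\<integral>\<^sup>+x. ennreal (norm (G x) * v x) \<partial>lebesgue)))"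
    by (intro mult_left_mono total) auto
  also have "\<dots> = ?A * (ennreal (1 + geom_const (s - \<tau>)) * (ennreal C1 * (ennreal (geom_const a) * (\<integral>\<^sup>+x. ennreal (norm (G x) * v x) \<partial>lebesgue))))"
    by (simp only: mult.assoc)
  also have "\<dots> = ?A * (ennreal ((1 + geom_const (s - \<tau>)) * C1 * geom_const a) * (\<integral>\<^sup>+x. ennreal (norm (G x) * v x) \<partial>lebesgue))"
    by (subst ennreal_mult3) (use Gs C1 Ga in auto)
  also have "\<dots> = ennreal ((1 + geom_const (s - \<tau>)) * C1 * geom_const a) * ?A * (\<integral>\<^sup>+x. ennreal (norm (G x) * v x) \<partial>lebesgue)"
    by (simp only: mult_ac)
  finally show ?thesis unfolding \<tau>_def C1_def .
qed

section \<open>Assembly of the cases\<close>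

text \<open>The common form of all cases. C and X are fixed before f, G, lam and F; C is meant to
  depend on p, \<beta> and the dimension only, while X carries the power of the Muckenhoupt
  constant.\<close>

definition family_bound :: "real \<Rightarrow> real \<Rightarrow> real \<Rightarrow> ennreal \<Rightarrow> (real ^ 'n \<Rightarrow> real) \<Rightarrow> bool" where
  "family_bound p \<beta> C X v \<longleftrightarrow> (\<forall>f G lam F. locally_integrable f \<longrightarrow> has_weak_gradient f G \<longrightarrow> 0 < lam \<longrightarrow> finite F \<longrightarrow> laminar F \<longrightarrow>
     (\<forall>q\<in>F. heavy f (lam * ell q powr (real CARD('n) * (\<beta> + 1 - 1 / p))) q) \<longrightarrow>
     (\<Sum>q\<in>F. ennreal (lam powr p * ell q powr (real CARD('n) * (\<beta> * p - 1))) * cube_mass (\<lambda>x. ennreal (v x)) q)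
       \<le> ennreal C * X * (\<integral>\<^sup>+x. ennreal (norm (G x) powr p * v x) \<partial>lebesgue))"

lemma ennpow_Lp_norm:
  fixes p :: real
  assumes "0 < p"
  shows "ennpow (Lp_norm p v g) p = (\<integral>\<^sup>+x. ennreal (\<bar>g x\<bar> powr p * v x) \<partial>lebesgue)"
proof -
  have "ennpow (ennpow x (1 / p)) p = x" for x
    using assms by (cases x) (auto simp: ennpow_def powr_powr ennreal_eq_0_iff)
  then show ?thesis by (simp add: Lp_norm_def)
qed

lemma level_sup_bound_of_family_bound:
  fixes p \<beta> C :: real
  assumes p: "1 \<le> p" and le: "\<And>v :: real ^ 'n \<Rightarrow> real. v \<in> A_class r \<Longrightarrow> family_bound p \<beta> C (X v) v"
  shows "\<exists>C'::real. C' > 0 \<and>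
       (\<forall>v :: real ^ 'n \<Rightarrow> real. \<forall>D f G.
          v \<in> A_class r \<longrightarrow> dyadic_grid D \<longrightarrow> f \<in> sobolev p v \<longrightarrow> has_weak_gradient f G \<longrightarrow>
          level_sup p \<beta> v D f \<le> ennreal C' * X v * ennpow (Lp_norm p v (\<lambda>x. norm (G x))) p)"
proof (intro exI conjI allI impI)
  let ?N = "CARD('n \<Rightarrow> bool \<times> bool)"
  \<comment> \<open>The number of grid cubes per code times C, made positive whatever the sign of
    C.\<close>
  let ?C = "real ?N * max 0 C + 1"
  show "0 < ?C" by (simp add: add_nonneg_pos)
  fix v f :: "real ^ 'n \<Rightarrow> real" and D :: "(real ^ 'n) set set" and G :: "real ^ 'n \<Rightarrow> real ^ 'n"
  assume v: "v \<in> A_class r" and D: "dyadic_grid D" and f: "f \<in> sobolev p v" and G: "has_weak_gradient f G"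
  have fl: "locally_integrable f" using f by (simp add: sobolev_def)
  let ?e = "\<integral>\<^sup>+x. ennreal (norm (G x) powr p * v x) \<partial>lebesgue"
  have "level_sup p \<beta> v D f \<le> of_nat ?N * (ennreal C * X v * ?e)"
  proof (rule level_sup_le[OF D])
    fix lam :: real and F :: "(int \<times> (real ^ 'n)) set"
    assume "0 < lam" "finite F" "laminar F"
      and "\<And>q. q \<in> F \<Longrightarrow> heavy f (lam * ell q powr (CARD('n) * (\<beta> + 1 - 1 / p))) q"
    then show "(\<Sum>q\<in>F. ennreal (lam powr p * ell q powr (CARD('n) * (\<beta> * p - 1))) * cube_mass (\<lambda>x. ennreal (v x)) q) \<le> ennreal C * X v * ?e"
      using le[OF v] fl G unfolding family_bound_def by blast
  qed
  also have "\<dots> = ennreal (real ?N * max 0 C) * (X v * ?e)"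
  proof -
    have "ennreal C = ennreal (max 0 C)" by (simp add: max_def ennreal_neg)
    then show ?thesis
      by (simp only: ennreal_mult of_nat_0_le_iff max.cobounded1 ennreal_of_nat_eq_real_of_nat mult.assoc)
  qed
  also have "\<dots> \<le> ennreal ?C * (X v * ?e)"
    by (intro mult_right_mono ennreal_leI) auto
  also have "\<dots> = ennreal ?C * X v * ennpow (Lp_norm p v (\<lambda>x. norm (G x))) p"
    using p by (simp add: ennpow_Lp_norm mult.assoc)
  finally show "level_sup p \<beta> v D f \<le> ennreal ?C * X v * ennpow (Lp_norm p v (\<lambda>x. norm (G x))) p" .
qed

text \<open>Poincare's inequality without holes is applied here, once for all cases except the
  sparse one.\<close>

lemma level_family_of_heavy:
  fixes f v :: "real ^ 'n \<Rightarrow> real" and p \<beta> lam :: real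
  assumes "locally_integrable f" "has_weak_gradient f G" "0 < lam" "finite F" "laminar F" "1 \<le> p"
    and heavy: "\<forall>q\<in>F. heavy f (lam * ell q powr (CARD('n) * (\<beta> + 1 - 1 / p))) q"
    and v: "v \<in> A_class r"
  shows "level_family F (\<lambda>x. norm (G x)) v lam (2 * poincare_const CARD('n)) p \<beta>"
proof
  have "G \<in> borel_measurable lebesgue"
    using assms(2) by (auto simp: has_weak_gradient_def intro: locally_integrable_measurable)
  then show "(\<lambda>x. norm (G x)) \<in> borel_measurable lebesgue" by measurable
  show "v \<in> borel_measurable lebesgue" using v by (rule A_class_measurable)
  show "0 \<le> v x" for x using v by (simp add: A_class_def weight_def)
  show "cube_mass (\<lambda>x. ennreal (v x)) q < top" for q
    using v by (intro cube_mass_finite) (auto simp: A_class_def weight_def)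
  show "0 < 2 * poincare_const CARD('n)" by (simp add: poincare_const_def)
  fix q assume "q \<in> F"
  then obtain Q where Q: "sc q \<subseteq> Q" "Q \<subseteq> cbox (snd q) (snd q + vec (ell q))"
      "lam * ell q powr (CARD('n) * (\<beta> + 1 - 1 / p)) < oscillation Q f"
    using heavy unfolding heavy_def by blast
  have "ennreal (lam * ell q powr (CARD('n) * (\<beta> + 1 - 1 / p))) \<le> ennreal (oscillation Q f)"
    using Q(3) by (intro ennreal_leI) simp
  also have "\<dots> \<le> ennreal (2 * poincare_const CARD('n)) * cube_mass (\<lambda>x. ennreal (norm (G x))) q"
    unfolding cube_mass_def sc_def
    by (rule oscillation_le[OF assms(1,2) ell_pos(1) Q(1)[unfolded sc_def] Q(2)])
  finally show "ennreal (lam * ell q powr (CARD('n) * (\<beta> + 1 - 1 / p)))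
      \<le> ennreal (2 * poincare_const CARD('n)) * cube_mass (\<lambda>x. ennreal (norm (G x))) q" .
qed (use assms in auto)

lemma family_bound_supercritical:
  fixes p \<beta> :: real and v :: "real ^ 'n \<Rightarrow> real"
  assumes p: "1 \<le> p" "1 / p < \<beta>" and v: "v \<in> A_class p"
  shows "family_bound p \<beta> (geom_const (CARD('n) * (\<beta> * p - 1)) * (2 * poincare_const CARD('n)) powr p) (A_const p v) v"
  unfolding family_bound_def
proof (intro allI impI)
  fix f G lam and F :: "(int \<times> (real ^ 'n)) set"
  assume "locally_integrable f" "has_weak_gradient f G" "0 < lam" "finite F" "laminar F"
    "\<forall>q\<in>F. heavy f (lam * ell q powr (CARD('n) * (\<beta> + 1 - 1 / p))) q"
  then interpret level_family F "\<lambda>x. norm (G x)" v lam "2 * poincare_const CARD('n)" p \<beta>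
    by (rule level_family_of_heavy[OF _ _ _ _ _ p(1) _ v])
  show "(\<Sum>q\<in>F. ennreal (lam powr p * ell q powr (CARD('n) * (\<beta> * p - 1))) * V q)
       \<le> ennreal (geom_const (CARD('n) * (\<beta> * p - 1)) * (2 * poincare_const CARD('n)) powr p) * A_const p v * energy"
    by (rule supercritical_bound[OF p(2) Ap_cube_mass_le[OF p(1) v]])
qed

lemma family_bound_subcritical:
  fixes p \<beta> :: real and v :: "real ^ 'n \<Rightarrow> real"
  assumes p: "1 \<le> p" "\<beta> < 1 / p - 1" and v: "v \<in> A_class p"
  shows "family_bound p \<beta> (geom_const (- (CARD('n) * (\<beta> * p - 1 + p))) * (2 * poincare_const CARD('n)) powr p) (A_const p v) v"
  unfolding family_bound_def
proof (intro allI impI)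
  fix f G lam and F :: "(int \<times> (real ^ 'n)) set"
  assume "locally_integrable f" "has_weak_gradient f G" "0 < lam" "finite F" "laminar F"
    "\<forall>q\<in>F. heavy f (lam * ell q powr (CARD('n) * (\<beta> + 1 - 1 / p))) q"
  then interpret level_family F "\<lambda>x. norm (G x)" v lam "2 * poincare_const CARD('n)" p \<beta>
    by (rule level_family_of_heavy[OF _ _ _ _ _ p(1) _ v])
  show "(\<Sum>q\<in>F. ennreal (lam powr p * ell q powr (CARD('n) * (\<beta> * p - 1))) * V q)
       \<le> ennreal (geom_const (- (CARD('n) * (\<beta> * p - 1 + p))) * (2 * poincare_const CARD('n)) powr p) * A_const p v * energy"
    by (rule subcritical_bound[OF p(2) Ap_cube_mass_le[OF p(1) v]])
qed

lemma family_bound_A1: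
  fixes p \<beta> :: real and v :: "real ^ 'n \<Rightarrow> real"
  assumes p: "1 < p" "\<beta> \<noteq> 1 / p" and v: "v \<in> A_class 1"
  shows "family_bound p \<beta> (2 powr p * (2 * poincare_const CARD('n)) powr p * geom_const (\<bar>CARD('n) * (\<beta> - 1 / p)\<bar> * (p - 1))) (A_const 1 v) v"
  unfolding family_bound_def
proof (intro allI impI)
  fix f G lam and F :: "(int \<times> (real ^ 'n)) set"
  assume "locally_integrable f" "has_weak_gradient f G" "0 < lam" "finite F" "laminar F"
    "\<forall>q\<in>F. heavy f (lam * ell q powr (CARD('n) * (\<beta> + 1 - 1 / p))) q"
  then interpret level_family F "\<lambda>x. norm (G x)" v lam "2 * poincare_const CARD('n)" p \<beta>
    by (rule level_family_of_heavy[OF _ _ _ _ _ less_imp_le[OF p(1)] _ v])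
  show "(\<Sum>q\<in>F. ennreal (lam powr p * ell q powr (CARD('n) * (\<beta> * p - 1))) * V q)
       \<le> ennreal (2 powr p * (2 * poincare_const CARD('n)) powr p * geom_const (\<bar>CARD('n) * (\<beta> - 1 / p)\<bar> * (p - 1))) * A_const 1 v * energy"
    by (rule A1_bound[OF p A1_cube_mass_mult_le[OF v]])
qed

lemma family_bound_dual:
  fixes p \<beta> :: real and v :: "real ^ 'n \<Rightarrow> real"
  assumes pgt: "1 < p" and ne: "\<beta> \<noteq> 1 / p" and v: "v \<in> A_class p"
  shows "family_bound p \<beta> (2 * 2 powr (1 / (p - 1)) * (2 * poincare_const CARD('n)) powr p * geom_const (\<bar>CARD('n) * (\<beta> - 1 / p)\<bar>) * (4 powr p * geom_const (p - 1)))
    (ennpow (A_const p v) (p / (p - 1))) v"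
  unfolding family_bound_def
proof (intro allI impI)
  fix f G lam and F :: "(int \<times> (real ^ 'n)) set"
  assume f: "locally_integrable f" "has_weak_gradient f G" "0 < lam" "finite F" "laminar F"
    "\<forall>q\<in>F. heavy f (lam * ell q powr (CARD('n) * (\<beta> + 1 - 1 / p))) q"
  obtain a where a: "A_const p v = ennreal a" "0 \<le> a"
    using v by (cases "A_const p v") (auto simp: A_class_def)
  interpret level_family F "\<lambda>x. norm (G x)" v lam "2 * poincare_const CARD('n)" p \<beta>
    by (rule level_family_of_heavy[OF f(1-5) less_imp_le[OF pgt] f(6) v])
  interpret dual_level_family F "\<lambda>x. norm (G x)" v lam "2 * poincare_const CARD('n)" p \<beta> a
  proof
    have GI: "locally_integrable G" using f(2) by (simp add: has_weak_gradient_def)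
    then have "locally_integrable (\<lambda>x. norm (G x))"
      unfolding locally_integrable_def by (blast intro: set_integrable_norm)
    then show "cube_mass (\<lambda>x. ennreal (norm (G x))) q < top" for q
      by (rule cube_mass_finite) simp
    show "\<exists>S>0. cube_mass (\<lambda>x. ennreal (dual_weight p v x)) q = ennreal S \<and>
      (AE x in lebesgue. x \<in> sc q \<longrightarrow> 0 < v x) \<and> V q * ennreal (S powr (p - 1)) \<le> ennreal a * ennreal (ell q powr (CARD('n) * p))"
      if "V q \<noteq> 0" for q
      by (rule Ap_dual_weight[OF pgt v that]) (auto simp: a)
  qed (use pgt a in auto)
  have "ennpow (A_const p v) (p / (p - 1)) = ennreal (a powr (p / (p - 1)))"
    using a pgt by (auto simp: ennpow_def ennreal_eq_0_iff)
  then show "(\<Sum>q\<in>F. ennreal (lam powr p * ell q powr (CARD('n) * (\<beta> * p - 1))) * V q)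
       \<le> ennreal (2 * 2 powr (1 / (p - 1)) * (2 * poincare_const CARD('n)) powr p * geom_const (\<bar>CARD('n) * (\<beta> - 1 / p)\<bar>) * (4 powr p * geom_const (p - 1)))
         * ennpow (A_const p v) (p / (p - 1)) * energy"
    using dual_bound[OF ne] by simp
qed

lemma family_bound_critical:
  fixes \<beta> s a :: real and v :: "real ^ 'n \<Rightarrow> real"
  assumes n: "2 \<le> CARD('n)" and \<beta>: "0 \<le> \<beta>" "\<beta> < 1 - 1 / CARD('n)" and v: "v \<in> A_class 1"
  defines "s \<equiv> (CARD('n) * \<beta> + CARD('n) - 1) / 2"
  defines "a \<equiv> (CARD('n) - 1 - s) / (CARD('n) - 1)"
  shows "family_bound 1 \<beta> ((1 + geom_const (s - CARD('n) * \<beta>)) * (16 * poincare_const CARD('n) / kap CARD('n)) * geom_const a) (A_const 1 v) v"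
  unfolding family_bound_def
proof (intro allI impI)
  fix f G lam and F :: "(int \<times> (real ^ 'n)) set"
  assume f: "locally_integrable f" "has_weak_gradient f G" "0 < lam" "finite F" "laminar F"
    "\<forall>q\<in>F. heavy f (lam * ell q powr (CARD('n) * (\<beta> + 1 - 1 / 1))) q"
  have h: "\<And>q. q \<in> F \<Longrightarrow> heavy f (lam * ell q powr (CARD('n) * \<beta>)) q" using f(6) by simp
  show "(\<Sum>q\<in>F. ennreal (lam powr 1 * ell q powr (CARD('n) * (\<beta> * 1 - 1))) * cube_mass (\<lambda>x. ennreal (v x)) q)
      \<le> ennreal ((1 + geom_const (s - CARD('n) * \<beta>)) * (16 * poincare_const CARD('n) / kap CARD('n)) * geom_const a) * A_const 1 v
        * (\<integral>\<^sup>+x. ennreal (norm (G x) powr 1 * v x) \<partial>lebesgue)"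
    using critical_bound[OF f(1,2) v n \<beta> f(4,5,3) h] f(3) unfolding s_def a_def by simp
qed

lemma ennpow_1 [simp]: "ennpow x 1 = x"
  by (cases x) (auto simp: ennpow_def)

lemma family_bound_p_eq_1:
  fixes \<beta> :: real
  assumes "\<beta> \<in> Omega 1 CARD('n::finite)"
  shows "\<exists>C. \<forall>v :: real ^ 'n \<Rightarrow> real. v \<in> A_class 1 \<longrightarrow> family_bound 1 \<beta> C (A_const 1 v) v"
proof -
  consider "1 < \<beta>" | "\<beta> < 0" | "0 \<le> \<beta>" "\<beta> < 1 - 1 / CARD('n)"
    using assms by (fastforce simp: Omega_def)
  then show ?thesis
  proof cases
    case 1
    then show ?thesis using family_bound_supercritical[of 1 \<beta>] by (metis div_by_1 order_refl)
  next
    case 2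
    then show ?thesis using family_bound_subcritical[of 1 \<beta>] by (metis diff_self div_by_1 order_refl)
  next
    case 3
    \<comment> \<open>In dimension 1 the range 0 \<le> \<beta> < 1 - 1/n is empty.\<close>
    have "CARD('n) \<noteq> 1" using 3 by auto
    moreover have "0 < CARD('n)" by simp
    ultimately have "2 \<le> CARD('n)" by linarith
    from family_bound_critical[OF this 3] show ?thesis by blast
  qed
qed

lemma family_bound_p_gt_1:
  fixes p \<beta> :: real
  assumes p: "1 < p" and \<beta>: "\<beta> \<in> Omega p CARD('n::finite)"
  shows "\<exists>C. \<forall>v :: real ^ 'n \<Rightarrow> real. v \<in> A_class p \<longrightarrow> family_bound p \<beta> C (ennpow (A_const p v) (alpha p \<beta>)) v"
proof -
  have ne: "\<beta> \<noteq> 1 / p" using \<beta> p by (simp add: Omega_def)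
  then consider "1 / p < \<beta>" | "\<beta> < 1 / p - 1" | "\<beta> \<in> {1 / p - 1 ..< 1 / p}" by fastforce
  then show ?thesis
  proof cases
    case 1
    then have "alpha p \<beta> = 1" by (simp add: alpha_def)
    then show ?thesis using family_bound_supercritical[OF less_imp_le[OF p] 1] by auto
  next
    case 2
    then have "alpha p \<beta> = 1" by (simp add: alpha_def)
    then show ?thesis using family_bound_subcritical[OF less_imp_le[OF p] 2] by auto
  next
    case 3
    then have "alpha p \<beta> = p / (p - 1)" using p by (simp add: alpha_def)
    then show ?thesis using family_bound_dual[OF p ne] by auto
  qed
qed

theorem theorem1p1:
  fixes p \<beta> :: real
  assumes "1 \<le> p" and "\<beta> \<in> Omega p CARD('n::finite)"
  shows
    "(\<exists>C::real. C > 0 \<and>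
       (\<forall>v :: real ^ 'n \<Rightarrow> real. \<forall>D f G.
          v \<in> A_class 1 \<longrightarrow> dyadic_grid D \<longrightarrow> f \<in> sobolev p v \<longrightarrow> has_weak_gradient f G \<longrightarrow>
          level_sup p \<beta> v D f
            \<le> ennreal C * A_const 1 v * ennpow (Lp_norm p v (\<lambda>x. norm (G x))) p)) \<and>
     (\<exists>C::real. C > 0 \<and>
       (\<forall>v :: real ^ 'n \<Rightarrow> real. \<forall>D f G.
          v \<in> A_class p \<longrightarrow> dyadic_grid D \<longrightarrow> f \<in> sobolev p v \<longrightarrow> has_weak_gradient f G \<longrightarrow>
          level_sup p \<beta> v D f
            \<le> ennreal C * ennpow (A_const p v) (alpha p \<beta>)
                 * ennpow (Lp_norm p v (\<lambda>x. norm (G x))) p))"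
proof (cases "p = 1")
  case True
  then obtain C where C: "\<And>v :: real ^ 'n \<Rightarrow> real. v \<in> A_class 1 \<Longrightarrow> family_bound p \<beta> C (A_const 1 v) v"
    using family_bound_p_eq_1[of \<beta>] assms(2) by auto
  \<comment> \<open>For p = 1 both assertions are the same inequality.\<close>
  have "alpha p \<beta> = 1" using True by (simp add: alpha_def)
  with C True show ?thesis
    by (intro conjI level_sup_bound_of_family_bound[where C=C] assms(1)) auto
next
  case False
  then have p: "1 < p" using assms(1) by simp
  then have ne: "\<beta> \<noteq> 1 / p" using assms(2) by (simp add: Omega_def)
  obtain C where C: "\<And>v :: real ^ 'n \<Rightarrow> real. v \<in> A_class p \<Longrightarrow> family_bound p \<beta> C (ennpow (A_const p v) (alpha p \<beta>)) v"
    using family_bound_p_gt_1[OF p assms(2)] by blast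
  \<comment> \<open>For p > 1 the first assertion comes from truncation for all \<beta> \<noteq> 1/p
    at once, which keeps the A_1 constant linear even where the second assertion has the power p/(p
    - 1).\<close>
  show ?thesis
    using level_sup_bound_of_family_bound[OF assms(1) family_bound_A1[OF p ne]]
      level_sup_bound_of_family_bound[OF assms(1) C] by (rule conjI)
qed

end
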